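(* Let $\lambda=(\lambda_1>\dots>\lambda_{2\ell}\ge0)$ be a strict partition (augmented by a part $0$ if it has an odd number of positive parts), with signed index set $I_\lambda$, and let $r=(r_{i,j})$ be complex constants indexed by pairs $i,j\in I_\lambda$ with $i>|j|$. Let $\tau_{\mathrm{BKP}}(\mathbf t_B;w_\lambda)$ be the $\tau$-function of the BKP hierarchy associated with $L_\lambda(r)$. Then, up to a nonzero constant factor, $\tau_{\mathrm{BKP}}(\mathbf t_B;w_\lambda)=\mathrm{Pf}(W_\lambda)$, where $W_\lambda$ is the skew-symmetric matrix $$W_\lambda=\sum_{j>i\ge0}Q_{j,i}(\mathbf t_B)(\tilde E_{-i,-j}-\tilde E_{-j,-i})+\sum_{\substack{i\in I_\lambda\\ i>0}}(\tilde E_{-i,i}-\tilde E_{i,-i})+\sum_{\substack{i,j\in I_\lambda\\ i>|j|}}(-1)^{\min\{0,j\}}r_{i,j}(\tilde E_{i,j}-\tilde E_{j,i})$$ $$\qquad+\sum_{j=1}^{\ell}(\tilde E_{\lambda_{2j},\lambda_{2j-1}}-\tilde E_{\lambda_{2j-1},\lambda_{2j}})+(1-\delta_{\lambda_{2\ell},0})(\tilde E_{-0,+0}-\tilde E_{+0,-0}).$$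
   Context: Index set: $A=(\dots,-2,-1,-0,+0,1,2,\dots)$, totally ordered as written; $-0\ne+0$, negation exchanges them, $|\pm0|=0$, and neither counts as $>0$. Matrices have rows and columns labelled by $A$ in this order; $\tilde E_{i,j}$ is the matrix unit. For $i,j\notin\{+0,-0\}$ put $E_{i,j}=\tilde E_{i,j}$; $E_{i,0}=\tilde E_{i,+0}+\tilde E_{i,-0}$, $E_{0,i}=\tilde E_{+0,i}+\tilde E_{-0,i}$. Index set of $\lambda$: $I_\lambda\subset A$ contains, for each integer $j\ge0$, $-j$ if $j\in\{\lambda_1,\dots,\lambda_{2\ell}\}$ and $+j$ otherwise. In $r_{i,j}$ and $E_{i,j}$ an index $\pm0$ is read as $0$. In $W_\lambda$: in the first sum $-i$ with $i=0$ means $-0$; in the $r$-sum, $\tilde E_{i,j}$ with $j=\pm0\in I_\lambda$ keeps its sign ($\min\{0,\pm0\}=0$); in the sum over $1\le j\le\ell$ a part equal to $0$ means the index $+0$; if $\lambda=\emptyset$ the factor $1-\delta_{\lambda_{2\ell},0}$ is $1$. Schur-$Q$ functions: $\mathbf t_B=(t_1,t_3,\dots)$, $\exp(\sum_{k\text{ odd}}t_kz^k)=\sum_iq_i(\mathbf t_B)z^i$; for $a>b\ge1$, $Q_{a,b}=\frac12q_aq_b+\sum_{k=1}^b(-1)^kq_{a+k}q_{b-k}$; $Q_{a,0}=\frac1{\sqrt2}q_a$ for $a\ge 1$. Infinite Pfaffian: $\mathrm{Pf}(W_\lambda)$ is the limit as $n\to\infty$ of the Pfaffians of the $(2n+2)\times(2n+2)$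 truncations of $W_\lambda$ to the labels $-n,\dots,-1,-0,+0,1,\dots,n$, in $\mathbb C[[t_1,t_3,\dots]]$ with the topology of the grading $\deg t_k=k$. The associated point: $\hat V$ is the space of formal vectors $x=\sum_{\alpha\in A}x_\alpha e_\alpha$ with $x_\alpha=0$ for all sufficiently negative $\alpha$, with quadratic form $\sum_{k\ge0}(-1)^kx_{+k}x_{-k}$ and Gram matrix $\tilde M=\sum_{k\ge0}(-1)^k(\tilde E_{+k,-k}+\tilde E_{-k,+k})$. Put $$L_\lambda(r)=\tilde M+\sum_{i,j\in I_\lambda,\ i>|j|}r_{i,j}[E_{i,j}-E_{j,i}]-\sum_{i,j\in I_\lambda,\ i,j>0}r_{i,0}r_{j,0}E_{i,j},$$ and let $U\subset\hat V$ be the (isotropic) span of the columns of $L_\lambda(r)$ with labels in $I_\lambda$. The $\tau$-function: define operators $X_\alpha$ ($\alpha\in\mathbb Z$) on $\mathbb C[[t_1,t_3,\dots]]$ (the neutral-fermion realization of the spin representation, i.e. the type $B$ boson-fermion correspondence) by $$\sum_{\alpha\in\mathbb Z}X_\alpha z^\alpha=\tfrac1{\sqrt2}\exp\Big(\sum_{k\text{ odd}}t_kz^k\Big)\exp\Big(-2\sum_{k\text{ odd}}\tfrac{z^{-k}}{k}\tfrac{\partial}{\partial t_k}\Big).$$ For $x\in\hat V$ with $x_{-0}=x_{+0}$ let $X(x)=\sqrt2\,x_{-0}X_0+\sum_{\alpha\neq\pm0}x_\alpha X_\alpha$. The BKP $\tau$-function associated with $L_\lambda(r)$ is the nonzero element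 of $\mathbb C[[t_1,t_3,\dots]]$, unique up to a nonzero constant, annihilated by $X(x)$ for all $x\in U$ with $x_{-0}=x_{+0}$. *)

theory Defs
  imports
    "HOL-Analysis.Analysis"
    "HOL-Library.Multiset"
    "HOL-Combinatorics.Permutations"
    "HOL-Computational_Algebra.Formal_Power_Series"
begin

section \<open>The ring of formal power series in $t_1, t_3, t_5, \dots$\<close>

text \<open>
  A monomial in \<open>t\<^sub>1, t\<^sub>3, t\<^sub>5, \<dots>\<close> is a multiset of natural numbers, in which \<open>j\<close> stands
  for the variable with (odd) index \<open>2 * j + 1\<close>.
\<close>

typedef tseries = "UNIV :: (nat multiset \<Rightarrow> complex) set"
  morphisms coeff Tseries
  by simp

lemma coeff_Tseries [simp]: "coeff (Tseries f) = f"
  by (simp add: Tseries_inverse)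

lemma tseries_eqI: "(\<And>m. coeff f m = coeff g m) \<Longrightarrow> f = g"
  by (metis coeff_inject ext)

lemma tseries_eq_iff: "f = g \<longleftrightarrow> (\<forall>m. coeff f m = coeff g m)"
  by (auto intro: tseries_eqI)

definition weight :: "nat multiset \<Rightarrow> nat"
  where "weight m = (\<Sum>j\<in>#m. 2 * j + 1)"

lemma finite_submultisets: "finite {a. a \<subseteq># (m :: nat multiset)}"
proof -
  have "{a. a \<subseteq># m} \<subseteq> (\<Union>k\<in>{..size m}. multisets_of_size (set_mset m) k)"
    by (auto simp: multisets_of_size_def dest: mset_subset_eqD size_mset_mono)
  then show ?thesis
    by (rule finite_subset) auto
qed

instantiation tseries :: comm_ring_1
begin

definition "0 = Tseries (\<lambda>m. 0)"
definition "1 = Tseries (\<lambda>m. if m = {#} then 1 else 0)"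
definition "f + g = Tseries (\<lambda>m. coeff f m + coeff g m)"
definition "- f = Tseries (\<lambda>m. - coeff f m)"
definition "f - g = Tseries (\<lambda>m. coeff f m - coeff g m)"
definition "f * g = Tseries (\<lambda>m. \<Sum>a | a \<subseteq># m. coeff f a * coeff g (m - a))"

instance
proof
  fix f g h :: tseries
  show "f + g + h = f + (g + h)" "f + g = g + f" "0 + f = f" "- f + f = 0" "f - g = f + - g"
    by (simp_all add: plus_tseries_def zero_tseries_def uminus_tseries_def minus_tseries_def
        tseries_eq_iff)
  show "(f + g) * h = f * h + g * h"
    by (simp add: plus_tseries_def times_tseries_def tseries_eq_iff sum.distrib algebra_simps)
  show "f * g = g * f"
  proof (rule tseries_eqI)
    fix m
    have "(\<Sum>a | a \<subseteq># m. coeff f a * coeff g (m - a)) = (\<Sum>a | a \<subseteq># m. coeff g a * coeff f (m - a))"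
      by (rule sum.reindex_bij_witness[where i = "\<lambda>a. m - a" and j = "\<lambda>a. m - a"])
        (auto simp: subset_mset.le_iff_add mult.commute)
    then show "coeff (f * g) m = coeff (g * f) m"
      by (simp add: times_tseries_def)
  qed
  show "1 * f = f"
  proof (rule tseries_eqI)
    fix m
    have "(\<Sum>a | a \<subseteq># m. (if a = {#} then 1 else 0) * coeff f (m - a))
        = (\<Sum>a | a \<subseteq># m. if a = {#} then coeff f m else 0)"
      by (rule sum.cong) auto
    also have "\<dots> = coeff f m"
      by (subst sum.delta) (auto simp: finite_submultisets)
    finally show "coeff (1 * f) m = coeff f m"
      by (simp add: times_tseries_def one_tseries_def)
  qed
  show "f * g * h = f * (g * h)"
  proof (rule tseries_eqI)
    fix m
    have "coeff (f * g * h) m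
        = (\<Sum>(c, a)\<in>(SIGMA c:{c. c \<subseteq># m}. {a. a \<subseteq># c}). coeff f a * coeff g (c - a) * coeff h (m - c))"
      by (simp add: times_tseries_def sum_distrib_right sum.Sigma finite_submultisets)
    also have "\<dots> = (\<Sum>(a, b)\<in>(SIGMA a:{a. a \<subseteq># m}. {b. b \<subseteq># m - a}).
        coeff f a * (coeff g b * coeff h (m - a - b)))"
    proof (rule sum.reindex_bij_witness[where i = "\<lambda>(a, b). (a + b, a)" and j = "\<lambda>(c, a). (a, c - a)"])
      fix p assume "p \<in> (SIGMA c:{c. c \<subseteq># m}. {a. a \<subseteq># c})"
      then obtain c a where p: "p = (c, a)" "a \<subseteq># c" "c \<subseteq># m" by auto
      from p(2) obtain b where b: "c = a + b" by (metis subset_mset.le_iff_add)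
      from p(3) obtain d where d: "m = c + d" by (metis subset_mset.le_iff_add)
      show "(case (case p of (c, a) \<Rightarrow> (a, c - a)) of (a, b) \<Rightarrow> (a + b, a)) = p"
        "(case p of (c, a) \<Rightarrow> (a, c - a)) \<in> (SIGMA a:{a. a \<subseteq># m}. {b. b \<subseteq># m - a})"
        "(case (case p of (c, a) \<Rightarrow> (a, c - a)) of (a, b) \<Rightarrow>
            coeff f a * (coeff g b * coeff h (m - a - b)))
          = (case p of (c, a) \<Rightarrow> coeff f a * coeff g (c - a) * coeff h (m - c))"
        by (simp_all add: p(1) b d add.assoc mult.assoc)
    next
      fix p assume "p \<in> (SIGMA a:{a. a \<subseteq># m}. {b. b \<subseteq># m - a})"
      then obtain a b where p: "p = (a, b)" "a \<subseteq># m" "b \<subseteq># m - a" by auto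
      from p(2) obtain d where d: "m = a + d" by (metis subset_mset.le_iff_add)
      with p(3) obtain e where e: "d = b + e"
        by (metis add_diff_cancel_left' subset_mset.le_iff_add)
      show "(case (case p of (a, b) \<Rightarrow> (a + b, a)) of (c, a) \<Rightarrow> (a, c - a)) = p"
        "(case p of (a, b) \<Rightarrow> (a + b, a)) \<in> (SIGMA c:{c. c \<subseteq># m}. {a. a \<subseteq># c})"
        by (simp_all add: p(1) d e add.assoc)
    qed
    also have "\<dots> = coeff (f * (g * h)) m"
      by (simp add: times_tseries_def sum_distrib_left sum.Sigma finite_submultisets)
    finally show "coeff (f * g * h) m = coeff (f * (g * h)) m" .
  qed
  show "(0 :: tseries) \<noteq> 1"
    by (simp add: zero_tseries_def one_tseries_def tseries_eq_iff exI[of _ "{#}"])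
qed

end

text \<open>The topology of the grading \<open>deg t\<^sub>k = k\<close>.\<close>

instantiation tseries :: t2_space
begin

definition open_tseries :: "tseries set \<Rightarrow> bool" where
  "open S \<longleftrightarrow> (\<forall>f\<in>S. \<exists>N. \<forall>g. (\<forall>m. weight m \<le> N \<longrightarrow> coeff g m = coeff f m) \<longrightarrow> g \<in> S)"

instance
proof
  show "open (UNIV :: tseries set)"
    by (simp add: open_tseries_def)
next
  fix S T :: "tseries set"
  assume S: "open S" and T: "open T"
  show "open (S \<inter> T)"
    unfolding open_tseries_def
  proof
    fix f assume f: "f \<in> S \<inter> T"
    obtain M where M: "\<And>g. (\<forall>m. weight m \<le> M \<longrightarrow> coeff g m = coeff f m) \<Longrightarrow> g \<in> S"
      using S f unfolding open_tseries_def by blast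
    obtain N where N: "\<And>g. (\<forall>m. weight m \<le> N \<longrightarrow> coeff g m = coeff f m) \<Longrightarrow> g \<in> T"
      using T f unfolding open_tseries_def by blast
    show "\<exists>N. \<forall>g. (\<forall>m. weight m \<le> N \<longrightarrow> coeff g m = coeff f m) \<longrightarrow> g \<in> S \<inter> T"
      by (rule exI[of _ "max M N"]) (auto intro: M N)
  qed
next
  fix K :: "tseries set set"
  assume K: "\<forall>S\<in>K. open S"
  show "open (\<Union>K)"
    unfolding open_tseries_def
  proof
    fix f assume "f \<in> \<Union>K"
    then obtain S where S: "S \<in> K" "f \<in> S" by blast
    then obtain N where "\<forall>g. (\<forall>m. weight m \<le> N \<longrightarrow> coeff g m = coeff f m) \<longrightarrow> g \<in> S"
      using K unfolding open_tseries_def by blast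
    with S(1) show "\<exists>N. \<forall>g. (\<forall>m. weight m \<le> N \<longrightarrow> coeff g m = coeff f m) \<longrightarrow> g \<in> \<Union>K"
      by blast
  qed
next
  fix f g :: tseries
  assume "f \<noteq> g"
  then obtain m where m: "coeff f m \<noteq> coeff g m" by (auto simp: tseries_eq_iff)
  let ?B = "\<lambda>f. {h. coeff h m = coeff f m}"
  have "open (?B f)" for f
    unfolding open_tseries_def by (auto intro!: exI[of _ "weight m"])
  moreover have "?B f \<inter> ?B g = {}" using m by auto
  ultimately show "\<exists>U V. open U \<and> open V \<and> f \<in> U \<and> g \<in> V \<and> U \<inter> V = {}"
    by (intro exI[of _ "?B f"] exI[of _ "?B g"]) auto
qed

end

lemma open_tseries_nbhd: "open {h. \<forall>m. weight m \<le> N \<longrightarrow> coeff h m = coeff f m}"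
  unfolding open_tseries_def by (auto intro!: exI[of _ N])

lemma tendsto_tseries_iff:
  "(F \<longlongrightarrow> f) G \<longleftrightarrow> (\<forall>N. eventually (\<lambda>n. \<forall>m. weight m \<le> N \<longrightarrow> coeff (F n) m = coeff f m) G)"
proof
  assume F: "(F \<longlongrightarrow> f) G"
  show "\<forall>N. eventually (\<lambda>n. \<forall>m. weight m \<le> N \<longrightarrow> coeff (F n) m = coeff f m) G"
  proof
    fix N
    show "eventually (\<lambda>n. \<forall>m. weight m \<le> N \<longrightarrow> coeff (F n) m = coeff f m) G"
      using topological_tendstoD[OF F open_tseries_nbhd[of N f]] by simp
  qed
next
  assume *: "\<forall>N. eventually (\<lambda>n. \<forall>m. weight m \<le> N \<longrightarrow> coeff (F n) m = coeff f m) G"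
  show "(F \<longlongrightarrow> f) G"
  proof (rule topological_tendstoI)
    fix S assume "open S" "f \<in> S"
    then obtain N where N: "\<And>g. (\<forall>m. weight m \<le> N \<longrightarrow> coeff g m = coeff f m) \<Longrightarrow> g \<in> S"
      unfolding open_tseries_def by blast
    show "eventually (\<lambda>n. F n \<in> S) G"
      using *[rule_format, of N] by (rule eventually_mono) (rule N)
  qed
qed

instance tseries :: topological_comm_monoid_add
proof
  fix a b :: tseries
  show "((\<lambda>p. fst p + snd p) \<longlongrightarrow> a + b) (nhds a \<times>\<^sub>F nhds b)"
    unfolding tendsto_tseries_iff
  proof
    fix N
    let ?P = "\<lambda>a h. \<forall>m. weight m \<le> N \<longrightarrow> coeff h m = coeff a m"
    have "eventually (?P f) (nhds f)" for f
      unfolding eventually_nhds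
      by (rule exI[of _ "{h. ?P f h}"]) (use open_tseries_nbhd[of N f] in simp)
    then have "eventually (\<lambda>p. ?P a (fst p) \<and> ?P b (snd p)) (nhds a \<times>\<^sub>F nhds b)"
      unfolding eventually_prod_filter by (intro exI[of _ "?P a"] exI[of _ "?P b"]) simp
    then show "eventually (\<lambda>p. \<forall>m. weight m \<le> N \<longrightarrow>
        coeff (fst p + snd p) m = coeff (a + b) m) (nhds a \<times>\<^sub>F nhds b)"
      by (rule eventually_mono) (simp add: plus_tseries_def)
  qed
qed

definition tconst :: "complex \<Rightarrow> tseries"
  where "tconst c = Tseries (\<lambda>m. if m = {#} then c else 0)"

text \<open>The variable \<open>t\<^sub>k\<close> and the derivation \<open>\<partial>/\<partial>t\<^sub>k\<close>; only odd \<open>k\<close> are meaningful.\<close>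

definition tvar :: "nat \<Rightarrow> tseries"
  where "tvar k = Tseries (\<lambda>m. if m = {#k div 2#} then 1 else 0)"

definition tderiv :: "nat \<Rightarrow> tseries \<Rightarrow> tseries"
  where "tderiv k f =
    Tseries (\<lambda>m. of_nat (count m (k div 2) + 1) * coeff f (add_mset (k div 2) m))"


section \<open>Schur Q-functions\<close>

text \<open>The power series variable is \<open>z\<close>; the left factor of the composition is \<open>exp\<close>.\<close>

definition q_series :: "tseries fps"
  where "q_series =
    Abs_fps (\<lambda>n. tconst (1 / fact n)) oo Abs_fps (\<lambda>k. if odd k then tvar k else 0)"

definition q :: "nat \<Rightarrow> tseries"
  where "q i = fps_nth q_series i"

text \<open>Only used for \<open>a > b\<close>.\<close>

definition schurQ :: "nat \<Rightarrow> nat \<Rightarrow> tseries"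
  where "schurQ a b =
    (if b = 0 then tconst (1 / complex_of_real (sqrt 2)) * q a
     else tconst (1 / 2) * q a * q b + (\<Sum>k = 1..b. (- 1) ^ k * q (a + k) * q (b - k)))"


section \<open>Neutral fermion operators\<close>

text \<open>
  \<open>dpow j n\<close> is the coefficient of \<open>z\<close> to the power \<open>- n\<close> in the \<open>j\<close>-th power of
  \<open>- 2 * (\<Sum>k odd. z powi (- k) / k * \<partial>/\<partial>t\<^sub>k)\<close>, and \<open>dexp n\<close> the one in its exponential. As this
  Laurent series has no terms of degree above \<open>- 1\<close>, only the powers \<open>j \<le> n\<close> contribute.
\<close>

primrec dpow :: "nat \<Rightarrow> nat \<Rightarrow> tseries \<Rightarrow> tseries" where
  "dpow 0 n f = (if n = 0 then f else 0)"
| "dpow (Suc j) n f =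
    (\<Sum>k | 1 \<le> k \<and> k \<le> n \<and> odd k. tconst (- 2 / of_nat k) * tderiv k (dpow j (n - k) f))"

definition dexp :: "nat \<Rightarrow> tseries \<Rightarrow> tseries"
  where "dexp n f = (\<Sum>j\<le>n. tconst (1 / fact j) * dpow j n f)"

definition X_op :: "int \<Rightarrow> tseries \<Rightarrow> tseries"
  where "X_op \<alpha> f = tconst (1 / complex_of_real (sqrt 2)) *
    (\<Sum>\<^sub>\<infinity>n\<in>{n :: nat. 0 \<le> \<alpha> + int n}. q (nat (\<alpha> + int n)) * dexp n f)"


section \<open>Labels and matrices\<close>

text \<open>
  The index set \<open>A\<close>: \<open>Neg k\<close> is \<open>- k\<close> and \<open>Pos k\<close> is \<open>+ k\<close>, so \<open>Neg 0\<close> and \<open>Pos 0\<close> are the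
  two zeros. The function \<open>ival\<close> reads both of them as the integer \<open>0\<close>.
\<close>

datatype label = Neg nat | Pos nat

fun lneg :: "label \<Rightarrow> label" where
  "lneg (Neg k) = Pos k"
| "lneg (Pos k) = Neg k"

fun ival :: "label \<Rightarrow> int" where
  "ival (Neg k) = - int k"
| "ival (Pos k) = int k"

text \<open>The \<open>p\<close>-th entry (from \<open>0\<close>) of the increasing sequence \<open>-n, \<dots>, -1, -0, +0, 1, \<dots>, n\<close>.\<close>

definition trunc_label :: "nat \<Rightarrow> nat \<Rightarrow> label"
  where "trunc_label n p = (if p \<le> n then Neg (n - p) else Pos (p - (n + 1)))"

type_synonym 'a lmat = "label \<Rightarrow> label \<Rightarrow> 'a"

definition Et :: "label \<Rightarrow> label \<Rightarrow> 'a :: zero_neq_one lmat"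
  where "Et i j \<alpha> \<beta> = (if \<alpha> = i \<and> \<beta> = j then 1 else 0)"

text \<open>
  The matrix \<open>E\<^sub>i\<^sub>,\<^sub>j\<close> for integers \<open>i, j\<close> that are not both \<open>0\<close>: summing the units over all labels
  read as \<open>i\<close> and as \<open>j\<close> gives two units if one of the indices is \<open>0\<close>.
\<close>

definition E :: "int \<Rightarrow> int \<Rightarrow> complex lmat"
  where "E i j \<alpha> \<beta> = (\<Sum>i' | ival i' = i. \<Sum>j' | ival j' = j. Et i' j' \<alpha> \<beta>)"

definition I_set :: "nat list \<Rightarrow> label set"
  where "I_set lam = {Neg j | j. j \<in> set lam} \<union> {Pos j | j. j \<notin> set lam}"

definition M_mat :: "complex lmat"
  where "M_mat \<alpha> \<beta> =
    (\<Sum>\<^sub>\<infinity>k :: nat. (- 1) ^ k * (Et (Pos k) (Neg k) \<alpha> \<beta> + Et (Neg k) (Pos k) \<alpha> \<beta>))"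

text \<open>
  Infinite sums of matrices are taken entrywise; each entry has only finitely many nonzero
  contributions. Of \<open>r\<close>, only the values at \<open>(ival i, ival j)\<close> for \<open>i\<close> and \<open>j\<close> in the index set
  with \<open>i > \<bar>j\<bar>\<close> are used.
\<close>

definition L_mat :: "nat list \<Rightarrow> (int \<Rightarrow> int \<Rightarrow> complex) \<Rightarrow> complex lmat"
  where "L_mat lam r \<alpha> \<beta> =
    M_mat \<alpha> \<beta>
    + (\<Sum>\<^sub>\<infinity>(i, j)\<in>{(i, j). i \<in> I_set lam \<and> j \<in> I_set lam \<and> ival i > \<bar>ival j\<bar>}.
        r (ival i) (ival j) * (E (ival i) (ival j) \<alpha> \<beta> - E (ival j) (ival i) \<alpha> \<beta>))
    - (\<Sum>\<^sub>\<infinity>(i, j)\<in>{(i, j). i \<in> I_set lam \<and> j \<in> I_set lam \<and> ival i > 0 \<and> ival j > 0}.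
        r (ival i) 0 * r (ival j) 0 * E (ival i) (ival j) \<alpha> \<beta>)"

text \<open>The finite linear combinations of the columns with labels in the index set.\<close>

definition U_space :: "nat list \<Rightarrow> (int \<Rightarrow> int \<Rightarrow> complex) \<Rightarrow> (label \<Rightarrow> complex) set"
  where "U_space lam r =
    {x. \<exists>B c. finite B \<and> B \<subseteq> I_set lam \<and> x = (\<lambda>\<alpha>. \<Sum>\<beta>\<in>B. c \<beta> * L_mat lam r \<alpha> \<beta>)}"

text \<open>
  Meaningful for vectors whose components vanish at all sufficiently negative labels, such as the
  elements of \<open>U_space\<close>: then the sum converges, since \<open>X_op \<alpha>\<close> raises the degree by \<open>\<alpha>\<close> or more.
\<close>

definition X_vec :: "(label \<Rightarrow> complex) \<Rightarrow> tseries \<Rightarrow> tseries"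
  where "X_vec x f =
    tconst (complex_of_real (sqrt 2) * x (Neg 0)) * X_op 0 f
    + (\<Sum>\<^sub>\<infinity>\<alpha>\<in>{\<alpha>. \<alpha> \<noteq> Neg 0 \<and> \<alpha> \<noteq> Pos 0}. tconst (x \<alpha>) * X_op (ival \<alpha>) f)"

definition is_BKP_tau :: "nat list \<Rightarrow> (int \<Rightarrow> int \<Rightarrow> complex) \<Rightarrow> tseries \<Rightarrow> bool"
  where "is_BKP_tau lam r \<tau> \<longleftrightarrow>
    \<tau> \<noteq> 0 \<and> (\<forall>x\<in>U_space lam r. x (Neg 0) = x (Pos 0) \<longrightarrow> X_vec x \<tau> = 0)"


section \<open>Pfaffians\<close>

text \<open>
  The Pfaffian of the skew-symmetric \<open>2n\<close> by \<open>2n\<close> matrix with rows and columns \<open>0, \<dots>, 2n - 1\<close>,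
  as a sum over perfect matchings.
\<close>

definition pfaffian :: "nat \<Rightarrow> (nat \<Rightarrow> nat \<Rightarrow> 'a) \<Rightarrow> 'a :: comm_ring_1"
  where "pfaffian n a =
    (\<Sum>\<sigma> | \<sigma> permutes {..<2 * n} \<and> (\<forall>i<n. \<sigma> (2 * i) < \<sigma> (2 * i + 1))
          \<and> (\<forall>i. i + 1 < n \<longrightarrow> \<sigma> (2 * i) < \<sigma> (2 * (i + 1))).
      of_int (sign \<sigma>) * (\<Prod>i<n. a (\<sigma> (2 * i)) (\<sigma> (2 * i + 1))))"

definition Pf_trunc :: "tseries lmat \<Rightarrow> nat \<Rightarrow> tseries"
  where "Pf_trunc W n = pfaffian (n + 1) (\<lambda>p q. W (trunc_label n p) (trunc_label n q))"

definition Pf_inf :: "tseries lmat \<Rightarrow> tseries"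
  where "Pf_inf W = lim (Pf_trunc W)"

text \<open>The part \<open>\<lambda>\<^sub>j\<close>, counting from \<open>j = 1\<close>.\<close>

abbreviation part :: "nat list \<Rightarrow> nat \<Rightarrow> nat"
  where "part lam j \<equiv> lam ! (j - 1)"

definition W_mat :: "nat list \<Rightarrow> (int \<Rightarrow> int \<Rightarrow> complex) \<Rightarrow> tseries lmat"
  where "W_mat lam r \<alpha> \<beta> =
    (\<Sum>\<^sub>\<infinity>(j, i)\<in>{(j, i). j > i}.
        schurQ j i * (Et (Neg i) (Neg j) \<alpha> \<beta> - Et (Neg j) (Neg i) \<alpha> \<beta>))
    + (\<Sum>\<^sub>\<infinity>i\<in>{i \<in> I_set lam. ival i > 0}. Et (lneg i) i \<alpha> \<beta> - Et i (lneg i) \<alpha> \<beta>)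
    + (\<Sum>\<^sub>\<infinity>(i, j)\<in>{(i, j). i \<in> I_set lam \<and> j \<in> I_set lam \<and> ival i > \<bar>ival j\<bar>}.
        tconst ((- 1) powi min 0 (ival j) * r (ival i) (ival j)) * (Et i j \<alpha> \<beta> - Et j i \<alpha> \<beta>))
    + (\<Sum>j = 1..length lam div 2.
        Et (Pos (part lam (2 * j))) (Pos (part lam (2 * j - 1))) \<alpha> \<beta>
        - Et (Pos (part lam (2 * j - 1))) (Pos (part lam (2 * j))) \<alpha> \<beta>)
    + (if lam \<noteq> [] \<and> last lam = 0 then 0
       else Et (Neg 0) (Pos 0) \<alpha> \<beta> - Et (Pos 0) (Neg 0) \<alpha> \<beta>)"

end

theory Submission
  imports Defs
begin

text \<open>
  The neutral fermion field is multiplication by the generating series of the \<open>q\<^sub>i\<close> composed with a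
  ring homomorphism (the shift of the times), and this shift changes the matrix of the \<open>Q\<^sub>i\<^sub>j\<close> by an
  alternating form of rank two. Hence every fermion operator acts on a truncation of
  \<open>Pf W\<^sub>\<lambda>\<close> by bordering the matrix with two rows. For a column of \<open>L\<^sub>\<lambda>(r)\<close> one of the new rows is a
  linear combination of the rows of \<open>W\<^sub>\<lambda>\<close>, so the bordered Pfaffian vanishes.

  For uniqueness, let \<open>\<langle>\<lambda>|\<close> be the constant term after applying the annihilation operators of the
  positive parts of \<open>\<lambda>\<close>. It is killed by \<open>X\<^sub>\<alpha>\<close> for all nonzero \<open>\<alpha>\<close> in \<open>I\<^sub>\<lambda>\<close>. The column labelled
  \<open>\<beta>\<close> expresses \<open>X\<^bsub>-\<beta>\<^esub> \<tau>\<close> through such \<open>X\<^sub>\<alpha> \<tau>\<close>, and the Clifford relations move these to the left, so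
  \<open>\<langle>\<lambda>|\<tau>\<close> determines all matrix elements of \<open>\<tau>\<close> by induction on the length of the word.
  Finally \<open>\<langle>\<lambda>|Pf W\<^sub>\<lambda> = \<plusminus>1\<close>: the operators strike out the labels of the parts, and at \<open>t = 0\<close> exactly
  one perfect matching of the rest survives.
\<close>

section \<open>Pfaffians along a list of labels\<close>

text \<open>Let Q(z,w) = q(z) q(w) (z - w)/(2 (z + w)), expanded in w/z. The vertex operator shifts
  each odd time t_k by -2 u^k/k with u = 1/z', where z' is its own variable. This multiplies q(w) by
  s(w) = (1 - u w)/(1 + u w). The identity (s(z) s(w) - 1) (z - w)/(z + w) = s(z) - s(w) is why the
  shift changes the matrix of the Q by a form of rank two; the normalization of Q_{a,0} by 1/sqrt 2
  makes the index 0 obey the same rule. The kernel also yields the Clifford relations: its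
  expansions in w/z and in z/w differ by a delta function at z = -w, where q(z) q(w) = 1. The
  obstacle is that series, operator sums and the matrix are all infinite. The grading removes it:
  X_\<alpha> raises the degree by \<alpha>, a column of L has finitely many negative labels, and
  enlarging a truncation of W beyond n changes its Pfaffian only in degrees above n. Every claim is
  therefore checked on one coefficient at a time, with a finite truncation chosen for it.\<close>

definition del :: "nat \<Rightarrow> 'a list \<Rightarrow> 'a list"
  where "del k L = take k L @ drop (Suc k) L"

lemma length_del [simp]: "k < length L \<Longrightarrow> length (del k L) = length L - 1"
  by (simp add: del_def)

lemma nth_del: "k < length L \<Longrightarrow> i < length L - 1 \<Longrightarrow> del k L ! i = (if i < k then L ! i else L ! Suc i)"
  by (auto simp: del_def nth_append min_def)

lemma del_0 [simp]: "del 0 (a # L) = L"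
  and del_Suc [simp]: "del (Suc k) (a # L) = a # del k L"
  by (simp_all add: del_def)

lemma set_del_subset: "set (del k L) \<subseteq> set L"
  by (auto simp: del_def dest: in_set_takeD in_set_dropD)

lemma del_append: "del k (xs @ ys) = (if k < length xs then del k xs @ ys else xs @ del (k - length xs) ys)"
  by (auto simp: del_def Suc_diff_le not_less)

lemma del_map: "del k (map f L) = map f (del k L)"
  by (simp add: del_def take_map drop_map)

lemma del_del:
  assumes "l < k" "k < length L"
  shows "del l (del k L) = del (k - 1) (del l L)"
  using assms by (intro nth_equalityI) (auto simp: nth_del)

text \<open>Expansion along the head of a list of arbitrary labels makes bordering, deletion and
  reordering list operations. Only entries \<open>A c d\<close> with \<open>c\<close> before
  \<open>d\<close> are read, and lists of odd length get 0.\<close>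

function pf :: "('l \<Rightarrow> 'l \<Rightarrow> 'a) \<Rightarrow> 'l list \<Rightarrow> 'a :: comm_ring_1" where
  "pf A [] = 1"
| "pf A (a # L) = (\<Sum>k<length L. (- 1) ^ k * A a (L ! k) * pf A (del k L))"
  by pat_completeness auto
termination by (relation "Wellfounded.measure (\<lambda>(A, L). length L)") auto

declare pf.simps(2) [simp del]

lemma pf_cong:
  "(\<And>c d. c \<in> set L \<Longrightarrow> d \<in> set L \<Longrightarrow> A c d = B c d) \<Longrightarrow> pf A L = pf B L"
proof (induction "length L" arbitrary: L rule: less_induct)
  case less
  show ?case
  proof (cases L)
    case (Cons a M)
    have "pf A (del k M) = pf B (del k M)" if "k < length M" for k
      using that less.prems set_del_subset[of k M] by (intro less.hyps) (auto simp: Cons)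
    then show ?thesis using less.prems by (simp add: Cons pf.simps(2))
  qed simp
qed

lemma pf_map: "pf A (map f L) = pf (\<lambda>c d. A (f c) (f d)) L"
proof (induction "length L" arbitrary: L rule: less_induct)
  case less
  show ?case
    by (cases L) (simp_all add: pf.simps(2) less del_map)
qed

text \<open>Serves three homomorphisms: the shift \<open>tshift\<close>, the embedding
  \<open>fps_const\<close> and the constant term at t = 0.\<close>

lemma pf_hom:
  assumes "h 1 = 1" "h 0 = 0" "\<And>x y. h (x + y) = h x + h y" "\<And>x. h (- x) = - h x" "\<And>x y. h (x * y) = h x * h y"
  shows "h (pf A L) = pf (\<lambda>c d. h (A c d)) L"
proof (induction "length L" arbitrary: L rule: less_induct)
  case less
  have sum: "h (\<Sum>k\<in>K. g k) = (\<Sum>k\<in>K. h (g k))" if "finite K" for K :: "nat set" and g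
    using that by induction (simp_all add: assms)
  have pow: "h ((- 1) ^ k) = (- 1) ^ k" for k
    by (induction k) (simp_all add: assms)
  show ?case
    by (cases L) (simp_all add: pf.simps(2) less sum pow assms)
qed

section \<open>Pfaffians of alternating matrices: reordering, row combinations, bordering\<close>

locale alternating =
  fixes A :: "'l \<Rightarrow> 'l \<Rightarrow> 'a :: comm_ring_1"
  assumes skew: "A c d = - A d c" and diag: "A c c = 0"
begin

text \<open>The part of the expansion along two rows in which the partner of \<open>b\<close>
  precedes that of \<open>a\<close>. The other part is the same sum with the roles exchanged and the
  opposite sign, so \<open>pf_Cons_Cons\<close> exhibits the antisymmetry in \<open>a\<close> and
  \<open>b\<close>.\<close>

definition half :: "'l \<Rightarrow> 'l \<Rightarrow> 'l list \<Rightarrow> 'a" where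
  "half a b L = (\<Sum>(k, l)\<in>{(k, l). k < length L \<and> l < k}.
     (- 1) ^ (k + l) * A a (L ! k) * A b (L ! l) * pf A (del l (del k L)))"

lemma pf_Cons_Cons: "pf A (a # b # L) = A a b * pf A L - half a b L + half b a L"
proof -
  let ?n = "length L"
  let ?f = "\<lambda>a b k l. (- 1) ^ (k + l) * A a (L ! k) * A b (del k L ! l) * pf A (del l (del k L))"
  have "(\<Sum>k<?n. (- 1) ^ Suc k * A a (L ! k) * pf A (b # del k L)) =
      - (\<Sum>k<?n. \<Sum>l<?n-1. ?f a b k l)"
    unfolding sum_negf[symmetric]
    by (intro sum.cong) (simp_all add: pf.simps(2) sum_distrib_left power_add mult_ac flip: sum_negf)
  also have "(\<Sum>k<?n. \<Sum>l<?n-1. ?f a b k l) = (\<Sum>(k,l)\<in>{..<?n}\<times>{..<?n-1}. ?f a b k l)"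
    by (simp add: sum.cartesian_product)
  also have "{..<?n}\<times>{..<?n-1} = {(k, l). k < ?n \<and> l < k} \<union> {(k, l). k < ?n \<and> k \<le> l \<and> l < ?n-1}"
    by auto
  also have "(\<Sum>(k,l)\<in>\<dots>. ?f a b k l) = (\<Sum>(k,l)\<in>{(k, l). k < ?n \<and> l < k}. ?f a b k l)
      + (\<Sum>(k,l)\<in>{(k, l). k < ?n \<and> k \<le> l \<and> l < ?n-1}. ?f a b k l)"
    by (rule sum.union_disjoint)
      (auto intro: finite_subset[of _ "{..<?n}\<times>{..<?n}"])
  also have "(\<Sum>(k,l)\<in>{(k, l). k < ?n \<and> l < k}. ?f a b k l) = half a b L"
    unfolding half_def by (intro sum.cong) (auto simp: nth_del)
  \<comment> \<open>Position \<open>l\<close> of \<open>del k L\<close> is position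
    \<open>l + 1\<close> of \<open>L\<close> when \<open>k\<close> does not exceed \<open>l\<close>;
    the changed parity gives the minus sign.\<close>
  also have "(\<Sum>(k,l)\<in>{(k, l). k < ?n \<and> k \<le> l \<and> l < ?n-1}. ?f a b k l) = - half b a L"
    unfolding half_def sum_negf[symmetric]
    by (rule sum.reindex_bij_witness[where i = "\<lambda>(k, l). (l, k - 1)" and j = "\<lambda>(k, l). (l + 1, k)"])
      (auto simp: nth_del del_del mult_ac add.commute)
  finally show ?thesis
    by (simp add: pf.simps(2)[of _ a] sum.lessThan_Suc_shift del: sum.lessThan_Suc)
qed

text \<open>At the head this is the antisymmetry of \<open>pf_Cons_Cons\<close>. Behind a head
  \<open>x\<close>, the terms pairing \<open>x\<close> with \<open>a\<close> and with
  \<open>b\<close> change places and differ in sign because the positions are adjacent; every other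
  term deletes a label elsewhere and falls to the induction.\<close>

lemma pf_swap: "pf A (xs @ a # b # ys) = - pf A (xs @ b # a # ys)"
proof (induction "length xs + length ys" arbitrary: xs ys rule: less_induct)
  case less
  show ?case
  proof (cases xs)
    case Nil
    then show ?thesis by (simp add: pf_Cons_Cons skew[of b a])
  next
    case (Cons x zs)
    let ?n = "length zs + 2 + length ys" and ?m = "length zs"
    let ?t = "Transposition.transpose ?m (Suc ?m)"
    let ?L = "zs @ a # b # ys" and ?M = "zs @ b # a # ys"
    have *: "(- 1) ^ k * A x (?L ! k) * pf A (del k ?L) = - ((- 1) ^ ?t k * A x (?M ! ?t k) * pf A (del (?t k) ?M))"
      if "k < ?n" for k
    proof -
      consider "k < ?m" | "k = ?m" | "k = Suc ?m" | "k > Suc ?m" by linarith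
      then show ?thesis
      proof cases
        case 1
        then have "pf A (del k ?L) = - pf A (del k ?M)"
          using less[of "del k zs" ys] by (simp add: Cons del_append)
        with 1 show ?thesis by (simp add: nth_append transpose_apply_other)
      next
        case 4
        then obtain j where j: "k = ?m + Suc (Suc j)" by (metis add_Suc_right less_iff_Suc_add add_Suc)
        have "pf A (del k ?L) = - pf A (del k ?M)"
          using less[of zs "del j ys"] that by (simp add: Cons del_append j)
        with 4 show ?thesis by (simp add: nth_append transpose_apply_other j)
      qed (simp_all add: nth_append del_append Suc_diff_le)
    qed
    have "(\<Sum>k<?n. (- 1) ^ k * A x (?L ! k) * pf A (del k ?L))
       = (\<Sum>k<?n. - ((- 1) ^ k * A x (?M ! k) * pf A (del k ?M)))"
      by (rule sum.reindex_bij_witness[where i = ?t and j = ?t])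
        (use * in \<open>auto simp: Transposition.transpose_def\<close>)
    then show ?thesis
      by (simp add: Cons pf.simps(2) sum_negf)
  qed
qed

lemma pf_move: "pf A (xs @ ys @ a # zs) = (- 1) ^ length ys * pf A (xs @ a # ys @ zs)"
proof (induction ys arbitrary: zs rule: rev_induct)
  case (snoc y ys)
  show ?case using pf_swap[of "xs @ ys" y a zs] snoc[of "y # zs"] by simp
qed simp

lemma pf_repeated: "a \<in> set L \<Longrightarrow> pf A (a # L) = 0"
proof -
  assume "a \<in> set L"
  then obtain ys zs where L: "L = ys @ a # zs" by (auto simp: in_set_conv_decomp)
  show ?thesis using pf_move[of "[a]" ys a zs] by (simp add: L pf_Cons_Cons diag)
qed

lemma pf_perm:
  assumes "mset L = mset M"
  shows "\<exists>s\<in>{1, - 1}. pf A L = s * pf A M"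
proof -
  \<comment> \<open>The arbitrary prefix lets the induction hypothesis act behind the label just
    placed, with a sign independent of the prefix.\<close>
  have "\<exists>s\<in>{1, - 1}. \<forall>xs. pf A (xs @ L) = s * pf A (xs @ M)"
    using assms
  proof (induction L arbitrary: M)
    case (Cons a L)
    then have "a \<in> set M" by (metis list.set_intros(1) set_mset_mset)
    then obtain ys zs where M: "M = ys @ a # zs" by (auto simp: in_set_conv_decomp)
    with Cons.prems have "mset L = mset (ys @ zs)" by simp
    from Cons.IH[OF this] obtain s where s: "s \<in> {1, - 1}" "\<And>xs. pf A (xs @ L) = s * pf A (xs @ ys @ zs)"
      by blast
    show ?case
    proof (rule bexI[of _ "s * (- 1) ^ length ys"], rule allI)
      fix xs
      have "(- 1) ^ length ys * ((- 1) ^ length ys * x) = x" for x :: 'a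
        by (simp add: mult.assoc[symmetric] power_add[symmetric])
      then show "pf A (xs @ a # L) = s * (- 1) ^ length ys * pf A (xs @ M)"
        using s(2)[of "xs @ [a]"] by (simp add: M pf_move mult.assoc)
    next
      show "s * (- 1) ^ length ys \<in> {1, - 1}" using s(1) by (cases "even (length ys)") auto
    qed
  qed auto
  then obtain s where "s \<in> {1, - 1}" "\<And>xs. pf A (xs @ L) = s * pf A (xs @ M)" by blast
  from this(1) this(2)[of "[]"] show ?thesis by auto
qed

text \<open>Linearity in the first row splits the Pfaffian into Pfaffians whose head already occurs
  in \<open>L\<close>.\<close>

lemma pf_row_combination:
  assumes "C \<subseteq> set L" "\<And>d. d \<in> set L \<Longrightarrow> A a d = (\<Sum>c\<in>C. y c * A c d)"
  shows "pf A (a # L) = 0"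
proof -
  have "pf A (a # L) = (\<Sum>k<length L. \<Sum>c\<in>C. y c * ((- 1) ^ k * A c (L ! k) * pf A (del k L)))"
    unfolding pf.simps(2)
    by (intro sum.cong) (simp_all add: assms(2) sum_distrib_left sum_distrib_right mult_ac)
  also have "\<dots> = (\<Sum>c\<in>C. y c * pf A (c # L))"
    by (subst sum.swap) (simp add: pf.simps(2) sum_distrib_left)
  also have "\<dots> = 0"
    using assms(1) by (intro sum.neutral) (auto simp: pf_repeated)
  finally show ?thesis .
qed

text \<open>This is the Schur complement of the 2 by 2 block on \<open>a\<close> and
  \<open>b\<close>, whose Pfaffian is 1.\<close>

lemma pf_border:
  assumes ab: "A a b = 1"
  shows "pf A (a # b # L) = pf (\<lambda>c d. A c d - (A a c * A b d - A b c * A a d)) L"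
proof (induction "length L" arbitrary: L rule: less_induct)
  case less
  let ?C = "\<lambda>c d. A c d - (A a c * A b d - A b c * A a d)"
  show ?case
  proof (cases L)
    case Nil
    then show ?thesis using ab by (simp add: pf.simps(2))
  next
    case (Cons x M)
    let ?S = "\<lambda>f. \<Sum>k<length M. (- 1) ^ k * f (M ! k) * pf A (a # b # del k M)"
    have exp: "pf A (c # d # e # M) = A c d * pf A (e # M) - A c e * pf A (d # M)
        + (\<Sum>k<length M. (- 1) ^ k * A c (M ! k) * pf A (d # e # del k M))" for c d e
      by (simp add: pf.simps(2)[of _ c] sum.lessThan_Suc_shift del: sum.lessThan_Suc)
    \<comment> \<open>Expanding a vanishing Pfaffian with \<open>b\<close> repeated expresses
      \<open>pf A (b # M)\<close> by minors that contain both \<open>a\<close> and \<open>b\<close>,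
      where the induction hypothesis applies; the same is done for \<open>a\<close>.\<close>
    have b: "pf A (b # M) = ?S (A b)"
      using pf_repeated[of b "a # b # M"] exp[of b a b] ab skew[of b a] diag[of b]
      by simp
    have a: "pf A (a # M) = ?S (A a)"
      using pf_repeated[of a "a # b # M"] exp[of a a b] ab diag[of a] by simp
    have "pf A (a # b # x # M) = pf A (x # a # b # M)"
      using pf_move[of "[]" "[a, b]" x M] by simp
    also have "\<dots> = - A a x * ?S (A b) + A b x * ?S (A a) + ?S (A x)"
      using skew[of a x] skew[of b x] by (simp add: exp a b)
    also have "\<dots> = ?S (?C x)"
      by (simp add: sum_distrib_left sum.distrib[symmetric] sum_subtractf[symmetric] sum_negf[symmetric] algebra_simps)
    also have "\<dots> = pf ?C (x # M)"
      by (simp add: pf.simps(2)[of _ x] less Cons)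
    finally show ?thesis by (simp add: Cons)
  qed
qed

lemma pf_pair: "(\<And>d. d \<in> set L \<Longrightarrow> A a d = 0) \<Longrightarrow> pf A (a # b # L) = A a b * pf A L"
  by (simp add: pf.simps(2)[of _ a] sum.lessThan_Suc_shift del: sum.lessThan_Suc)

end

section \<open>The sum over perfect matchings, expanded along the first row\<close>

definition matchings :: "nat \<Rightarrow> (nat \<Rightarrow> nat) set" where
  "matchings n = {\<sigma>. \<sigma> permutes {..<2 * n} \<and> (\<forall>i<n. \<sigma> (2 * i) < \<sigma> (2 * i + 1))
          \<and> (\<forall>i. i + 1 < n \<longrightarrow> \<sigma> (2 * i) < \<sigma> (2 * (i + 1)))}"

text \<open>The cycle that sends position 1 to \<open>k + 1\<close>, the partner of 0, and keeps the
  order of the later positions. As a product of \<open>k\<close> adjacent transpositions it has the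
  sign of the corresponding term of the expansion.\<close>

primrec rot :: "nat \<Rightarrow> nat \<Rightarrow> nat" where
  "rot 0 = id"
| "rot (Suc k) = Transposition.transpose (Suc k) (Suc (Suc k)) \<circ> rot k"

lemma rot_permutes: "Suc k < m \<Longrightarrow> rot k permutes {..<m}"
  by (induction k) (auto intro!: permutes_compose permutes_swap_id simp: permutes_id)

lemma sign_rot: "sign (rot k) = (- 1) ^ k"
proof (induction k)
  case (Suc k)
  have "permutation (rot k)" using rot_permutes[of k "k + 2"] by (auto intro: permutation_permutes[THEN iffD2])
  then have "sign (rot (Suc k)) = sign (Transposition.transpose (Suc k) (Suc (Suc k))) * sign (rot k)"
    unfolding rot.simps by (intro sign_compose permutation_swap_id)
  then show ?case using Suc by (simp add: sign_swap_id del: rot.simps)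
qed simp

lemma rot_apply:
  "rot k 0 = 0" "rot k (Suc 0) = Suc k" "rot k (Suc (Suc p)) = (if p < k then Suc p else Suc (Suc p))"
  by (induction k) (auto simp: Transposition.transpose_def)

text \<open>Puts the pair 0, 1 in front of a matching. Each matching of 2n + 2 points is
  \<open>rot k\<close> after such a one in a unique way.\<close>

definition shift2 :: "(nat \<Rightarrow> nat) \<Rightarrow> nat \<Rightarrow> nat" where
  "shift2 \<tau> i = (if i < 2 then i else \<tau> (i - 2) + 2)"

lemma shift2_simps [simp]:
  "shift2 \<tau> 0 = 0" "shift2 \<tau> (Suc 0) = Suc 0" "shift2 \<tau> (Suc (Suc i)) = Suc (Suc (\<tau> i))"
  by (simp_all add: shift2_def)

lemma shift2_permutes_sign:
  assumes "\<tau> permutes {..<m}"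
  shows "shift2 \<tau> permutes {..<Suc (Suc m)} \<and> sign (shift2 \<tau>) = sign \<tau>"
  using assms finite_lessThan[of m]
proof (induction \<tau> rule: permutes_induct)
  case id
  have "shift2 id = id" by (auto simp: shift2_def fun_eq_iff)
  then show ?case by (simp only: sign_id permutes_id)
next
  case (swap a b p)
  have eq: "shift2 (Transposition.transpose a b \<circ> p) = Transposition.transpose (Suc (Suc a)) (Suc (Suc b)) \<circ> shift2 p"
    by (auto simp: shift2_def Transposition.transpose_def fun_eq_iff)
  have "permutation p" "permutation (shift2 p)"
    using swap by (auto intro: permutation_permutes[THEN iffD2])
  then have "sign (Transposition.transpose (Suc (Suc a)) (Suc (Suc b)) \<circ> shift2 p) = sign (Transposition.transpose a b \<circ> p)"
    using swap by (simp only: sign_compose permutation_swap_id sign_swap_id) simp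
  moreover have "Transposition.transpose (Suc (Suc a)) (Suc (Suc b)) \<circ> shift2 p permutes {..<Suc (Suc m)}"
    using swap by (intro permutes_compose permutes_swap_id) auto
  ultimately show ?case unfolding eq by blast
qed

text \<open>The point 0 is neither the larger member of a pair nor the smaller member of a later
  pair, because the smaller members increase.\<close>

lemma matchings_0: assumes "\<sigma> \<in> matchings (Suc n)" shows "\<sigma> 0 = 0"
proof -
  have \<sigma>: "\<sigma> permutes {..<2 * Suc n}" using assms by (simp add: matchings_def)
  obtain i where i: "\<sigma> i = 0" "i < 2 * Suc n"
    using permutes_image[OF \<sigma>] by (metis image_iff lessThan_iff nat_0_less_mult_iff zero_less_Suc zero_less_numeral)
  show ?thesis
  proof (cases "even i")
    case True
    then obtain j where j: "i = 2 * j" by blast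
    show ?thesis
    proof (cases j)
      case (Suc l)
      then show ?thesis using assms i j by (auto simp: matchings_def)
    qed (use i j in simp)
  next
    case False
    then obtain j where j: "i = 2 * j + 1" by (blast elim: oddE)
    then have "j < Suc n" using i by simp
    then have "\<sigma> (2 * j) < \<sigma> (2 * j + 1)" using assms by (auto simp: matchings_def)
    then show ?thesis using i j by simp
  qed
qed

lemma rot_shift2_in_matchings:
  assumes "\<tau> \<in> matchings n" "k < 2 * n + 1"
  shows "rot k \<circ> shift2 \<tau> \<in> matchings (Suc n)"
  unfolding matchings_def
proof (intro CollectI conjI allI impI)
  have \<tau>: "\<tau> permutes {..<2 * n}" using assms by (simp add: matchings_def)
  show "rot k \<circ> shift2 \<tau> permutes {..<2 * Suc n}"
    using assms shift2_permutes_sign[OF \<tau>] rot_permutes[of k "2 * Suc n"] by (auto intro: permutes_compose)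
  have mono: "rot k (Suc (Suc a)) < rot k (Suc (Suc b))" if "a < b" for a b
    using that by (auto simp: rot_apply)
  fix i
  show "(rot k \<circ> shift2 \<tau>) (2 * i) < (rot k \<circ> shift2 \<tau>) (2 * i + 1)" if "i < Suc n"
    using that assms(1) mono by (cases i) (auto simp: matchings_def rot_apply)
  show "(rot k \<circ> shift2 \<tau>) (2 * i) < (rot k \<circ> shift2 \<tau>) (2 * (i + 1))" if "i + 1 < Suc n"
    using that assms(1) mono by (cases i) (auto simp: matchings_def rot_apply(1,3) numeral_2_eq_2)
qed

lemma matchings_decompose:
  assumes "\<sigma> \<in> matchings (Suc n)"
  shows "\<exists>k<2 * n + 1. \<exists>\<tau>\<in>matchings n. \<sigma> = rot k \<circ> shift2 \<tau>"
proof -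
  have \<sigma>: "\<sigma> permutes {..<2 * Suc n}" using assms by (simp add: matchings_def)
  have 0: "\<sigma> 0 = 0" using matchings_0[OF assms] .
  have "0 < \<sigma> 1" using assms 0 by (fastforce simp: matchings_def)
  then obtain k where k: "\<sigma> (Suc 0) = Suc k" by (cases "\<sigma> 1") auto
  have kn: "k < 2 * n + 1" using permutes_in_image[OF \<sigma>, of 1] k by simp
  have rot: "rot k permutes {..<2 * Suc n}" using kn by (intro rot_permutes) simp
  \<comment> \<open>Undoing the cycle leaves a permutation that fixes 0 and 1, hence one of the form
    \<open>shift2 \<tau>\<close>.\<close>
  define \<rho> where "\<rho> = inv (rot k) \<circ> \<sigma>"
  have \<rho>: "\<rho> permutes {..<2 * Suc n}" unfolding \<rho>_def by (intro permutes_compose \<sigma> permutes_inv rot)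
  have \<rho>_eq: "\<rho> i = j \<longleftrightarrow> \<sigma> i = rot k j" for i j
    using permutes_inv_eq[OF rot] unfolding \<rho>_def by (metis comp_apply)
  have \<rho>0: "\<rho> 0 = 0" "\<rho> (Suc 0) = Suc 0" by (simp_all add: \<rho>_eq 0 k rot_apply)
  have \<rho>2: "\<exists>j. \<rho> (Suc (Suc i)) = Suc (Suc j)" for i
  proof -
    have "\<rho> (Suc (Suc i)) \<noteq> \<rho> 0" "\<rho> (Suc (Suc i)) \<noteq> \<rho> (Suc 0)"
      using permutes_inj[OF \<rho>] by (auto dest: injD)
    then show ?thesis unfolding \<rho>0 by (metis not0_implies_Suc)
  qed
  define \<tau> where "\<tau> i = \<rho> (i + 2) - 2" for i
  have \<tau>\<rho>: "\<rho> (Suc (Suc i)) = Suc (Suc (\<tau> i))" for i using \<rho>2[of i] by (auto simp: \<tau>_def)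
  have "\<rho> = shift2 \<tau>"
  proof
    fix i show "\<rho> i = shift2 \<tau> i"
    proof (cases "i < 2")
      case True
      then have "i = 0 \<or> i = Suc 0" by auto
      then show ?thesis using \<rho>0 by auto
    next
      case False
      then obtain j where "i = Suc (Suc j)" by (metis add_2_eq_Suc le_Suc_ex not_less)
      then show ?thesis by (simp add: \<tau>\<rho>)
    qed
  qed
  then have \<sigma>eq: "\<sigma> = rot k \<circ> shift2 \<tau>"
    using \<rho>_eq by (metis comp_apply ext)
  have \<sigma>2: "\<sigma> (Suc (Suc i)) = (if \<tau> i < k then Suc (\<tau> i) else Suc (Suc (\<tau> i)))" for i
    by (simp add: \<sigma>eq rot_apply)
  \<comment> \<open>On positions from 2 on, \<open>rot k\<close> is increasing, so the order
    conditions on \<sigma> descend to \<tau>.\<close>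
  have less: "\<tau> a < \<tau> b" if "\<sigma> (Suc (Suc a)) < \<sigma> (Suc (Suc b))" for a b
    using that by (auto simp: \<sigma>2 split: if_splits)
  have "\<tau> permutes {..<2 * n}"
  proof (rule bij_imp_permutes)
    have "inj \<tau>"
    proof (rule injI)
      fix a b assume "\<tau> a = \<tau> b"
      then have "\<rho> (Suc (Suc a)) = \<rho> (Suc (Suc b))" by (simp add: \<tau>\<rho>)
      then show "a = b" using permutes_inj[OF \<rho>] by (auto dest: injD)
    qed
    moreover have "\<tau> ` {..<2 * n} \<subseteq> {..<2 * n}"
      using permutes_in_image[OF \<rho>, of "Suc (Suc _)"] by (auto simp: \<tau>\<rho>)
    ultimately show "bij_betw \<tau> {..<2 * n} {..<2 * n}"
      by (metis bij_betw_def endo_inj_surj finite_lessThan inj_on_subset subset_UNIV)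
    show "\<tau> i = i" if "i \<notin> {..<2 * n}" for i
      using permutes_not_in[OF \<rho>, of "Suc (Suc i)"] that by (simp add: \<tau>\<rho>)
  qed
  moreover have "\<tau> (2 * i) < \<tau> (2 * i + 1)" if "i < n" for i
    using assms that by (intro less) (auto simp: matchings_def dest!: spec[of _ "Suc i"])
  moreover have "\<tau> (2 * i) < \<tau> (2 * (i + 1))" if "i + 1 < n" for i
    using assms that by (intro less) (auto simp: matchings_def dest!: spec[of _ "Suc i"])
  ultimately have "\<tau> \<in> matchings n" by (auto simp: matchings_def)
  with kn \<sigma>eq show ?thesis by blast
qed

lemma inj_rot_shift2: "inj_on (\<lambda>(k, \<tau>). rot k \<circ> shift2 \<tau>) ({..<2 * n + 1} \<times> matchings n)"
proof (rule inj_onI, clarify)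
  fix k l \<tau> \<tau>'
  assume eq: "rot k \<circ> shift2 \<tau> = rot l \<circ> shift2 \<tau>'"
  from fun_cong[OF eq, of 1] have kl: "k = l" by (simp add: rot_apply)
  have "\<tau> i = \<tau>' i" for i
    using fun_cong[OF eq, of "Suc (Suc i)"] by (auto simp: rot_apply kl split: if_splits)
  with kl show "k = l \<and> \<tau> = \<tau>'" by auto
qed

lemma pfaffian_Suc:
  "pfaffian (Suc n) a = (\<Sum>k<2 * n + 1. (- 1) ^ k * a 0 (Suc k) *
     pfaffian n (\<lambda>p q. a (rot k (Suc (Suc p))) (rot k (Suc (Suc q)))))"
proof -
  let ?g = "\<lambda>\<sigma>. \<Prod>i<n. a (\<sigma> (2 * i)) (\<sigma> (2 * i + 1))"
  have "pfaffian (Suc n) a = (\<Sum>\<sigma>\<in>matchings (Suc n). of_int (sign \<sigma>) * (\<Prod>i<Suc n. a (\<sigma> (2 * i)) (\<sigma> (2 * i + 1))))"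
    by (simp add: pfaffian_def matchings_def)
  also have "matchings (Suc n) = (\<lambda>(k, \<tau>). rot k \<circ> shift2 \<tau>) ` ({..<2 * n + 1} \<times> matchings n)"
    using rot_shift2_in_matchings matchings_decompose by (fastforce simp: image_iff)
  also have "(\<Sum>\<sigma>\<in>\<dots>. of_int (sign \<sigma>) * (\<Prod>i<Suc n. a (\<sigma> (2 * i)) (\<sigma> (2 * i + 1))))
     = (\<Sum>(k, \<tau>)\<in>{..<2 * n + 1} \<times> matchings n. (- 1) ^ k * a 0 (Suc k) *
        (of_int (sign \<tau>) * (\<Prod>i<n. a (rot k (Suc (Suc (\<tau> (2 * i))))) (rot k (Suc (Suc (\<tau> (2 * i + 1))))))))"
  proof (subst sum.reindex[OF inj_rot_shift2], rule sum.cong, rule refl)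
    fix x assume "x \<in> {..<2 * n + 1} \<times> matchings n"
    then obtain k \<tau> where x: "x = (k, \<tau>)" and "\<tau> \<in> matchings n" by auto
    then have \<tau>: "\<tau> permutes {..<2 * n}" by (simp add: matchings_def)
    have perm: "permutation (rot k)" "permutation (shift2 \<tau>)"
      using rot_permutes[of k "k + 2"] shift2_permutes_sign[OF \<tau>]
      by (auto intro: permutation_permutes[THEN iffD2])
    show "((\<lambda>\<sigma>. of_int (sign \<sigma>) * (\<Prod>i<Suc n. a (\<sigma> (2 * i)) (\<sigma> (2 * i + 1)))) \<circ> (\<lambda>(k, \<tau>). rot k \<circ> shift2 \<tau>)) x
      = (case x of (k, \<tau>) \<Rightarrow> (- 1) ^ k * a 0 (Suc k) *
        (of_int (sign \<tau>) * (\<Prod>i<n. a (rot k (Suc (Suc (\<tau> (2 * i))))) (rot k (Suc (Suc (\<tau> (2 * i + 1))))))))"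
      using perm shift2_permutes_sign[OF \<tau>]
      by (simp add: x sign_compose sign_rot prod.lessThan_Suc_shift rot_apply(1,2) mult_ac del: prod.lessThan_Suc)
  qed
  also have "\<dots> = (\<Sum>k<2 * n + 1. (- 1) ^ k * a 0 (Suc k) *
     pfaffian n (\<lambda>p q. a (rot k (Suc (Suc p))) (rot k (Suc (Suc q)))))"
    by (simp add: pfaffian_def matchings_def sum.cartesian_product[symmetric] sum_distrib_left)
  finally show ?thesis .
qed

lemma pfaffian_eq_pf: "pfaffian n a = pf a [0..<2 * n]"
proof (induction n arbitrary: a)
  case 0
  have "{\<sigma> :: nat \<Rightarrow> nat. \<sigma> permutes {}} = {id}" by auto
  then show ?case by (simp add: pfaffian_def sign_id)
next
  case (Suc n)
  have del: "del k [Suc 0..<2 * Suc n] = map (\<lambda>p. rot k (Suc (Suc p))) [0..<2 * n]" if "k < 2 * n + 1" for k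
    using that by (intro nth_equalityI) (auto simp: nth_del rot_apply(3) simp del: upt_Suc)
  have "pf a [0..<2 * Suc n] = pf a (0 # [Suc 0..<2 * Suc n])" by (subst upt_conv_Cons) auto
  also have "\<dots> = (\<Sum>k<2 * n + 1. (- 1) ^ k * a 0 (Suc k) * pf a (del k [Suc 0..<2 * Suc n]))"
    by (simp add: pf.simps(2) del: upt_Suc)
  also have "\<dots> = pfaffian (Suc n) a"
    unfolding pfaffian_Suc by (intro sum.cong refl) (simp only: del pf_map Suc lessThan_iff)
  finally show ?case ..
qed

unbundle no vec_syntax
unbundle fps_syntax

section \<open>Coefficients and constants in the ring of series\<close>

lemma coeff_0 [simp]: "coeff 0 m = 0"
  and coeff_1: "coeff 1 m = (if m = {#} then 1 else 0)"
  and coeff_add [simp]: "coeff (f + g) m = coeff f m + coeff g m"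
  and coeff_uminus [simp]: "coeff (- f) m = - coeff f m"
  and coeff_diff [simp]: "coeff (f - g) m = coeff f m - coeff g m"
  and coeff_mult: "coeff (f * g) m = (\<Sum>a | a \<subseteq># m. coeff f a * coeff g (m - a))"
  by (simp_all add: zero_tseries_def one_tseries_def plus_tseries_def uminus_tseries_def
      minus_tseries_def times_tseries_def)

lemma coeff_sum [simp]: "coeff (\<Sum>x\<in>B. F x) m = (\<Sum>x\<in>B. coeff (F x) m)"
  by (induction B rule: infinite_finite_induct) simp_all

lemma coeff_tconst_mult [simp]: "coeff (tconst c * f) m = c * coeff f m"
proof -
  have "coeff (tconst c * f) m = (\<Sum>a | a \<subseteq># m. if a = {#} then c * coeff f m else 0)"
    unfolding coeff_mult by (rule sum.cong) (auto simp: tconst_def)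
  then show ?thesis by (simp add: sum.delta finite_submultisets)
qed

lemma tconst_0 [simp]: "tconst 0 = 0" and tconst_1 [simp]: "tconst 1 = 1"
  and tconst_add: "tconst (c + d) = tconst c + tconst d"
  and tconst_uminus: "tconst (- c) = - tconst c"
  by (simp_all add: tseries_eq_iff tconst_def coeff_1)

lemma coeff_tconst: "coeff (tconst c) m = (if m = {#} then c else 0)"
  by (simp add: tconst_def)

lemma tconst_mult: "tconst (c * d) = tconst c * tconst d"
  by (simp add: tseries_eq_iff coeff_tconst)

lemma tconst_mult_assoc: "tconst c * (tconst d * f) = tconst (c * d) * f"
  by (simp add: tconst_mult mult.assoc)

lemma tconst_of_nat: "tconst (of_nat n) = of_nat n"
  by (induction n) (simp_all add: tconst_add)

lemma tconst_power: "tconst (c ^ n) = tconst c ^ n"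
  by (induction n) (simp_all add: tconst_mult)

lemma tconst_sum: "tconst (\<Sum>x\<in>B. c x) = (\<Sum>x\<in>B. tconst (c x))"
  by (induction B rule: infinite_finite_induct) (simp_all add: tconst_add)

lemma tconst_eq_0 [simp]: "tconst c = 0 \<longleftrightarrow> c = 0"
  by (auto simp: tseries_eq_iff coeff_tconst split: if_splits)

lemma tconst_neg_1_power: "tconst ((- 1) ^ n) = (- 1) ^ n"
  by (simp add: tconst_power tconst_uminus)

section \<open>The grading\<close>

lemma weight_add [simp]: "weight (a + b) = weight a + weight b"
  by (simp add: weight_def)

lemma weight_add_mset [simp]: "weight (add_mset i m) = weight m + (2 * i + 1)"
  by (simp add: weight_def)

lemma weight_empty [simp]: "weight {#} = 0"
  by (simp add: weight_def)

lemma weight_diff: "a \<subseteq># m \<Longrightarrow> weight a + weight (m - a) = weight m"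
  by (metis weight_add subset_mset.add_diff_inverse)

definition homog :: "nat \<Rightarrow> tseries \<Rightarrow> bool"
  where "homog d f \<longleftrightarrow> (\<forall>m. coeff f m \<noteq> 0 \<longrightarrow> weight m = d)"

lemma homog_mult: assumes "homog d f" "homog e g" shows "homog (d + e) (f * g)"
  unfolding homog_def
proof (intro allI impI)
  fix m assume "coeff (f * g) m \<noteq> 0"
  then obtain a where "a \<subseteq># m" "coeff f a \<noteq> 0" "coeff g (m - a) \<noteq> 0"
    unfolding coeff_mult by (metis (no_types, lifting) mem_Collect_eq mult_eq_0_iff sum.not_neutral_contains_not_neutral)
  then show "weight m = d + e" using assms weight_diff[of a m] by (simp add: homog_def)
qed

lemma homog_0 [simp]: "homog d 0" by (simp add: homog_def)

lemma homog_tconst_mult: "homog d f \<Longrightarrow> homog d (tconst c * f)"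
  by (simp add: homog_def)

lemma homog_sum: "(\<And>x. x \<in> B \<Longrightarrow> homog d (F x)) \<Longrightarrow> homog d (\<Sum>x\<in>B. F x)"
  unfolding homog_def by (metis (no_types, lifting) coeff_sum sum.not_neutral_contains_not_neutral)

lemma coeff_mult_homog:
  assumes "homog d f"
  shows "coeff (f * g) m = (\<Sum>a | a \<subseteq># m \<and> weight (m - a) + d = weight m. coeff f a * coeff g (m - a))"
  unfolding coeff_mult
proof (rule sum.mono_neutral_right)
  show "\<forall>i\<in>{a. a \<subseteq># m} - {a. a \<subseteq># m \<and> weight (m - a) + d = weight m}. coeff f i * coeff g (m - i) = 0"
    using assms weight_diff by (fastforce simp: homog_def)
qed (auto simp: finite_submultisets)

text \<open>A family with only finitely many members having terms up to each degree is summable in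
  the topology of the grading, and a coefficient of the sum may be computed on any finite set of
  indices that catches all contributions to it.\<close>

lemma coeff_infsum:
  assumes "\<And>N. finite {x\<in>S. \<exists>m. weight m \<le> N \<and> coeff (F x) m \<noteq> 0}"
    and "finite B" "B \<subseteq> S" "\<And>x. x \<in> S - B \<Longrightarrow> coeff (F x) m = 0"
  shows "coeff (infsum F S) m = (\<Sum>x\<in>B. coeff (F x) m)"
proof -
  let ?Z = "\<lambda>m. {x\<in>S. coeff (F x) m \<noteq> 0}"
  have fin: "finite (?Z m)" for m
    by (rule finite_subset[OF _ assms(1)[of "weight m"]]) auto
  let ?f = "Tseries (\<lambda>m. \<Sum>x\<in>?Z m. coeff (F x) m)"
  have "(F has_sum ?f) S"
    unfolding has_sum_def tendsto_tseries_iff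
  proof
    fix N
    let ?X = "{x\<in>S. \<exists>m. weight m \<le> N \<and> coeff (F x) m \<noteq> 0}"
    show "\<forall>\<^sub>F B in finite_subsets_at_top S. \<forall>m. weight m \<le> N \<longrightarrow> coeff (sum F B) m = coeff ?f m"
      unfolding eventually_finite_subsets_at_top
    proof (intro exI[of _ ?X] conjI allI impI)
      fix B m assume B: "finite B \<and> ?X \<subseteq> B \<and> B \<subseteq> S" and m: "weight m \<le> N"
      show "coeff (sum F B) m = coeff ?f m"
        unfolding coeff_sum coeff_Tseries using B m
        by (intro sum.mono_neutral_right) auto
    qed (use assms(1) in auto)
  qed
  then have "coeff (infsum F S) m = (\<Sum>x\<in>?Z m. coeff (F x) m)"
    by (simp add: infsumI)
  also have "\<dots> = (\<Sum>x\<in>B. coeff (F x) m)"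
    using assms by (intro sum.mono_neutral_left) auto
  finally show ?thesis .
qed

section \<open>Derivations\<close>

lemma tderiv_add: "tderiv k (f + g) = tderiv k f + tderiv k g"
  by (simp add: tderiv_def tseries_eq_iff algebra_simps)

lemma tderiv_0 [simp]: "tderiv k 0 = 0"
  by (simp add: tderiv_def tseries_eq_iff)

lemma tderiv_tconst_mult: "tderiv k (tconst c * f) = tconst c * tderiv k f"
  by (simp add: tderiv_def tseries_eq_iff)

lemma tderiv_tconst [simp]: "tderiv k (tconst c) = 0"
  by (simp add: tderiv_def tseries_eq_iff coeff_tconst)

lemma tderiv_1 [simp]: "tderiv k 1 = 0"
  using tderiv_tconst[of k 1] by simp

lemma tderiv_sum: "tderiv k (\<Sum>x\<in>B. F x) = (\<Sum>x\<in>B. tderiv k (F x))"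
  by (induction B rule: infinite_finite_induct) (simp_all add: tderiv_add)

lemma tderiv_commute: "tderiv j (tderiv k f) = tderiv k (tderiv j f)"
  by (cases "j div 2 = k div 2") (simp_all add: tderiv_def tseries_eq_iff add_mset_commute)

lemma tderiv_mult: "tderiv k (f * g) = tderiv k f * g + f * tderiv k g"
proof (rule tseries_eqI)
  fix m
  let ?i = "k div 2"
  let ?m = "add_mset ?i m"
  have compl: "M - (M - a) = a" if "a \<subseteq># M" for a M :: "nat multiset"
    using that by (auto simp: subset_mset.le_iff_add)
  have shift: "(\<Sum>a | a \<subseteq># ?m. of_nat (count a ?i) * (coeff f a * coeff g (?m - a)))
     = coeff (tderiv k f * g) m" for f g
  proof -
    have "(\<Sum>a | a \<subseteq># ?m. of_nat (count a ?i) * (coeff f a * coeff g (?m - a)))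
      = (\<Sum>a | a \<subseteq># ?m \<and> ?i \<in># a. of_nat (count a ?i) * (coeff f a * coeff g (?m - a)))"
      by (rule sum.mono_neutral_right) (auto simp: finite_submultisets not_in_iff)
    also have "\<dots> = coeff (tderiv k f * g) m"
      unfolding coeff_mult
      by (rule sum.reindex_bij_witness[where i = "add_mset ?i" and j = "\<lambda>a. a - {#?i#}"])
        (auto simp: tderiv_def subset_eq_diff_conv insert_DiffM algebra_simps dest!: multi_member_split)
    finally show ?thesis .
  qed
  have "coeff (tderiv k (f * g)) m = (\<Sum>a | a \<subseteq># ?m. of_nat (count ?m ?i) * (coeff f a * coeff g (?m - a)))"
    by (simp add: tderiv_def coeff_mult sum_distrib_left)
  \<comment> \<open>The multiplicity of the variable in a product of monomials is the sum of its
    multiplicities in the factors; the two summands become the two Leibniz terms.\<close>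
  also have "\<dots> = (\<Sum>a | a \<subseteq># ?m. of_nat (count a ?i) * (coeff f a * coeff g (?m - a))
       + of_nat (count (?m - a) ?i) * (coeff g (?m - a) * coeff f a))"
  proof (rule sum.cong[OF refl])
    fix a assume "a \<in> {a. a \<subseteq># ?m}"
    then have "count ?m ?i = count a ?i + count (?m - a) ?i"
      by (metis count_union mem_Collect_eq subset_mset.add_diff_inverse)
    then show "of_nat (count ?m ?i) * (coeff f a * coeff g (?m - a))
      = of_nat (count a ?i) * (coeff f a * coeff g (?m - a))
       + of_nat (count (?m - a) ?i) * (coeff g (?m - a) * coeff f a)"
      by (simp only: of_nat_add) (simp add: algebra_simps)
  qed
  also have "\<dots> = coeff (tderiv k f * g) m
     + (\<Sum>a | a \<subseteq># ?m. of_nat (count (?m - a) ?i) * (coeff g (?m - a) * coeff f a))"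
    by (simp only: sum.distrib shift)
  also have "(\<Sum>a | a \<subseteq># ?m. of_nat (count (?m - a) ?i) * (coeff g (?m - a) * coeff f a))
     = (\<Sum>a | a \<subseteq># ?m. of_nat (count a ?i) * (coeff g a * coeff f (?m - a)))"
    by (rule sum.reindex_bij_witness[where i = "\<lambda>a. ?m - a" and j = "\<lambda>a. ?m - a"])
      (auto simp: compl)
  also have "\<dots> = coeff (tderiv k g * f) m" by (rule shift)
  finally show "coeff (tderiv k (f * g)) m = coeff (tderiv k f * g + f * tderiv k g) m"
    by (simp add: mult.commute)
qed

section \<open>The shift of the times as the exponential of a derivation\<close>

definition fderiv :: "nat \<Rightarrow> tseries fps \<Rightarrow> tseries fps"
  where "fderiv k F = Abs_fps (\<lambda>n. tderiv k (F $ n))"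

lemma fderiv_mult: "fderiv k (F * G) = fderiv k F * G + F * fderiv k G"
  by (simp add: fps_eq_iff fderiv_def fps_mult_nth tderiv_sum tderiv_mult sum.distrib)

text \<open>The derivation -2 times the sum over odd k of (u^k/k) d/dt_k, where the series variable
  u stands for 1/z. Its exponential substitutes t_k - 2 u^k/k for t_k.\<close>

definition gen_deriv :: "tseries fps \<Rightarrow> tseries fps" where
  "gen_deriv F = Abs_fps (\<lambda>n. \<Sum>k | 1 \<le> k \<and> k \<le> n \<and> odd k. tconst (- 2 / of_nat k) * tderiv k (F $ (n - k)))"

text \<open>Up to order \<open>N\<close> the operator is one fixed finite sum of derivations of the
  power series ring, so its Leibniz rule follows from theirs.\<close>

lemma gen_deriv_nth_eq:
  assumes "n \<le> N"
  shows "gen_deriv F $ n = (\<Sum>k | 1 \<le> k \<and> k \<le> N \<and> odd k. fps_const (tconst (- 2 / of_nat k)) * (fps_X ^ k * fderiv k F)) $ n"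
proof -
  have "gen_deriv F $ n = (\<Sum>k | 1 \<le> k \<and> k \<le> N \<and> odd k. if k \<le> n then tconst (- 2 / of_nat k) * tderiv k (F $ (n - k)) else 0)"
    unfolding gen_deriv_def using assms by (simp add: sum.If_cases) (intro sum.cong, auto)
  also have "\<dots> = (\<Sum>k | 1 \<le> k \<and> k \<le> N \<and> odd k. fps_const (tconst (- 2 / of_nat k)) * (fps_X ^ k * fderiv k F)) $ n"
    unfolding fps_sum_nth by (intro sum.cong) (auto simp: fps_X_power_mult_nth fderiv_def)
  finally show ?thesis .
qed

lemma gen_deriv_mult: "gen_deriv (F * G) = gen_deriv F * G + F * gen_deriv G"
proof (rule fps_ext)
  fix n
  let ?D = "\<lambda>F. \<Sum>k | 1 \<le> k \<and> k \<le> n \<and> odd k. fps_const (tconst (- 2 / of_nat k)) * (fps_X ^ k * fderiv k F)"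
  have "gen_deriv (F * G) $ n = ?D (F * G) $ n" by (rule gen_deriv_nth_eq) simp
  also have "?D (F * G) = ?D F * G + F * ?D G"
    by (simp add: fderiv_mult sum_distrib_left sum_distrib_right sum.distrib[symmetric] algebra_simps)
  also have "\<dots> $ n = (gen_deriv F * G + F * gen_deriv G) $ n"
    unfolding fps_add_nth fps_mult_nth
    by (intro arg_cong2[of _ _ _ _ "(+)"] sum.cong refl) (simp_all add: gen_deriv_nth_eq[of _ n])
  finally show "gen_deriv (F * G) $ n = (gen_deriv F * G + F * gen_deriv G) $ n" .
qed

lemma gen_deriv_0 [simp]: "gen_deriv 0 = 0" by (simp add: gen_deriv_def fps_eq_iff)

lemma gen_deriv_add: "gen_deriv (F + G) = gen_deriv F + gen_deriv G"
  by (simp add: gen_deriv_def fps_eq_iff tderiv_add sum.distrib algebra_simps)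

lemma gen_deriv_sum: "gen_deriv (\<Sum>x\<in>B. F x) = (\<Sum>x\<in>B. gen_deriv (F x))"
  by (induction B rule: infinite_finite_induct) (simp_all add: gen_deriv_add)

lemma gen_deriv_const_mult: "gen_deriv (fps_const (tconst c) * F) = fps_const (tconst c) * gen_deriv F"
  by (simp add: gen_deriv_def fps_eq_iff tderiv_tconst_mult sum_distrib_left mult.left_commute)

definition div_power :: "nat \<Rightarrow> tseries fps \<Rightarrow> tseries fps"
  where "div_power j F = fps_const (tconst (1 / fact j)) * (gen_deriv ^^ j) F"

lemma gen_deriv_div_power: "gen_deriv (div_power j F) = of_nat (Suc j) * div_power (Suc j) F"
proof -
  have "of_nat (Suc j) * div_power (Suc j) F = fps_const (tconst (of_nat (Suc j))) * (fps_const (tconst (1 / fact (Suc j))) * gen_deriv ((gen_deriv ^^ j) F))"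
    by (simp add: div_power_def tconst_of_nat fps_of_nat del: of_nat_Suc)
  also have "\<dots> = fps_const (tconst (1 / fact j)) * gen_deriv ((gen_deriv ^^ j) F)"
    by (simp add: mult.assoc[symmetric] tconst_mult[symmetric] del: of_nat_Suc)
  finally show ?thesis by (simp add: div_power_def gen_deriv_const_mult)
qed

lemma div_power_0 [simp]: "div_power 0 F = F" by (simp add: div_power_def)

lemma fps_of_nat_cancel:
  fixes F G :: "tseries fps"
  assumes "of_nat (Suc j) * F = of_nat (Suc j) * G" shows "F = G"
proof -
  have "fps_const (tconst (1 / of_nat (Suc j))) * (of_nat (Suc j) * F) = F" for F
    by (simp add: mult.assoc[symmetric] tconst_mult[symmetric] fps_of_nat[symmetric] tconst_of_nat[symmetric] del: of_nat_Suc)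
  then show ?thesis using assms by metis
qed

text \<open>Leibniz rule for divided powers. Differentiating the rule for \<open>j\<close> produces
  every term of the next rule twice, with weights \<open>i\<close> and \<open>j + 1 - i\<close>,
  which add up to \<open>j + 1\<close>.\<close>

lemma div_power_mult: "div_power j (F * G) = (\<Sum>i\<le>j. div_power i F * div_power (j - i) G)"
proof (induction j)
  case (Suc j)
  have "of_nat (Suc j) * div_power (Suc j) (F * G) = (\<Sum>i\<le>j. gen_deriv (div_power i F * div_power (j - i) G))"
    by (simp only: gen_deriv_div_power[symmetric] Suc gen_deriv_sum)
  also have "\<dots> = (\<Sum>i\<le>j. of_nat (Suc i) * (div_power (Suc i) F * div_power (Suc j - Suc i) G))
       + (\<Sum>i\<le>j. of_nat (Suc j - i) * (div_power i F * div_power (Suc j - i) G))"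
    by (simp add: gen_deriv_mult gen_deriv_div_power sum.distrib Suc_diff_le mult_ac del: of_nat_Suc)
  also have "(\<Sum>i\<le>j. of_nat (Suc i) * (div_power (Suc i) F * div_power (Suc j - Suc i) G)) = (\<Sum>i\<le>Suc j. of_nat i * (div_power i F * div_power (Suc j - i) G))"
    by (subst sum.atMost_Suc_shift) simp
  also have "(\<Sum>i\<le>j. of_nat (Suc j - i) * (div_power i F * div_power (Suc j - i) G)) = (\<Sum>i\<le>Suc j. of_nat (Suc j - i) * (div_power i F * div_power (Suc j - i) G))"
    by simp
  also have "(\<Sum>i\<le>Suc j. of_nat i * (div_power i F * div_power (Suc j - i) G)) + \<dots> = of_nat (Suc j) * (\<Sum>i\<le>Suc j. div_power i F * div_power (Suc j - i) G)"
    unfolding sum.distrib[symmetric] sum_distrib_left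
    by (intro sum.cong refl) (simp add: distrib_right[symmetric] of_nat_add[symmetric] del: of_nat_Suc of_nat_add)
  finally show ?case by (rule fps_of_nat_cancel)
qed simp

lemma gen_deriv_vanish: "(\<And>i. i < j \<Longrightarrow> F $ i = 0) \<Longrightarrow> n < Suc j \<Longrightarrow> gen_deriv F $ n = 0"
  by (auto simp: gen_deriv_def intro!: sum.neutral)

text \<open>Each application of the derivation raises the order in u, so every coefficient of the
  exponential is a finite sum.\<close>

lemma div_power_vanish: "n < j \<Longrightarrow> div_power j F $ n = 0"
proof -
  have "(gen_deriv ^^ j) F $ n = 0" if "n < j" for n
    using that
  proof (induction j arbitrary: n)
    case (Suc j)
    then show ?case using gen_deriv_vanish[of j "(gen_deriv ^^ j) F" n] by simp
  qed simp
  then show "n < j \<Longrightarrow> div_power j F $ n = 0" by (simp add: div_power_def)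
qed

lemma dpow_eq: "dpow j n f = (gen_deriv ^^ j) (fps_const f) $ n"
  by (induction j arbitrary: n) (simp_all add: gen_deriv_def)

definition tshift :: "tseries \<Rightarrow> tseries fps"
  where "tshift f = Abs_fps (\<lambda>n. dexp n f)"

lemma tshift_nth: "n \<le> N \<Longrightarrow> tshift f $ n = (\<Sum>j\<le>N. div_power j (fps_const f) $ n)"
proof -
  assume n: "n \<le> N"
  have "tshift f $ n = (\<Sum>j\<le>n. div_power j (fps_const f) $ n)"
    by (simp add: tshift_def dexp_def dpow_eq div_power_def)
  also have "\<dots> = (\<Sum>j\<le>N. div_power j (fps_const f) $ n)"
    using n by (intro sum.mono_neutral_left) (auto simp: div_power_vanish)
  finally show ?thesis .
qed

lemma tshift_mult: "tshift (f * g) = tshift f * tshift g"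
proof (rule fps_ext)
  fix n
  let ?F = "fps_const f" and ?G = "fps_const g"
  have "tshift (f * g) $ n = (\<Sum>j\<le>n. div_power j (?F * ?G) $ n)"
    by (simp add: tshift_nth[of n n])
  also have "\<dots> = (\<Sum>j\<le>n. \<Sum>i\<le>j. (div_power i ?F * div_power (j - i) ?G) $ n)"
    by (simp only: div_power_mult fps_sum_nth)
  also have "\<dots> = (\<Sum>(i, l)\<in>{(i, l). i + l \<le> n}. (div_power i ?F * div_power l ?G) $ n)"
    by (simp add: sum.triangle_reindex_eq)
  \<comment> \<open>Pairs with i + l > n have no term of order n, so the triangle may be completed
    to a square, over which the sum factors.\<close>
  also have "\<dots> = (\<Sum>(i, l)\<in>{..n} \<times> {..n}. (div_power i ?F * div_power l ?G) $ n)"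
  proof (rule sum.mono_neutral_left)
    have "div_power i ?F $ p * div_power l ?G $ (n - p) = 0" if "\<not> i + l \<le> n" "p \<le> n" for i l p
      using that div_power_vanish[of p i ?F] div_power_vanish[of "n - p" l ?G] by (cases "p < i") auto
    then have "(div_power i ?F * div_power l ?G) $ n = 0" if "\<not> i + l \<le> n" for i l
      unfolding fps_mult_nth using that by (intro sum.neutral) auto
    then show "\<forall>i\<in>{..n} \<times> {..n} - {(i, l). i + l \<le> n}. (case i of (i, l) \<Rightarrow> (div_power i ?F * div_power l ?G) $ n) = 0"
      by auto
  qed auto
  also have "\<dots> = ((\<Sum>i\<le>n. div_power i ?F) * (\<Sum>l\<le>n. div_power l ?G)) $ n"
    by (simp add: sum_product fps_sum_nth flip: sum.cartesian_product)
  also have "\<dots> = (tshift f * tshift g) $ n"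
    unfolding fps_mult_nth by (intro sum.cong) (simp_all add: tshift_nth[of _ n] fps_sum_nth)
  finally show "tshift (f * g) $ n = (tshift f * tshift g) $ n" .
qed

lemma fps_const_add': "fps_const (f + g) = fps_const f + fps_const (g :: tseries)"
  by simp

lemma DDpow_add: "(gen_deriv ^^ j) (F + G) = (gen_deriv ^^ j) F + (gen_deriv ^^ j) G"
  by (induction j) (simp_all add: gen_deriv_add)

lemma DDpow_tconst: "(gen_deriv ^^ j) (fps_const (tconst c) * F) = fps_const (tconst c) * (gen_deriv ^^ j) F"
  by (induction j) (simp_all add: gen_deriv_const_mult)

lemma tshift_add: "tshift (f + g) = tshift f + tshift g"
  by (simp add: fps_eq_iff tshift_nth[OF order_refl] div_power_def DDpow_add algebra_simps sum.distrib fps_const_add' del: fps_const_add)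

lemma tshift_tconst_mult: "tshift (tconst c * f) = fps_const (tconst c) * tshift f"
  by (simp add: fps_eq_iff tshift_nth[OF order_refl] div_power_def DDpow_tconst fps_const_mult[symmetric] sum_distrib_left mult.left_commute del: fps_const_mult)

lemma tshift_1: "tshift 1 = 1"
proof -
  have "gen_deriv 1 = 0" by (auto simp: gen_deriv_def fps_eq_iff intro!: sum.neutral)
  then have "(gen_deriv ^^ j) 1 = (if j = 0 then 1 else 0)" for j by (induction j) simp_all
  then show ?thesis
    by (auto simp: fps_eq_iff tshift_nth[OF order_refl] div_power_def intro!: sum.neutral)
qed

lemma tshift_0 [simp]: "tshift 0 = 0"
  using tshift_add[of 0 0] by simp

lemma tshift_uminus: "tshift (- f) = - tshift f"
  using tshift_add[of f "- f"] by (simp add: eq_neg_iff_add_eq_0 add.commute)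

lemma tshift_diff: "tshift (f - g) = tshift f - tshift g"
  by (simp only: diff_conv_add_uminus tshift_add tshift_uminus)

lemma tshift_tconst: "tshift (tconst c) = fps_const (tconst c)"
  using tshift_tconst_mult[of c 1] by (simp add: tshift_1)

section \<open>The functions q\<close>

definition tgen :: "tseries fps"
  where "tgen = Abs_fps (\<lambda>k. if odd k then tvar k else 0)"

lemma q_eq: "n \<le> N \<Longrightarrow> q n = (\<Sum>i\<le>N. tconst (1 / fact i) * (tgen ^ i) $ n)"
proof -
  assume n: "n \<le> N"
  have "q n = (\<Sum>i\<le>n. tconst (1 / fact i) * (tgen ^ i) $ n)"
    by (simp add: q_def q_series_def fps_compose_nth tgen_def atLeast0AtMost)
  also have "\<dots> = (\<Sum>i\<le>N. tconst (1 / fact i) * (tgen ^ i) $ n)"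
    using n by (intro sum.mono_neutral_left) (auto simp: startsby_zero_power_prefix tgen_def)
  finally show ?thesis .
qed

lemma q_0 [simp]: "q 0 = 1"
  by (simp add: q_eq[of 0 0])

lemma homog_tvar: "odd k \<Longrightarrow> homog k (tvar k)"
  by (auto simp: homog_def tvar_def weight_def)

lemma homog_q: "homog n (q n)"
proof -
  have "homog n ((tgen ^ i) $ n)" for i n
  proof (induction i arbitrary: n)
    case (Suc i)
    have "homog n (tgen $ j * (tgen ^ i) $ (n - j))" if "j \<le> n" for j
      using homog_mult[of j "tgen $ j" "n - j" "(tgen ^ i) $ (n - j)"] that Suc homog_tvar
      by (simp add: tgen_def)
    then show ?case by (auto simp: fps_mult_nth intro!: homog_sum)
  qed (auto simp: homog_def coeff_1)
  then show ?thesis by (simp add: q_eq[of n n] homog_sum homog_tconst_mult)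
qed

lemma fderiv_tgen: assumes "odd k" shows "fderiv k tgen = fps_X ^ k"
proof -
  have "tderiv k (tvar j) = (if j = k then 1 else 0)" if "odd j" for j
    using assms that by (auto simp: tseries_eq_iff tderiv_def tvar_def coeff_1 elim!: oddE)
  then show ?thesis using assms by (auto simp: fps_eq_iff fderiv_def tgen_def)
qed

lemma fderiv_1 [simp]: "fderiv k 1 = 0"
  unfolding fderiv_def by (rule fps_ext) simp

lemma fderiv_power: "fderiv k (F ^ i) = of_nat i * F ^ (i - 1) * fderiv k F"
proof (induction i)
  case 0
  show ?case by simp
next
  case (Suc i)
  then show ?case by (cases i) (simp_all add: fderiv_mult algebra_simps)
qed

lemma tderiv_q: assumes "odd k" shows "tderiv k (q n) = (if k \<le> n then q (n - k) else 0)"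
proof -
  obtain l where l: "k = Suc l" using assms by (cases k) auto
  have "tderiv k (q n) = (\<Sum>i\<le>Suc n. tconst (1 / fact i) * fderiv k (tgen ^ i) $ n)"
    by (simp add: q_eq[of n "Suc n"] tderiv_sum tderiv_add tderiv_tconst_mult fderiv_def del: sum.atMost_Suc)
  also have "\<dots> = (\<Sum>i\<le>n. tconst (1 / fact (Suc i)) * fderiv k (tgen ^ Suc i) $ n)"
    by (subst sum.atMost_Suc_shift) (simp add: fderiv_power)
  also have "\<dots> = (\<Sum>i\<le>n. tconst (1 / fact i) * (if k \<le> n then (tgen ^ i) $ (n - k) else 0))"
  proof (intro sum.cong refl)
    fix i
    have "tconst (1 / fact (Suc i)) * (of_nat (Suc i) * f) = tconst (1 / fact i) * f" for f
      by (simp add: tconst_of_nat[symmetric] tconst_mult_assoc del: of_nat_Suc)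
    then show "tconst (1 / fact (Suc i)) * fderiv k (tgen ^ Suc i) $ n =
       tconst (1 / fact i) * (if k \<le> n then (tgen ^ i) $ (n - k) else 0)"
      using assms by (simp add: fderiv_power fderiv_tgen fps_X_power_mult_right_nth mult.assoc fps_of_nat[symmetric]
          del: of_nat_Suc power_Suc)
  qed
  finally show ?thesis by (auto simp: q_eq[of "n - k" n])
qed

lemma constant_if_tderiv_0:
  assumes "\<And>k. odd k \<Longrightarrow> tderiv k f = 0" "m \<noteq> {#}"
  shows "coeff f m = 0"
proof -
  obtain i where "i \<in># m" using assms(2) by blast
  then obtain m' where m: "m = add_mset i m'" by (blast dest: multi_member_split)
  have "coeff (tderiv (2 * i + 1) f) m' = 0" using assms(1)[of "2 * i + 1"] by simp
  then have "of_nat (count m' i + 1) * coeff f m = 0" by (simp add: tderiv_def m)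
  then show ?thesis by (simp only: mult_eq_0_iff of_nat_eq_0_iff) simp
qed

text \<open>The identity q(z) q(-z) = 1, true because the exponent of q is odd in z. Here all
  derivatives of the coefficient are shown to vanish, so it is constant, while it is homogeneous of
  positive degree.\<close>

lemma q_alternating_sum: assumes "n > 0" shows "(\<Sum>i\<le>n. (- 1) ^ i * q i * q (n - i)) = 0"
proof -
  have hom: "homog n (\<Sum>i\<le>n. (- 1) ^ i * q i * q (n - i))" for n
    unfolding tconst_neg_1_power[symmetric] mult.assoc
    by (intro homog_sum homog_tconst_mult) (metis atMost_iff homog_mult homog_q le_add_diff_inverse)
  have d: "tderiv k (\<Sum>i\<le>n. (- 1) ^ i * q i * q (n - i)) = 0" if k: "odd k" for k
  proof -
    have "tderiv k (\<Sum>i\<le>n. (- 1) ^ i * q i * q (n - i)) =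
       (\<Sum>i\<le>n. (- 1) ^ i * (if k \<le> i then q (i - k) else 0) * q (n - i))
      + (\<Sum>i\<le>n. (- 1) ^ i * q i * (if k \<le> n - i then q (n - i - k) else 0))"
      unfolding tconst_neg_1_power[symmetric] mult.assoc
      by (simp add: tderiv_sum tderiv_tconst_mult tderiv_mult tderiv_q k sum.distrib algebra_simps)
    also have "(\<Sum>i\<le>n. (- 1) ^ i * (if k \<le> i then q (i - k) else 0) * q (n - i))
        = (\<Sum>i\<in>{k..n}. (- 1) ^ i * q (i - k) * q (n - i))"
      by (rule sum.mono_neutral_cong_right) auto
    \<comment> \<open>Moving the index by the odd number \<open>k\<close> reverses the sign.\<close>
    also have "\<dots> = (\<Sum>i\<in>{i. i + k \<le> n}. - ((- 1) ^ i * q i * q (n - i - k)))"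
      by (rule sum.reindex_bij_witness[where i = "\<lambda>i. i + k" and j = "\<lambda>i. i - k"])
        (use k in \<open>auto simp: power_add uminus_power_if add.commute\<close>)
    also have "(\<Sum>i\<le>n. (- 1) ^ i * q i * (if k \<le> n - i then q (n - i - k) else 0))
        = (\<Sum>i\<in>{i. i + k \<le> n}. (- 1) ^ i * q i * q (n - i - k))"
      by (rule sum.mono_neutral_cong_right) auto
    finally show ?thesis by (simp add: sum_negf)
  qed
  show ?thesis
  proof (rule tseries_eqI)
    fix m
    show "coeff (\<Sum>i\<le>n. (- 1) ^ i * q i * q (n - i)) m = coeff 0 m"
    proof (cases "m = {#}")
      case True
      then show ?thesis using hom[of n] assms unfolding homog_def by fastforce
    next
      case False
      then show ?thesis using constant_if_tderiv_0[OF d] by simp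
    qed
  qed
qed

section \<open>The shift acting on q and on the kernel of the Q-functions\<close>

definition qz :: "int \<Rightarrow> tseries"
  where "qz a = (if a < 0 then 0 else q (nat a))"

lemma qz_neg [simp]: "a < 0 \<Longrightarrow> qz a = 0" by (simp add: qz_def)
lemma qz_int [simp]: "qz (int n) = q n" by (simp add: qz_def)
lemma qz_0 [simp]: "qz 0 = 1" by (simp add: qz_def)
lemma qz_1: "a = int n \<Longrightarrow> qz a = q n" by simp

text \<open>The coefficients of \<open>(1 - y) / (1 + y)\<close>, the factor by which the shift multiplies \<open>q\<close>.\<close>

definition shift_coeff :: "nat \<Rightarrow> complex"
  where "shift_coeff n = (if n = 0 then 1 else 2 * (- 1) ^ n)"

text \<open>This is -2 artanh y = log ((1 - y)/(1 + y)). The shift multiplies the generating series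
  q(w) by its exponential at y = u w.\<close>

definition artanh2 :: "complex fps"
  where "artanh2 = Abs_fps (\<lambda>k. if odd k then - 2 / of_nat k else 0)"

lemma sum_shift_coeff: "(\<Sum>i\<le>n. if even n = even i then shift_coeff i else 0) = of_nat (n + 1) * (- 1) ^ n"
proof (induction n rule: nat_less_induct)
  case (1 n)
  consider "n = 0" | "n = 1" | m where "n = Suc (Suc m)" by (metis One_nat_def not0_implies_Suc)
  then show ?case
  proof cases
    case 3
    then show ?thesis using 1[rule_format, of m] by (simp add: shift_coeff_def algebra_simps)
  qed (simp_all add: shift_coeff_def)
qed

text \<open>The exponential h satisfies h' = -2 h/(1 - y^2), which determines its coefficients
  recursively; \<open>sum_shift_coeff\<close> evaluates the sum on the right.\<close>

lemma exp_artanh2: "(fps_exp 1 oo artanh2) $ n = shift_coeff n"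
proof (induction n rule: nat_less_induct)
  case (1 n)
  let ?h = "fps_exp 1 oo artanh2"
  show ?case
  proof (cases n)
    case 0
    then show ?thesis by (simp add: shift_coeff_def)
  next
    case (Suc k)
    have d: "fps_deriv ?h = ?h * fps_deriv artanh2"
      by (subst fps_compose_deriv) (simp_all add: artanh2_def)
    have "fps_deriv artanh2 $ i = (if even i then - 2 else 0)" for i
      by (simp add: artanh2_def del: of_nat_Suc)
    then have "of_nat (Suc k) * ?h $ Suc k = (\<Sum>i\<le>k. ?h $ i * (if even k = even i then - 2 else 0))"
      using arg_cong[OF d, of "\<lambda>F. F $ k"]
      by (simp add: fps_mult_nth atLeast0AtMost del: of_nat_Suc)
    also have "\<dots> = - 2 * (\<Sum>i\<le>k. if even k = even i then shift_coeff i else 0)"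
      using 1 Suc unfolding sum_distrib_left by (intro sum.cong) auto
    also have "\<dots> = of_nat (Suc k) * shift_coeff (Suc k)"
      by (simp add: sum_shift_coeff shift_coeff_def)
    finally show ?thesis unfolding Suc by (simp del: of_nat_Suc)
  qed
qed

text \<open>As d/dt_k lowers the index of q by k, the derivation acts on the family of the q as
  \<open>artanh2\<close> evaluated at the lowering of the index.\<close>

lemma dpow_q: "dpow i n (q j) = tconst ((artanh2 ^ i) $ n) * qz (int j - int n)"
proof (induction i arbitrary: n)
  case 0
  then show ?case by simp
next
  case (Suc i)
  have "dpow (Suc i) n (q j) = (\<Sum>k | 1 \<le> k \<and> k \<le> n \<and> odd k.
      tconst (- 2 / of_nat k * (artanh2 ^ i) $ (n - k)) * qz (int j - int n))"
    unfolding dpow.simps(2)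
  proof (intro sum.cong refl)
    fix k assume k: "k \<in> {k. 1 \<le> k \<and> k \<le> n \<and> odd k}"
    have "tderiv k (qz (int j - int (n - k))) = qz (int j - int n)"
    proof (cases "n - k \<le> j")
      case True
      then have "qz (int j - int (n - k)) = q (j - (n - k))"
        by (intro qz_1) (simp add: of_nat_diff)
      moreover have "qz (int j - int n) = q (j - (n - k) - k)" if "k \<le> j - (n - k)"
        using that k by (intro qz_1) auto
      ultimately show ?thesis using k True by (auto simp: tderiv_q)
    next
      case False
      then have "int j < int (n - k)" by simp
      then show ?thesis using k False by (auto simp: qz_def)
    qed
    then show "tconst (- 2 / of_nat k) * tderiv k (dpow i (n - k) (q j)) =
      tconst (- 2 / of_nat k * (artanh2 ^ i) $ (n - k)) * qz (int j - int n)"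
      unfolding Suc tderiv_tconst_mult tconst_mult_assoc by simp
  qed
  also have "\<dots> = tconst (\<Sum>k | 1 \<le> k \<and> k \<le> n \<and> odd k. - 2 / of_nat k * (artanh2 ^ i) $ (n - k)) * qz (int j - int n)"
    by (simp add: tconst_sum sum_distrib_right)
  also have "(\<Sum>k | 1 \<le> k \<and> k \<le> n \<and> odd k. - 2 / of_nat k * (artanh2 ^ i) $ (n - k)) = (artanh2 ^ Suc i) $ n"
    unfolding power_Suc fps_mult_nth
    by (rule sum.mono_neutral_cong_left) (auto simp: artanh2_def Suc_le_eq intro: Nat.gr0I)
  finally show ?case .
qed

lemma tshift_q: "tshift (q j) $ n = tconst (shift_coeff n) * qz (int j - int n)"
proof -
  have "tshift (q j) $ n = tconst (\<Sum>i\<le>n. 1 / fact i * (artanh2 ^ i) $ n) * qz (int j - int n)"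
    by (simp add: tshift_def dexp_def dpow_q tconst_mult_assoc tconst_sum sum_distrib_right)
  also have "(\<Sum>i\<le>n. 1 / fact i * (artanh2 ^ i) $ n) = shift_coeff n"
    unfolding exp_artanh2[symmetric] by (simp add: fps_compose_nth atLeast0AtMost)
  finally show ?thesis .
qed

lemma tshift_qz: "tshift (qz a) $ n = tconst (shift_coeff n) * qz (a - int n)"
  by (cases "a < 0") (auto simp: qz_def[of a] tshift_q)

text \<open>The coefficient form of \<open>(1 + u w) * S (q w) = (1 - u w) * q w\<close>.\<close>

lemma tshift_qz_recurrence:
  "tshift (qz a) + fps_X * tshift (qz (a - 1)) = fps_const (qz a) - fps_X * fps_const (qz (a - 1))"
proof (rule fps_ext)
  fix n
  consider "n = 0" | "n = 1" | k where "n = Suc (Suc k)" by (metis One_nat_def not0_implies_Suc)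
  then show "(tshift (qz a) + fps_X * tshift (qz (a - 1))) $ n = (fps_const (qz a) - fps_X * fps_const (qz (a - 1))) $ n"
  proof cases
    case 2
    have "tconst 2 = 1 + 1" by (simp add: tconst_add[of 1 1, simplified])
    then show ?thesis using 2 by (simp add: tshift_qz shift_coeff_def tconst_uminus)
  next
    case 3
    then show ?thesis by (simp add: tshift_qz shift_coeff_def tconst_uminus algebra_simps)
  qed (simp add: tshift_qz shift_coeff_def)
qed

text \<open>The coefficient of \<open>z\<^sup>a w\<^sup>b\<close> in \<open>q(z) q(w) (z - w) / (2 (z + w))\<close>, expanded in powers of \<open>w / z\<close>.\<close>

definition q_pairing :: "int \<Rightarrow> int \<Rightarrow> tseries"
  where "q_pairing a b = tconst (1 / 2) * (\<Sum>n\<le>nat b. tconst (shift_coeff n) * (qz (a + int n) * qz (b - int n)))"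

lemma q_pairing_eq: "nat b \<le> N \<Longrightarrow> q_pairing a b = tconst (1 / 2) * (\<Sum>n\<le>N. tconst (shift_coeff n) * (qz (a + int n) * qz (b - int n)))"
  unfolding q_pairing_def by (intro arg_cong[of _ _ "(*) _"] sum.mono_neutral_left) (auto simp: qz_def nat_le_iff not_le)

lemma tconst_half: "tconst (1 / 2) * (tconst 2 * f) = f" "tconst (1 / 2) * f + tconst (1 / 2) * f = f"
  using tconst_mult_assoc[of "1 / 2" 2 f] by (simp_all flip: tconst_add distrib_right)

text \<open>Multiplying the generating series by 1 + w/z replaces the factor (1 - w/z)/(1 + w/z) by
  1 - w/z.\<close>

lemma q_pairing_recurrence:
  "q_pairing a b + q_pairing (a + 1) (b - 1) = tconst (1 / 2) * (qz a * qz b - qz (a + 1) * qz (b - 1))"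
proof -
  define N where "N = nat b"
  let ?g = "\<lambda>n. qz (a + int n) * qz (b - int n)"
  have "q_pairing a b = tconst (1 / 2) * (\<Sum>n\<le>Suc (Suc N). tconst (shift_coeff n) * ?g n)"
    by (rule q_pairing_eq) (simp add: N_def)
  moreover have "q_pairing (a + 1) (b - 1) = tconst (1 / 2) * (\<Sum>n\<le>Suc N. tconst (shift_coeff n) * ?g (Suc n))"
    by (subst q_pairing_eq[of _ "Suc N"]) (simp_all add: N_def algebra_simps)
  ultimately have "q_pairing a b + q_pairing (a + 1) (b - 1) = tconst (1 / 2) *
      (?g 0 + (\<Sum>n\<le>Suc N. tconst (shift_coeff (Suc n) + shift_coeff n) * ?g (Suc n)))"
    by (subst (asm) sum.atMost_Suc_shift)
      (simp only: distrib_left[symmetric] sum.distrib[symmetric] tconst_add distrib_right, simp add: shift_coeff_def sum.distrib algebra_simps)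
  also have "(\<Sum>n\<le>Suc N. tconst (shift_coeff (Suc n) + shift_coeff n) * ?g (Suc n)) = - ?g 1"
    by (subst sum.atMost_Suc_shift) (simp add: shift_coeff_def tconst_uminus)
  finally show ?thesis by simp
qed

lemma q_pairing_right_0: "q_pairing a 0 = tconst (1 / 2) * qz a"
  by (simp add: q_pairing_def shift_coeff_def)

lemma q_pairing_right_neg: "b < 0 \<Longrightarrow> q_pairing a b = 0"
  by (simp add: q_pairing_def)

lemma minus_half: "tconst (1 / 2) + tconst (1 / 2) = 1"
  by (simp flip: tconst_add)

text \<open>The recurrence trades (a, b + 1) for (a + 1, b) and negates the symmetrized pairing,
  since its product terms are skew. At b = 0 the claim comes from q(z) q(-z) = 1.\<close>

lemma q_pairing_skew_nonneg:
  "q_pairing (int a) (int b) + q_pairing (int b) (int a) = (if a + b = 0 then 1 else 0)"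
proof (induction b arbitrary: a)
  case 0
  have "q_pairing 0 (int a) = (if a = 0 then tconst (1/2) else - tconst (1 / 2) * q a)"
  proof (cases "a = 0")
    case False
    have "(\<Sum>n\<le>a. tconst (shift_coeff n) * (q n * q (a - n))) = (\<Sum>n\<le>a. tconst 2 * ((- 1) ^ n * q n * q (a - n)) - (if n = 0 then q a else 0))"
      by (intro sum.cong refl)
       (auto simp: shift_coeff_def tconst_mult tconst_neg_1_power mult.assoc tconst_add[of 1 1, simplified] algebra_simps)
    also have "\<dots> = - q a" using q_alternating_sum[of a] False by (simp add: sum_subtractf flip: sum_distrib_left)
    moreover have "qz (int a - int n) = q (a - n)" if "n \<le> a" for n
      using that by (intro qz_1) auto
    ultimately show ?thesis using False by (simp add: q_pairing_def)
  qed (simp add: q_pairing_def shift_coeff_def)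
  then show ?case by (simp add: q_pairing_right_0 minus_half)
next
  case (Suc b)
  have "q_pairing (int a) (int (Suc b)) = tconst (1 / 2) * (q a * q (Suc b) - q (Suc a) * q b) - q_pairing (int (Suc a)) (int b)"
    using q_pairing_recurrence[of "int a" "int (Suc b)"] qz_int[of "Suc a"] qz_int[of "Suc b"] qz_int[of a] qz_int[of b]
    by (simp add: eq_diff_eq add.commute del: qz_int)
  moreover have "q_pairing (int (Suc b)) (int a) = tconst (1 / 2) * (q b * q (Suc a) - q (Suc b) * q a) - q_pairing (int b) (int (Suc a))"
    using q_pairing_recurrence[of "int b" "int (Suc a)"] qz_int[of "Suc a"] qz_int[of "Suc b"] qz_int[of a] qz_int[of b]
    by (simp add: eq_diff_eq add.commute del: qz_int)
  moreover have "tconst (1 / 2) * (q a * q (Suc b) - q (Suc a) * q b) + tconst (1 / 2) * (q b * q (Suc a) - q (Suc b) * q a) = 0"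
    by (simp add: mult.commute flip: distrib_left)
  ultimately have "q_pairing (int a) (int (Suc b)) + q_pairing (int (Suc b)) (int a) = - (q_pairing (int (Suc a)) (int b) + q_pairing (int b) (int (Suc a)))"
    by (metis (no_types, lifting) add_diff_add diff_0 add.commute)
  then show ?case unfolding Suc by simp
qed

text \<open>Only indices from \<open>m\<close> on contribute; as \<open>m > 0\<close>, the
  exceptional coefficient \<open>shift_coeff 0\<close> is not among them, and the sum is a
  coefficient of q(z) q(-z) = 1.\<close>

lemma q_pairing_left_neg:
  assumes "m > 0" shows "q_pairing (- int m) (int b) = (if b = m then (- 1) ^ m else 0)"
proof (cases "m \<le> b")
  case True
  have "(\<Sum>n\<le>b. tconst (shift_coeff n) * (qz (- int m + int n) * qz (int b - int n)))
     = (\<Sum>n\<in>{m..b}. tconst (shift_coeff n) * (qz (- int m + int n) * qz (int b - int n)))"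
    by (rule sum.mono_neutral_right) auto
  also have "\<dots> = (\<Sum>i\<le>b - m. tconst 2 * ((- 1) ^ m * ((- 1) ^ i * q i * q (b - m - i))))"
  proof (rule sum.reindex_bij_witness[where i = "\<lambda>i. i + m" and j = "\<lambda>n. n - m"])
    fix n assume n: "n \<in> {m..b}"
    then have "qz (- int m + int n) = q (n - m)" "qz (int b - int n) = q (b - m - (n - m))"
      by (intro qz_1; simp)+
    moreover have "n = m + (n - m)" using n by simp
    then have "tconst (shift_coeff n) = tconst 2 * ((- 1) ^ m * (- 1) ^ (n - m))"
      using n assms by (metis atLeastAtMost_iff not_gr_zero not_le power_add shift_coeff_def tconst_mult tconst_neg_1_power)
    ultimately show "tconst 2 * ((- 1) ^ m * ((- 1) ^ (n - m) * q (n - m) * q (b - m - (n - m))))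
      = tconst (shift_coeff n) * (qz (- int m + int n) * qz (int b - int n))" by (simp add: mult.assoc)
  qed (use True in auto)
  also have "\<dots> = tconst 2 * ((- 1) ^ m * (\<Sum>i\<le>b - m. (- 1) ^ i * q i * q (b - m - i)))"
    by (simp add: sum_distrib_left)
  also have "(\<Sum>i\<le>b - m. (- 1) ^ i * q i * q (b - m - i)) = (if b = m then 1 else 0)"
    using q_alternating_sum[of "b - m"] True by auto
  finally show ?thesis by (simp add: q_pairing_def tconst_half(1))
next
  case False
  then show ?thesis by (auto simp: q_pairing_def intro!: sum.neutral)
qed

text \<open>The right side is the delta function at z = -w by which the two expansions of the kernel
  differ. It will become the scalar in the Clifford relation.\<close>

lemma q_pairing_skew: "q_pairing a b + q_pairing b a = (if a + b = 0 then (- 1) ^ nat \<bar>a\<bar> else 0)"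
proof -
  have nn: "q_pairing a b + q_pairing b a = (if a + b = 0 then (- 1) ^ nat \<bar>a\<bar> else 0)" if "a \<ge> 0" "b \<ge> 0" for a b
    using q_pairing_skew_nonneg[of "nat a" "nat b"] that by auto
  have pn: "q_pairing a b + q_pairing b a = (if a + b = 0 then (- 1) ^ nat \<bar>a\<bar> else 0)" if "a < 0" for a b
  proof (cases "b < 0")
    case False
    then show ?thesis using that q_pairing_left_neg[of "nat (- a)" "nat b"] by (auto simp: q_pairing_right_neg)
  qed (use that in \<open>auto simp: q_pairing_right_neg\<close>)
  show ?thesis
  proof (cases "a < 0")
    case False
    show ?thesis
    proof (cases "b < 0")
      case True
      moreover have "a + b = 0 \<Longrightarrow> nat \<bar>b\<bar> = nat \<bar>a\<bar>" by linarith
      ultimately show ?thesis using pn[of b a] by (auto simp: add.commute)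
    qed (use nn False in auto)
  qed (rule pn)
qed

lemma q_pairing_Suc:
  assumes "b > 0"
  shows "q_pairing (int a) (int b) = tconst (1 / 2) * q a * q b + (\<Sum>k = 1..b. (- 1) ^ k * q (a + k) * q (b - k))"
proof -
  have "(\<Sum>n\<le>b. tconst (shift_coeff n) * (qz (int a + int n) * qz (int b - int n)))
     = q a * q b + tconst 2 * (\<Sum>k = 1..b. (- 1) ^ k * q (a + k) * q (b - k))"
  proof -
    have "{..b} = insert 0 {1..b}" by auto
    moreover have "tconst (shift_coeff n) * (qz (int a + int n) * qz (int b - int n)) = tconst 2 * ((- 1) ^ n * q (a + n) * q (b - n))"
      if "n \<in> {1..b}" for n
    proof -
      have "qz (int a + int n) = q (a + n)" "qz (int b - int n) = q (b - n)"
        using that by (intro qz_1; simp)+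
      then show ?thesis using that by (simp add: shift_coeff_def tconst_mult tconst_neg_1_power mult.assoc)
    qed
    ultimately show ?thesis by (simp add: shift_coeff_def sum_distrib_left)
  qed
  then show ?thesis by (simp add: q_pairing_def distrib_left tconst_half mult.assoc)
qed

text \<open>The coefficient form of the rank-two identity for the kernel. The induction on
  \<open>b\<close> keeps \<open>a\<close> an arbitrary integer because the recurrence raises
  it.\<close>

lemma tshift_q_pairing:
  "tshift (q_pairing a (int b)) - fps_const (q_pairing a (int b)) = fps_const (tconst (1 / 2)) *
     ((tshift (qz a) - fps_const (qz a)) * fps_const (q b) - fps_const (qz a) * (tshift (q b) - fps_const (q b)))"
proof (induction b arbitrary: a)
  case 0
  show ?case
    by (simp add: q_pairing_right_0 tshift_tconst_mult tshift_1 right_diff_distrib flip: fps_const_mult)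
next
  case (Suc b)
  let ?c = fps_const and ?h = "fps_const (tconst (1 / 2))"
  let ?u = "\<lambda>j. tshift (qz j) + ?c (qz j)" and ?v = "\<lambda>j. tshift (qz j) - ?c (qz j)"
  have uv: "?v j = - (fps_X * ?u (j - 1))" for j
    using tshift_qz_recurrence[of j] by (simp add: algebra_simps)
  have eq: "q_pairing a (int (Suc b)) = tconst (1 / 2) * (qz a * q (Suc b) - qz (a + 1) * q b) - q_pairing (a + 1) (int b)"
    using q_pairing_recurrence[of a "int (Suc b)"] qz_int[of "Suc b"] qz_int[of "b"]
    by (simp add: eq_diff_eq del: qz_int)
  \<comment> \<open>Since \<open>?v j\<close> is minus the series variable times
    \<open>?u (j - 1)\<close>, both sides are minus that variable times
    \<open>?u a * ?u (int b)\<close>.\<close>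
  have key: "?u a * ?v (int (Suc b)) = ?v (a + 1) * ?u (int b)"
  proof -
    have 1: "?v (a + 1) = - (fps_X * ?u a)" using uv[of "a + 1"] by simp
    have 2: "?v (int (Suc b)) = - (fps_X * ?u (int b))" using uv[of "int (Suc b)"] by simp
    show ?thesis unfolding 1 2 by (simp only: mult_minus_right mult_minus_left mult_ac)
  qed
  have "tshift (q_pairing a (int (Suc b))) - ?c (q_pairing a (int (Suc b))) =
      ?h * (tshift (qz a) * tshift (q (Suc b)) - tshift (qz (a + 1)) * tshift (q b) - ?c (qz a) * ?c (q (Suc b)) + ?c (qz (a + 1)) * ?c (q b))
      - (tshift (q_pairing (a + 1) (int b)) - ?c (q_pairing (a + 1) (int b)))"
    by (simp only: eq tshift_diff tshift_tconst tshift_mult fps_const_mult[symmetric] fps_const_sub[symmetric])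
      (simp only: right_diff_distrib distrib_left diff_conv_add_uminus minus_add_distrib minus_minus mult_minus_right add_ac)
  also have "\<dots> = ?h * ((tshift (qz a) * tshift (q (Suc b)) - tshift (qz (a + 1)) * tshift (q b) - ?c (qz a) * ?c (q (Suc b)) + ?c (qz (a + 1)) * ?c (q b))
      - (?v (a + 1) * ?c (q b) - ?c (qz (a + 1)) * (tshift (q b) - ?c (q b))))"
    unfolding Suc by (rule right_diff_distrib[symmetric])
  also have "(tshift (qz a) * tshift (q (Suc b)) - tshift (qz (a + 1)) * tshift (q b) - ?c (qz a) * ?c (q (Suc b)) + ?c (qz (a + 1)) * ?c (q b))
      - (?v (a + 1) * ?c (q b) - ?c (qz (a + 1)) * (tshift (q b) - ?c (q b)))
    = ?v a * ?c (q (Suc b)) - ?c (qz a) * (tshift (q (Suc b)) - ?c (q (Suc b)))"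
    using key unfolding qz_int by (simp add: algebra_simps)
  finally show ?case .
qed

section \<open>Vertex operators\<close>

definition inv_sqrt2 :: complex where "inv_sqrt2 = 1 / complex_of_real (sqrt 2)"

lemma inv_sqrt2_mult [simp]: "inv_sqrt2 * inv_sqrt2 = 1 / 2" "inv_sqrt2 * complex_of_real (sqrt 2) = 1" "complex_of_real (sqrt 2) * inv_sqrt2 = 1"
  by (simp_all add: inv_sqrt2_def flip: of_real_mult)

lemma inv_sqrt2_double: "inv_sqrt2 * 2 = complex_of_real (sqrt 2)"
proof -
  have "inv_sqrt2 * 2 = inv_sqrt2 * (complex_of_real (sqrt 2) * complex_of_real (sqrt 2))" by (simp flip: of_real_mult)
  then show ?thesis by (simp only: mult.assoc[symmetric] inv_sqrt2_mult mult_1)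
qed

text \<open>What remains of \<open>X_op\<close> once the shift is split off: multiplication by q(z)
  and extraction of a power of z. Unlike \<open>X_op\<close>, it is linear over the whole ring of
  series.\<close>

definition vertex_lin :: "int \<Rightarrow> tseries fps \<Rightarrow> tseries" where
  "vertex_lin \<alpha> F = tconst inv_sqrt2 * (\<Sum>\<^sub>\<infinity>n\<in>{n :: nat. 0 \<le> \<alpha> + int n}. q (nat (\<alpha> + int n)) * F $ n)"

lemma X_op_eq_vertex_lin: "X_op \<alpha> f = vertex_lin \<alpha> (tshift f)"
  by (simp add: X_op_def vertex_lin_def tshift_def inv_sqrt2_def)

lemma coeff_q_mult_eq_0: "weight m < n \<Longrightarrow> coeff (q n * f) m = 0"
  by (auto simp: coeff_mult_homog[OF homog_q] intro!: sum.neutral)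

lemma coeff_vertex_lin:
  assumes "weight m + nat \<bar>\<alpha>\<bar> \<le> N"
  shows "coeff (vertex_lin \<alpha> F) m = inv_sqrt2 * (\<Sum>n\<le>N. coeff (qz (\<alpha> + int n) * F $ n) m)"
proof -
  let ?S = "{n :: nat. 0 \<le> \<alpha> + int n}" and ?F = "\<lambda>n. q (nat (\<alpha> + int n)) * F $ n"
  have "coeff (infsum ?F ?S) m = (\<Sum>n\<in>{n\<in>?S. n \<le> N}. coeff (?F n) m)"
  proof (rule coeff_infsum)
    fix M
    show "finite {n\<in>?S. \<exists>m. weight m \<le> M \<and> coeff (?F n) m \<noteq> 0}"
    proof (rule finite_subset)
      show "{n\<in>?S. \<exists>m. weight m \<le> M \<and> coeff (?F n) m \<noteq> 0} \<subseteq> {..M + nat \<bar>\<alpha>\<bar>}"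
      proof clarify
        fix n m assume "0 \<le> \<alpha> + int n" "weight m \<le> M" "coeff (?F n) m \<noteq> 0"
        with coeff_q_mult_eq_0[of m "nat (\<alpha> + int n)" "F $ n"] show "n \<le> M + nat \<bar>\<alpha>\<bar>" by linarith
      qed
    qed simp
  next
    fix n assume "n \<in> ?S - {n\<in>?S. n \<le> N}"
    then show "coeff (?F n) m = 0" using assms by (intro coeff_q_mult_eq_0) auto
  qed auto
  also have "\<dots> = (\<Sum>n\<le>N. coeff (qz (\<alpha> + int n) * F $ n) m)"
    by (rule sum.mono_neutral_cong_left) (auto simp: qz_def)
  finally show ?thesis by (simp add: vertex_lin_def)
qed

lemma vertex_lin_add: "vertex_lin \<alpha> (F + G) = vertex_lin \<alpha> F + vertex_lin \<alpha> G"
  by (rule tseries_eqI)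
    (simp only: coeff_add coeff_vertex_lin[OF order_refl] fps_add_nth distrib_left sum.distrib)

lemma vertex_lin_const_mult: "vertex_lin \<alpha> (fps_const h * F) = h * vertex_lin \<alpha> F"
proof (rule tseries_eqI)
  fix m
  let ?N = "weight m + nat \<bar>\<alpha>\<bar>"
  \<comment> \<open>One cut-off serves all divisors \<open>a\<close> of \<open>m\<close>, because
    \<open>m - a\<close> is never heavier than \<open>m\<close>.\<close>
  have "coeff (vertex_lin \<alpha> F) (m - a) = inv_sqrt2 * (\<Sum>n\<le>?N. coeff (qz (\<alpha> + int n) * F $ n) (m - a))" if "a \<subseteq># m" for a
    by (rule coeff_vertex_lin) (use weight_diff[OF that] in simp)
  then have "coeff (h * vertex_lin \<alpha> F) m = (\<Sum>a | a \<subseteq># m. coeff h a * (inv_sqrt2 * (\<Sum>n\<le>?N. coeff (qz (\<alpha> + int n) * F $ n) (m - a))))"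
    by (subst coeff_mult) (intro sum.cong, simp_all)
  also have "\<dots> = coeff (h * (tconst inv_sqrt2 * (\<Sum>n\<le>?N. qz (\<alpha> + int n) * F $ n))) m"
    by (subst coeff_mult) simp
  also have "h * (tconst inv_sqrt2 * (\<Sum>n\<le>?N. qz (\<alpha> + int n) * F $ n)) = tconst inv_sqrt2 * (\<Sum>n\<le>?N. qz (\<alpha> + int n) * (fps_const h * F) $ n)"
    by (simp add: sum_distrib_left mult_ac)
  also have "coeff \<dots> m = coeff (vertex_lin \<alpha> (fps_const h * F)) m"
    by (simp add: coeff_vertex_lin[OF order_refl])
  finally show "coeff (vertex_lin \<alpha> (fps_const h * F)) m = coeff (h * vertex_lin \<alpha> F) m" ..
qed

lemma vertex_lin_finite:
  assumes "\<And>n. n > N \<Longrightarrow> F $ n = 0"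
  shows "vertex_lin \<alpha> F = tconst inv_sqrt2 * (\<Sum>n\<le>N. qz (\<alpha> + int n) * F $ n)"
proof (rule tseries_eqI)
  fix m
  have "coeff (vertex_lin \<alpha> F) m = inv_sqrt2 * (\<Sum>n\<le>N + (weight m + nat \<bar>\<alpha>\<bar>). coeff (qz (\<alpha> + int n) * F $ n) m)"
    by (rule coeff_vertex_lin) simp
  also have "(\<Sum>n\<le>N + (weight m + nat \<bar>\<alpha>\<bar>). coeff (qz (\<alpha> + int n) * F $ n) m) = (\<Sum>n\<le>N. coeff (qz (\<alpha> + int n) * F $ n) m)"
    by (rule sum.mono_neutral_right) (auto simp: assms)
  finally show "coeff (vertex_lin \<alpha> F) m = coeff (tconst inv_sqrt2 * (\<Sum>n\<le>N. qz (\<alpha> + int n) * F $ n)) m" by simp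
qed

text \<open>Bordering uses only the existence of a linear \<Lambda>, and this property passes to
  linear combinations with constant coefficients. So a truncated vector of the column space acts by
  a single bordering row.\<close>

definition vertex_op :: "(tseries \<Rightarrow> tseries) \<Rightarrow> bool" where
  "vertex_op T \<longleftrightarrow> (\<exists>\<Lambda>. (\<forall>F G. \<Lambda> (F + G) = \<Lambda> F + \<Lambda> G) \<and> (\<forall>h F. \<Lambda> (fps_const h * F) = h * \<Lambda> F)
     \<and> (\<forall>f. T f = \<Lambda> (tshift f)))"

lemma vertex_op_X: "vertex_op (X_op \<alpha>)"
  unfolding vertex_op_def by (intro exI[of _ "vertex_lin \<alpha>"]) (simp add: vertex_lin_add vertex_lin_const_mult X_op_eq_vertex_lin)

lemma vertex_op_tconst_mult: "vertex_op T \<Longrightarrow> vertex_op (\<lambda>f. tconst c * T f)"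
  unfolding vertex_op_def
proof (elim exE conjE)
  fix \<Lambda> :: "tseries fps \<Rightarrow> tseries"
  assume "\<forall>F G. \<Lambda> (F + G) = \<Lambda> F + \<Lambda> G" "\<forall>h F. \<Lambda> (fps_const h * F) = h * \<Lambda> F" "\<forall>f. T f = \<Lambda> (tshift f)"
  then show "\<exists>\<Lambda>. (\<forall>F G. \<Lambda> (F + G) = \<Lambda> F + \<Lambda> G) \<and> (\<forall>h F. \<Lambda> (fps_const h * F) = h * \<Lambda> F)
     \<and> (\<forall>f. tconst c * T f = \<Lambda> (tshift f))"
    by (intro exI[of _ "\<lambda>F. tconst c * \<Lambda> F"]) (simp add: distrib_left mult.left_commute)
qed

lemma vertex_op_add: "vertex_op T \<Longrightarrow> vertex_op T' \<Longrightarrow> vertex_op (\<lambda>f. T f + T' f)"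
  unfolding vertex_op_def
proof (elim exE conjE)
  fix \<Lambda> \<Lambda>' :: "tseries fps \<Rightarrow> tseries"
  assume "\<forall>F G. \<Lambda> (F + G) = \<Lambda> F + \<Lambda> G" "\<forall>h F. \<Lambda> (fps_const h * F) = h * \<Lambda> F" "\<forall>f. T f = \<Lambda> (tshift f)"
    "\<forall>F G. \<Lambda>' (F + G) = \<Lambda>' F + \<Lambda>' G" "\<forall>h F. \<Lambda>' (fps_const h * F) = h * \<Lambda>' F" "\<forall>f. T' f = \<Lambda>' (tshift f)"
  then show "\<exists>\<Lambda>. (\<forall>F G. \<Lambda> (F + G) = \<Lambda> F + \<Lambda> G) \<and> (\<forall>h F. \<Lambda> (fps_const h * F) = h * \<Lambda> F)
     \<and> (\<forall>f. T f + T' f = \<Lambda> (tshift f))"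
    by (intro exI[of _ "\<lambda>F. \<Lambda> F + \<Lambda>' F"]) (simp add: distrib_left add_ac)
qed

lemma vertex_op_0: "vertex_op (\<lambda>f. 0)"
  unfolding vertex_op_def by (intro exI[of _ "\<lambda>F. 0"]) simp

lemma vertex_op_sum: "(\<And>x. x \<in> B \<Longrightarrow> vertex_op (T x)) \<Longrightarrow> vertex_op (\<lambda>f. \<Sum>x\<in>B. T x f)"
  by (induction B rule: infinite_finite_induct) (simp_all add: vertex_op_0 vertex_op_add)

lemma vertex_op_additive: "vertex_op T \<Longrightarrow> T (f + g) = T f + T g"
  by (auto simp: vertex_op_def tshift_add)

lemma vertex_op_scale: "vertex_op T \<Longrightarrow> T (tconst c * f) = tconst c * T f"
  by (auto simp: vertex_op_def tshift_tconst_mult)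

lemma vertex_op_zero: "vertex_op T \<Longrightarrow> T 0 = 0"
  using vertex_op_scale[of T 0 0] by simp

text \<open>A vertex operator \<open>\<Lambda> \<circ> tshift\<close> borders a Pfaffian: \<open>tshift\<close>, a ring homomorphism, perturbs the matrix by
  an alternating form of rank two, which bordering by two rows realizes, and \<open>\<Lambda>\<close> is linear.\<close>

lemma vertex_op_pf:
  fixes A :: "'l \<Rightarrow> 'l \<Rightarrow> tseries" and p :: "'l \<Rightarrow> tseries"
  defines "\<sigma> \<equiv> \<lambda>c. tshift (p c) - fps_const (p c)"
  assumes "vertex_op T" "alternating A"
    and shift: "\<And>c d. c \<in> set L \<Longrightarrow> d \<in> set L \<Longrightarrow>
       tshift (A c d) = fps_const (A c d) - (\<sigma> c * fps_const (p d) - fps_const (p c) * \<sigma> d)"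
    and b: "\<And>c. c \<in> set L \<Longrightarrow> A b c = p c"
    and a: "\<And>c. c \<in> set L \<Longrightarrow> A a c = T (p c)" "A a b = T 1"
    and ab: "a \<noteq> b" "a \<notin> set L" "b \<notin> set L"
  shows "T (pf A L) = pf A (a # b # L)"
proof -
  interpret alternating A by fact
  \<comment> \<open>A matrix over the series in u whose rows \<open>a\<close> and \<open>b\<close>
    carry the two vectors of the rank-two change. Eliminating both by \<open>pf_border\<close> gives
    the shifted entries on \<open>L\<close>.\<close>
  define A' where "A' c d =
    (if c = d then 0 else if c = a then (if d = b then 1 else \<sigma> d) else if d = a then (if c = b then - 1 else - \<sigma> c)
     else if c = b then fps_const (p d) else if d = b then - fps_const (p c) else fps_const (A c d))" for c d
  interpret A': alternating A'
  proof
    show "A' c d = - A' d c" for c d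
      using skew[of c d] ab(1) by (auto simp: A'_def simp flip: fps_const_neg)
  qed (simp add: A'_def)
  obtain \<Lambda> where add: "\<And>F G. \<Lambda> (F + G) = \<Lambda> F + \<Lambda> G"
    and scale: "\<And>h F. \<Lambda> (fps_const h * F) = h * \<Lambda> F" and T: "\<And>f. T f = \<Lambda> (tshift f)"
    using assms(2) unfolding vertex_op_def by blast
  have zero: "\<Lambda> 0 = 0" using scale[of 0 0] by simp
  have minus: "\<Lambda> (- F) = - \<Lambda> F" for F using scale[of "- 1" F]
    by (simp only: fps_const_neg[symmetric] fps_const_1_eq_1 mult_minus_left mult_1)
  have diff: "\<Lambda> (F - G) = \<Lambda> F - \<Lambda> G" for F G using add[of F "- G"]
    by (simp only: minus diff_conv_add_uminus)
  have sum: "\<Lambda> (\<Sum>k<n. F k) = (\<Sum>k<n. \<Lambda> (F k))" for n :: nat and F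
    by (induction n) (simp_all add: zero add)
  have const: "\<Lambda> (fps_const h) = h * T 1" for h
    using scale[of h 1] by (simp add: T tshift_1)
  have diag': "fps_const (A c c) = 0" for c by (simp add: diag)
  have pfL: "pf A' L = fps_const (pf A L)"
    by (subst pf_hom[of fps_const]) (auto intro!: pf_cong simp: A'_def ab diag' simp flip: fps_const_add fps_const_mult)
  have pf_bord: "pf A' (b # del k L) = fps_const (pf A (b # del k L))" for k
  proof (subst pf_hom[of fps_const])
    have "c \<in> set L \<Longrightarrow> A c b = - p c" for c using skew[of c b] b[of c] by simp
    then show "pf A' (b # del k L) = pf (\<lambda>c d. fps_const (A c d)) (b # del k L)"
      using set_del_subset[of k L] ab
      by (intro pf_cong) (auto simp: A'_def diag' b subset_iff)
  qed (auto simp flip: fps_const_add fps_const_mult)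
  have expand: "pf B (c # d # L) = B c d * pf B L - (\<Sum>k<length L. (- 1) ^ k * B c (L ! k) * pf B (d # del k L))"
    for B :: "'l \<Rightarrow> 'l \<Rightarrow> 'r :: comm_ring_1" and c d
    by (simp add: pf.simps(2)[of _ c] sum.lessThan_Suc_shift sum_negf del: sum.lessThan_Suc)
  have "tshift (pf A L) = pf (\<lambda>c d. tshift (A c d)) L"
    by (rule pf_hom) (simp_all add: tshift_1 tshift_add tshift_uminus tshift_mult)
  also have "\<dots> = pf (\<lambda>c d. A' c d - (A' a c * A' b d - A' b c * A' a d)) L"
    using ab by (intro pf_cong) (auto simp: shift A'_def diag' diag)
  also have "\<dots> = pf A' (a # b # L)"
    by (rule A'.pf_border[symmetric]) (use ab in \<open>simp add: A'_def\<close>)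
  \<comment> \<open>Expansion along \<open>a\<close> confines u to the entries \<sigma>. The minors
    without \<open>a\<close> are constant in u, so \<Lambda> can be pulled past them.\<close>
  also have "\<dots> = fps_const (pf A L) - (\<Sum>k<length L. fps_const ((- 1) ^ k * pf A (b # del k L)) * \<sigma> (L ! k))"
  proof -
    have pw: "fps_const ((- 1) ^ k :: tseries) = (- 1) ^ k" for k
      by (induction k) (simp_all flip: fps_const_neg fps_const_mult)
    have "(- 1) ^ k * A' a (L ! k) * fps_const (pf A (b # del k L)) = fps_const ((- 1) ^ k * pf A (b # del k L)) * \<sigma> (L ! k)"
      if "k < length L" for k
    proof -
      have "A' a (L ! k) = \<sigma> (L ! k)" using ab nth_mem[OF that] by (auto simp: A'_def)
      then show ?thesis by (simp only: fps_const_mult[symmetric] pw mult_ac)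
    qed
    moreover have "A' a b = 1" using ab by (simp add: A'_def)
    ultimately show ?thesis unfolding expand pfL pf_bord by simp
  qed
  finally have tshift_pf: "tshift (pf A L) = fps_const (pf A L) - (\<Sum>k<length L. fps_const ((- 1) ^ k * pf A (b # del k L)) * \<sigma> (L ! k))" .
  have "T (pf A L) = pf A L * T 1 - (\<Sum>k<length L. (- 1) ^ k * pf A (b # del k L) * (T (p (L ! k)) - p (L ! k) * T 1))"
    unfolding T[of "pf A L"] tshift_pf by (simp only: diff sum scale const \<sigma>_def T[symmetric])
  also have "\<dots> = pf A L * T 1 - (\<Sum>k<length L. (- 1) ^ k * pf A (b # del k L) * T (p (L ! k)))
      + (\<Sum>k<length L. (- 1) ^ k * A b (L ! k) * pf A (b # del k L)) * T 1"
    by (simp add: right_diff_distrib sum_subtractf sum_distrib_left b mult_ac)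
  \<comment> \<open>The terms with \<open>T 1\<close> that stem from \<sigma> assemble into a
    Pfaffian with \<open>b\<close> repeated.\<close>
  also have "(\<Sum>k<length L. (- 1) ^ k * A b (L ! k) * pf A (b # del k L)) = 0"
  proof -
    have "A b b * pf A L - (\<Sum>k<length L. (- 1) ^ k * A b (L ! k) * pf A (b # del k L)) = 0"
      unfolding expand[symmetric] by (rule pf_repeated) simp
    then show ?thesis by (simp only: diag mult_zero_left diff_0 neg_equal_0_iff_equal)
  qed
  also have "pf A L * T 1 - (\<Sum>k<length L. (- 1) ^ k * pf A (b # del k L) * T (p (L ! k))) + 0 * T 1 = pf A (a # b # L)"
    unfolding expand by (simp add: a mult_ac)
  finally show ?thesis .
qed

text \<open>The bordering row at the label -i. For i > 0 it is Q_{i,0}; the value 1 at 0 is fixed by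
  the shift, so the index 0 follows the same rank-two rule \<open>tshift_skewQ\<close>.\<close>

definition qhat :: "nat \<Rightarrow> tseries"
  where "qhat i = (if i = 0 then 1 else tconst inv_sqrt2 * q i)"

definition skewQ :: "nat \<Rightarrow> nat \<Rightarrow> tseries"
  where "skewQ i j = (if i = j then 0 else if j < i then schurQ i j else - schurQ j i)"

lemma skewQ_skew: "skewQ i j = - skewQ j i" by (auto simp: skewQ_def)

lemma skewQ_eq_q_pairing: assumes "i > 0" "j > 0" shows "skewQ i j = q_pairing (int i) (int j)"
proof -
  have gt: "schurQ i j = q_pairing (int i) (int j)" if "j > 0" for i j
    using that by (simp add: schurQ_def q_pairing_Suc)
  have skew: "q_pairing (int i) (int j) = - q_pairing (int j) (int i)"
    using q_pairing_skew[of "int i" "int j"] assms by (simp add: eq_neg_iff_add_eq_0)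
  have "q_pairing (int i) (int i) = 0"
  proof -
    have "tconst (1 / 2) * (q_pairing (int i) (int i) + q_pairing (int i) (int i)) = 0"
      using q_pairing_skew[of "int i" "int i"] assms by simp
    then show ?thesis by (metis distrib_left tconst_half(2))
  qed
  then show ?thesis using assms by (auto simp: skewQ_def gt skew[symmetric])
qed

lemma skewQ_0_right: "skewQ i 0 = (if i = 0 then 0 else qhat i)"
  by (simp add: skewQ_def schurQ_def qhat_def inv_sqrt2_def)

lemma tshift_skewQ:
  "tshift (skewQ i j) = fps_const (skewQ i j) + ((tshift (qhat i) - fps_const (qhat i)) * fps_const (qhat j)
      - fps_const (qhat i) * (tshift (qhat j) - fps_const (qhat j)))"
proof -
  let ?R = "\<lambda>i j. (tshift (qhat i) - fps_const (qhat i)) * fps_const (qhat j) - fps_const (qhat i) * (tshift (qhat j) - fps_const (qhat j))"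
  have R: "?R i 0 = tshift (qhat i) - fps_const (qhat i)" for i by (simp add: qhat_def[of 0] tshift_1)
  have skew: "?R i j = - ?R j i" for i j by (simp add: algebra_simps)
  consider "j = 0" | "i = 0" | "i > 0" "j > 0" by auto
  then show ?thesis
  proof cases
    case 1
    then show ?thesis by (simp only: R skewQ_0_right) (simp add: qhat_def tshift_1)
  next
    case 2
    then show ?thesis
      by (subst (1 2) skewQ_skew, subst skew) (simp only: R skewQ_0_right, simp add: qhat_def tshift_1 tshift_uminus flip: fps_const_neg)
  next
    case 3
    \<comment> \<open>The factor 1/2 of the pairing is shared equally by the two vectors, whence the
      1/sqrt 2 in \<open>qhat\<close>.\<close>
    have half: "fps_const (tconst (1 / 2)) = fps_const (tconst inv_sqrt2) * fps_const (tconst inv_sqrt2)"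
      by (simp add: tconst_mult[symmetric])
    have "tshift (skewQ i j) - fps_const (skewQ i j) = ?R i j"
      using 3 tshift_q_pairing[of "int i" j] by (simp only: skewQ_eq_q_pairing half qz_int)
        (simp add: qhat_def tshift_mult tshift_tconst algebra_simps flip: fps_const_mult)
    then show ?thesis by (simp add: algebra_simps)
  qed
qed

lemma X_op_q: "X_op \<alpha> (q j) = tconst (inv_sqrt2 * 2) * q_pairing \<alpha> (int j)"
proof -
  have "X_op \<alpha> (q j) = tconst inv_sqrt2 * (\<Sum>n\<le>j. qz (\<alpha> + int n) * (tconst (shift_coeff n) * qz (int j - int n)))"
    unfolding X_op_eq_vertex_lin by (subst vertex_lin_finite[of j]) (simp_all add: tshift_q)
  then show ?thesis by (simp add: q_pairing_def tconst_mult_assoc mult_ac)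
qed

lemma X_op_1: "X_op \<alpha> 1 = tconst inv_sqrt2 * qz \<alpha>"
  using X_op_q[of \<alpha> 0] by (simp add: q_pairing_right_0 tconst_mult_assoc)

lemma X_op_qhat: "j > 0 \<Longrightarrow> X_op \<alpha> (qhat j) = q_pairing \<alpha> (int j)"
  by (simp add: qhat_def vertex_op_scale[OF vertex_op_X] X_op_q tconst_mult_assoc)
    (simp add: mult.assoc[symmetric])

lemma X_op_pos_qhat: "m > 0 \<Longrightarrow> X_op (int m) (qhat j) = skewQ m j"
  by (cases "j = 0") (simp_all add: X_op_qhat skewQ_eq_q_pairing skewQ_0_right, simp add: qhat_def X_op_1)

text \<open>An annihilation operator sees a single entry of the bordering row, so bordering by it
  strikes out one label.\<close>

lemma X_op_neg_qhat: "m > 0 \<Longrightarrow> X_op (- int m) (qhat j) = (if j = m then (- 1) ^ m else 0)"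
  by (cases "j = 0") (simp_all add: X_op_qhat q_pairing_left_neg, simp add: qhat_def X_op_1)

text \<open>The factor sqrt 2 attached to X_0 in the operator of a vector makes it reproduce row 0
  of the Q-block; the extra 1 at the index 0 enters \<open>target\<close>.\<close>

lemma X_op_0_qhat: "tconst (complex_of_real (sqrt 2)) * X_op 0 (qhat j) = skewQ 0 j + (if j = 0 then 1 else 0)"
proof (cases "j = 0")
  case True
  then show ?thesis by (simp add: qhat_def X_op_1 skewQ_def tconst_mult[symmetric])
next
  case False
  then have "q_pairing 0 (int j) = - (tconst (1 / 2) * q j)"
    using q_pairing_skew[of 0 "int j"] by (simp add: q_pairing_right_0 eq_neg_iff_add_eq_0)
  moreover have "complex_of_real (sqrt 2) / 2 = inv_sqrt2" by (simp flip: inv_sqrt2_double)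
  ultimately show ?thesis using False skewQ_skew[of 0 j]
    by (simp add: X_op_qhat skewQ_0_right tconst_mult_assoc) (simp add: qhat_def)
qed

lemma X_op_neg_1: "m > 0 \<Longrightarrow> X_op (- int m) 1 = 0"
  by (simp add: X_op_1)

section \<open>Clifford relations\<close>

text \<open>A predicate on integers treats lower bounds, upper bounds and excluded degrees alike,
  and can be translated by a negative amount: X_\<alpha> translates it by \<alpha>.\<close>

definition weight_in :: "(int \<Rightarrow> bool) \<Rightarrow> tseries \<Rightarrow> bool"
  where "weight_in P f \<longleftrightarrow> (\<forall>m. coeff f m \<noteq> 0 \<longrightarrow> P (int (weight m)))"

lemma weight_in_0 [simp]: "weight_in P 0" by (simp add: weight_in_def)

lemma weight_in_tconst_mult: "weight_in P f \<Longrightarrow> weight_in P (tconst c * f)"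
  by (simp add: weight_in_def)

lemma weight_in_sum: "(\<And>x. x \<in> B \<Longrightarrow> weight_in P (F x)) \<Longrightarrow> weight_in P (\<Sum>x\<in>B. F x)"
  unfolding weight_in_def by (metis (no_types, lifting) coeff_sum sum.not_neutral_contains_not_neutral)

lemma weight_in_diff: "weight_in P f \<Longrightarrow> weight_in P g \<Longrightarrow> weight_in P (f - g)"
  unfolding weight_in_def by (metis coeff_diff diff_self)

lemma weight_in_tderiv: assumes "weight_in P f" "odd k" shows "weight_in (\<lambda>x. P (x + int k)) (tderiv k f)"
  unfolding weight_in_def
proof (intro allI impI)
  fix m assume "coeff (tderiv k f) m \<noteq> 0"
  then have "coeff f (add_mset (k div 2) m) \<noteq> 0" by (auto simp: tderiv_def)
  then have "P (int (weight (add_mset (k div 2) m)))" using assms(1) unfolding weight_in_def by blast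
  moreover have "weight (add_mset (k div 2) m) = weight m + k"
    using odd_two_times_div_two_succ[OF assms(2)] by simp
  ultimately show "P (int (weight m) + int k)" by (simp only: of_nat_add)
qed

lemma weight_in_dpow: "weight_in P f \<Longrightarrow> weight_in (\<lambda>x. P (x + int n)) (dpow j n f)"
proof (induction j arbitrary: n)
  case (Suc j)
  show ?case unfolding dpow.simps(2)
  proof (intro weight_in_sum weight_in_tconst_mult)
    fix k assume k: "k \<in> {k. 1 \<le> k \<and> k \<le> n \<and> odd k}"
    have "weight_in (\<lambda>x. P (x + int k + int (n - k))) (tderiv k (dpow j (n - k) f))"
      by (rule weight_in_tderiv[OF Suc.IH[OF Suc.prems]]) (use k in simp)
    moreover have "x + int k + int (n - k) = x + int n" for x using k by simp
    ultimately show "weight_in (\<lambda>x. P (x + int n)) (tderiv k (dpow j (n - k) f))" by (simp only:)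
  qed
qed simp

lemma weight_in_dexp: "weight_in P f \<Longrightarrow> weight_in (\<lambda>x. P (x + int n)) (dexp n f)"
  unfolding dexp_def by (intro weight_in_sum weight_in_tconst_mult weight_in_dpow)

lemma weight_in_qz_mult: assumes "weight_in P f" shows "weight_in (\<lambda>x. P (x - a)) (qz a * f)"
proof (cases "a < 0")
  case False
  then obtain n where a: "a = int n" by (metis nonneg_int_cases not_le)
  show ?thesis
    unfolding weight_in_def
  proof (intro allI impI)
    fix m assume "coeff (qz a * f) m \<noteq> 0"
    then obtain b where b: "b \<subseteq># m" "coeff (q n) b \<noteq> 0" "coeff f (m - b) \<noteq> 0"
      unfolding a qz_int coeff_mult by (metis (no_types, lifting) mem_Collect_eq mult_eq_0_iff sum.not_neutral_contains_not_neutral)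
    have "weight b = n" using b(2) homog_q by (simp add: homog_def)
    then have "int (weight m) - a = int (weight (m - b))" using weight_diff[OF b(1)] a by simp
    then show "P (int (weight m) - a)" using b(3) assms by (simp add: weight_in_def)
  qed
qed simp

lemma weight_in_X_op: assumes "weight_in P f" shows "weight_in (\<lambda>x. P (x - \<alpha>)) (X_op \<alpha> f)"
  unfolding weight_in_def
proof (intro allI impI)
  fix m assume "coeff (X_op \<alpha> f) m \<noteq> 0"
  then have "(\<Sum>n\<le>weight m + nat \<bar>\<alpha>\<bar>. coeff (qz (\<alpha> + int n) * dexp n f) m) \<noteq> 0"
    unfolding X_op_eq_vertex_lin by (simp add: coeff_vertex_lin[OF order_refl] tshift_def)
  then obtain n where "coeff (qz (\<alpha> + int n) * dexp n f) m \<noteq> 0"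
    by (metis (no_types, lifting) sum.not_neutral_contains_not_neutral)
  then have "P (int (weight m) - (\<alpha> + int n) + int n)"
    using weight_in_qz_mult[OF weight_in_dexp[OF assms, of n], of "\<alpha> + int n"] unfolding weight_in_def by blast
  then show "P (int (weight m) - \<alpha>)" by simp
qed

lemma weight_in_False: "weight_in P f \<Longrightarrow> (\<And>n. \<not> P (int n)) \<Longrightarrow> f = 0"
  by (auto simp: weight_in_def tseries_eq_iff)

lemma tderiv_dpow: "tderiv k (dpow j n f) = dpow j n (tderiv k f)"
proof (induction j arbitrary: n)
  case (Suc j)
  then show ?case by (simp add: tderiv_sum tderiv_tconst_mult tderiv_commute[of k])
qed simp

lemma tderiv_dexp: "tderiv k (dexp n f) = dexp n (tderiv k f)"
  by (simp add: dexp_def tderiv_sum tderiv_tconst_mult tderiv_dpow)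

lemma dexp_add: "dexp n (f + g) = dexp n f + dexp n g"
  using arg_cong[OF tshift_add[of f g], of "\<lambda>F. F $ n"] by (simp add: tshift_def)

lemma dexp_tconst_mult: "dexp n (tconst c * f) = tconst c * dexp n f"
  using arg_cong[OF tshift_tconst_mult[of c f], of "\<lambda>F. F $ n"] by (simp add: tshift_def)

lemma dexp_0_right [simp]: "dexp n 0 = 0"
  using dexp_tconst_mult[of n 0 0] by simp

lemma dexp_sum: "dexp n (\<Sum>x\<in>B. F x) = (\<Sum>x\<in>B. dexp n (F x))"
  by (induction B rule: infinite_finite_induct) (simp_all add: dexp_add)

lemma dpow_dexp: "dpow j n (dexp b f) = dexp b (dpow j n f)"
  by (induction j arbitrary: n) (simp_all add: dexp_sum dexp_tconst_mult tderiv_dexp)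

lemma dexp_commute: "dexp a (dexp b f) = dexp b (dexp a f)"
  unfolding dexp_def[of a] by (simp add: dpow_dexp dexp_sum dexp_tconst_mult)

text \<open>For D = -2 times the sum of (u^k/k) d/dt_k, the operator u d/du sends the power j + 1 of
  D to (j + 1) (u D') times the power j, and u D' is free of denominators.\<close>

lemma dpow_euler:
  "of_nat n * dpow (Suc j) n f = of_nat (Suc j) * (\<Sum>k | 1 \<le> k \<and> k \<le> n \<and> odd k. tconst (- 2) * tderiv k (dpow j (n - k) f))"
proof (induction j arbitrary: n)
  case 0
  have "of_nat n * (tconst (- 2 / of_nat k) * tderiv k (dpow 0 (n - k) f)) = tconst (- 2) * tderiv k (dpow 0 (n - k) f)"
    if "1 \<le> k" "k \<le> n" for k
    using that by (cases "k = n") (simp_all add: tconst_of_nat[symmetric] tconst_mult_assoc)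
  then have "of_nat n * dpow (Suc 0) n f = (\<Sum>k | 1 \<le> k \<and> k \<le> n \<and> odd k. tconst (- 2) * tderiv k (dpow 0 (n - k) f))"
    unfolding dpow.simps(2)[of 0] sum_distrib_left by (intro sum.cong refl) blast
  then show ?case by (simp only: of_nat_Suc of_nat_0 add_0_right mult_1)
next
  case (Suc j)
  let ?K = "\<lambda>n. {k. 1 \<le> k \<and> k \<le> n \<and> odd k}"
  let ?s = "\<Sum>k\<in>?K n. tconst (- 2) * tderiv k (dpow (Suc j) (n - k) f)"
  have "of_nat n * dpow (Suc (Suc j)) n f = (\<Sum>k\<in>?K n. tconst (- 2) * tderiv k (dpow (Suc j) (n - k) f)
      + tconst (- 2 / of_nat k) * tderiv k (of_nat (n - k) * dpow (Suc j) (n - k) f))"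
    unfolding dpow.simps(2)[of "Suc j"] sum_distrib_left
  proof (intro sum.cong refl)
    fix k assume k: "k \<in> ?K n"
    have n: "(of_nat n :: tseries) = of_nat k + of_nat (n - k)" using k by (simp flip: of_nat_add)
    have "of_nat k * (tconst (- 2 / of_nat k) * g) = tconst (- 2) * g" for g
      using k by (simp add: tconst_of_nat[symmetric] tconst_mult_assoc)
    then show "of_nat n * (tconst (- 2 / of_nat k) * tderiv k (dpow (Suc j) (n - k) f)) =
      tconst (- 2) * tderiv k (dpow (Suc j) (n - k) f)
      + tconst (- 2 / of_nat k) * tderiv k (of_nat (n - k) * dpow (Suc j) (n - k) f)"
      unfolding n distrib_right
      by (simp only: tconst_of_nat[symmetric] tderiv_tconst_mult mult.left_commute[of "tconst (- 2 / of_nat k)"])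
  qed
  also have "\<dots> = ?s + (\<Sum>k\<in>?K n. \<Sum>l\<in>?K (n - k). of_nat (Suc j) *
      (tconst (- 2) * tderiv l (tconst (- 2 / of_nat k) * tderiv k (dpow j (n - k - l) f))))"
    unfolding Suc sum.distrib
    by (simp only: tconst_of_nat[symmetric] tderiv_tconst_mult tderiv_sum sum_distrib_left mult.left_commute tderiv_commute)
  also have "(\<Sum>k\<in>?K n. \<Sum>l\<in>?K (n - k). of_nat (Suc j) *
      (tconst (- 2) * tderiv l (tconst (- 2 / of_nat k) * tderiv k (dpow j (n - k - l) f))))
    = (\<Sum>l\<in>?K n. \<Sum>k\<in>?K (n - l). of_nat (Suc j) *
      (tconst (- 2) * tderiv l (tconst (- 2 / of_nat k) * tderiv k (dpow j (n - k - l) f))))"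
    by (subst sum.Sigma, simp, simp, subst sum.Sigma, simp, simp,
        rule sum.reindex_bij_witness[where i = "\<lambda>(l, k). (k, l)" and j = "\<lambda>(k, l). (l, k)"]) auto
  also have "\<dots> = of_nat (Suc j) * ?s"
    unfolding dpow.simps(2)[of j] tderiv_sum sum_distrib_left
    by (intro sum.cong refl) (simp only: diff_commute)
  finally show ?case by (simp add: algebra_simps)
qed

lemma dexp_euler: "of_nat n * dexp n f = (\<Sum>k | 1 \<le> k \<and> k \<le> n \<and> odd k. tconst (- 2) * tderiv k (dexp (n - k) f))"
proof -
  let ?K = "{k. 1 \<le> k \<and> k \<le> n \<and> odd k}"
  have dexp: "dexp i f = (\<Sum>j\<le>N. tconst (1 / fact j) * dpow j i f)" if "i \<le> N" for i N
    unfolding dexp_def using that div_power_vanish[of i _ "fps_const f"]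
    by (intro sum.mono_neutral_left) (auto simp: dpow_eq div_power_def)
  have "of_nat n * dexp n f = (\<Sum>j\<le>Suc n. tconst (1 / fact j) * (of_nat n * dpow j n f))"
    by (simp add: dexp[of n "Suc n"] sum_distrib_left mult.left_commute del: sum.atMost_Suc)
  also have "\<dots> = (\<Sum>j\<le>n. tconst (1 / fact (Suc j)) * (of_nat n * dpow (Suc j) n f))"
    by (subst sum.atMost_Suc_shift) simp
  also have "\<dots> = (\<Sum>j\<le>n. \<Sum>k\<in>?K. tconst (- 2) * tderiv k (tconst (1 / fact j) * dpow j (n - k) f))"
  proof (intro sum.cong refl)
    fix j
    have "tconst (1 / fact (Suc j)) * (of_nat (Suc j) * g) = tconst (1 / fact j) * g" for g
      by (simp add: tconst_of_nat[symmetric] tconst_mult_assoc del: of_nat_Suc)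
    then show "tconst (1 / fact (Suc j)) * (of_nat n * dpow (Suc j) n f) =
       (\<Sum>k\<in>?K. tconst (- 2) * tderiv k (tconst (1 / fact j) * dpow j (n - k) f))"
      unfolding dpow_euler
      by (simp only: sum_distrib_left tderiv_tconst_mult mult.left_commute[of _ "tconst (- 2)"])
  qed
  also have "\<dots> = (\<Sum>k\<in>?K. tconst (- 2) * tderiv k (dexp (n - k) f))"
    by (subst sum.swap) (simp add: dexp[of _ n] tderiv_sum sum_distrib_left)
  finally show ?thesis .
qed

lemma of_nat_mult_eq_0: "n > 0 \<Longrightarrow> of_nat n * (f :: tseries) = 0 \<Longrightarrow> f = 0"
proof -
  assume "n > 0" "of_nat n * f = 0"
  then have "tconst (1 / of_nat n) * (tconst (of_nat n) * f) = 0" by (simp add: tconst_of_nat)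
  then show "f = 0" using \<open>n > 0\<close> by (simp add: tconst_mult_assoc)
qed

lemma dexp_0 [simp]: "dexp 0 f = f"
  by (simp add: dexp_def)

text \<open>The shifts by u and by -u are inverse to each other because only odd powers of u occur.
  The Euler recurrence splits n times the coefficient into two sums that cancel when an odd index is
  moved.\<close>

lemma dexp_alternating: "(\<Sum>a\<le>n. (- 1) ^ a * dexp a (dexp (n - a) f)) = (if n = 0 then f else 0)"
proof (cases "n = 0")
  case False
  let ?K = "\<lambda>n. {k. 1 \<le> k \<and> k \<le> n \<and> odd k}"
  let ?g = "\<lambda>k a b. tconst (- 2) * tderiv k (dexp a (dexp b f))"
  have "of_nat n * (\<Sum>a\<le>n. (- 1) ^ a * dexp a (dexp (n - a) f)) =
     (\<Sum>a\<le>n. (- 1) ^ a * (of_nat a * dexp a (dexp (n - a) f))) + (\<Sum>a\<le>n. (- 1) ^ a * (of_nat (n - a) * dexp (n - a) (dexp a f)))"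
    unfolding sum_distrib_left sum.distrib[symmetric]
  proof (intro sum.cong refl)
    fix a assume "a \<in> {..n}"
    then have n: "(of_nat n :: tseries) = of_nat a + of_nat (n - a)" by (simp flip: of_nat_add)
    show "of_nat n * ((- 1) ^ a * dexp a (dexp (n - a) f)) =
      (- 1) ^ a * (of_nat a * dexp a (dexp (n - a) f)) + (- 1) ^ a * (of_nat (n - a) * dexp (n - a) (dexp a f))"
      unfolding n dexp_commute[of "n - a" a] by (simp only: algebra_simps)
  qed
  also have "(\<Sum>a\<le>n. (- 1) ^ a * (of_nat a * dexp a (dexp (n - a) f))) =
     (\<Sum>(a, k)\<in>(SIGMA a:{..n}. ?K a). (- 1) ^ a * ?g k (a - k) (n - a))"
    by (simp add: dexp_euler sum_distrib_left sum.Sigma)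
  also have "\<dots> = (\<Sum>(a, k)\<in>(SIGMA a:{..n}. ?K (n - a)). - ((- 1) ^ a * ?g k (n - a - k) a))"
    by (rule sum.reindex_bij_witness[where i = "\<lambda>(a, k). (a + k, k)" and j = "\<lambda>(a, k). (a - k, k)"])
      (auto simp: power_add dexp_commute diff_diff_left add.commute uminus_power_if)
  also have "\<dots> = - (\<Sum>a\<le>n. (- 1) ^ a * (of_nat (n - a) * dexp (n - a) (dexp a f)))"
    by (simp add: dexp_euler sum_distrib_left sum.Sigma sum_negf case_prod_beta del: of_nat_diff)
  finally have "of_nat n * (\<Sum>a\<le>n. (- 1) ^ a * dexp a (dexp (n - a) f)) = 0" by simp
  then show ?thesis using of_nat_mult_eq_0 False by auto
qed simp

section \<open>Products of two vertex operators\<close>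

lemma vertex_lin_shift: "vertex_lin \<alpha> (fps_X ^ a * F) = vertex_lin (\<alpha> + int a) F"
proof (rule tseries_eqI)
  fix m
  let ?N = "weight m + nat \<bar>\<alpha>\<bar> + a"
  have "coeff (vertex_lin \<alpha> (fps_X ^ a * F)) m = inv_sqrt2 * (\<Sum>n\<le>?N + a. coeff (qz (\<alpha> + int n) * (fps_X ^ a * F) $ n) m)"
    by (rule coeff_vertex_lin) simp
  also have "(\<Sum>n\<le>?N + a. coeff (qz (\<alpha> + int n) * (fps_X ^ a * F) $ n) m)
    = (\<Sum>n\<in>{a..?N + a}. coeff (qz (\<alpha> + int n) * F $ (n - a)) m)"
    by (rule sum.mono_neutral_cong_right) (auto simp: fps_X_power_mult_nth)
  also have "\<dots> = (\<Sum>n\<le>?N. coeff (qz (\<alpha> + int a + int n) * F $ n) m)"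
    by (rule sum.reindex_bij_witness[where i = "\<lambda>n. n + a" and j = "\<lambda>n. n - a"]) (auto simp: of_nat_diff)
  also have "inv_sqrt2 * \<dots> = coeff (vertex_lin (\<alpha> + int a) F) m"
    by (rule coeff_vertex_lin[symmetric]) linarith
  finally show "coeff (vertex_lin \<alpha> (fps_X ^ a * F)) m = coeff (vertex_lin (\<alpha> + int a) F) m" .
qed

lemma vertex_lin_0: "vertex_lin \<alpha> 0 = 0"
  using vertex_lin_add[of \<alpha> 0 0] by simp

lemma vertex_lin_sum: "vertex_lin \<alpha> (\<Sum>x\<in>B. F x) = (\<Sum>x\<in>B. vertex_lin \<alpha> (F x))"
  by (induction B rule: infinite_finite_induct) (simp_all add: vertex_lin_add vertex_lin_0)

lemma dexp_high: "weight_in (\<lambda>x. x \<le> int D) f \<Longrightarrow> n > D \<Longrightarrow> dexp n f = 0"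
  by (rule weight_in_False[OF weight_in_dexp]) auto

lemma X_op_qz_mult:
  assumes "weight_in (\<lambda>x. x \<le> int D) g"
  shows "X_op \<alpha> (qz b * g) = (\<Sum>a\<le>D. tconst (inv_sqrt2 * 2) * (q_pairing (\<alpha> + int a) b * dexp a g))"
proof -
  have "tshift g = (\<Sum>a\<le>D. fps_X ^ a * fps_const (dexp a g))"
    by (rule fps_ext) (simp add: tshift_def fps_sum_nth fps_X_power_mult_right_nth dexp_high[OF assms]
        if_distrib[of "\<lambda>x. x * _"] eq_commute[of _ "_ :: nat"] cong: if_cong)
  then have "tshift (qz b * g) = (\<Sum>a\<le>D. fps_const (dexp a g) * (fps_X ^ a * tshift (qz b)))"
    by (simp add: tshift_mult sum_distrib_left mult_ac)
  moreover have "vertex_lin \<beta> (tshift (qz b)) = tconst (inv_sqrt2 * 2) * q_pairing \<beta> b" for \<beta>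
  proof (cases "b < 0")
    case False
    then obtain n where "b = int n" by (metis nonneg_int_cases not_le)
    then show ?thesis using X_op_q[of \<beta> n] by (simp add: X_op_eq_vertex_lin)
  qed (simp add: q_pairing_right_neg vertex_lin_0)
  ultimately show ?thesis
    unfolding X_op_eq_vertex_lin by (simp only: vertex_lin_sum vertex_lin_const_mult vertex_lin_shift) (simp only: mult_ac)
qed

lemma X_op_high:
  assumes "weight_in (\<lambda>x. x \<le> int D) f"
  shows "X_op \<beta> f = tconst inv_sqrt2 * (\<Sum>m\<le>D. qz (\<beta> + int m) * dexp m f)"
  unfolding X_op_eq_vertex_lin by (subst vertex_lin_finite[of D]) (simp_all add: tshift_def dexp_high[OF assms])

lemma X_op_add: "X_op \<alpha> (f + g) = X_op \<alpha> f + X_op \<alpha> g"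
  by (rule vertex_op_additive[OF vertex_op_X])

lemma X_op_tconst_mult: "X_op \<alpha> (tconst c * f) = tconst c * X_op \<alpha> f"
  by (rule vertex_op_scale[OF vertex_op_X])

lemma X_op_0_right [simp]: "X_op \<alpha> 0 = 0"
  by (rule vertex_op_zero[OF vertex_op_X])

lemma X_op_sum: "X_op \<alpha> (\<Sum>x\<in>B. F x) = (\<Sum>x\<in>B. X_op \<alpha> (F x))"
  by (induction B rule: infinite_finite_induct) (simp_all add: X_op_add)

text \<open>Normal ordering: both shifts are brought to the right of the multiplications by q, and
  this produces the kernel \<open>q_pairing\<close>. The degree bound makes all sums finite.\<close>

lemma X_op_X_op_high:
  assumes "weight_in (\<lambda>x. x \<le> int D) f"
  shows "X_op \<alpha> (X_op \<beta> f) = (\<Sum>(a, m)\<in>{..D} \<times> {..D}. q_pairing (\<alpha> + int a) (\<beta> + int m) * dexp a (dexp m f))"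
proof -
  have high: "weight_in (\<lambda>x. x \<le> int D) (dexp m f)" for m
    using weight_in_dexp[OF assms, of m] by (auto simp: weight_in_def)
  have "X_op \<alpha> (X_op \<beta> f) = (\<Sum>m\<le>D. \<Sum>a\<le>D. tconst inv_sqrt2 * (tconst (inv_sqrt2 * 2) * (q_pairing (\<alpha> + int a) (\<beta> + int m) * dexp a (dexp m f))))"
    by (simp add: X_op_high[OF assms] X_op_tconst_mult X_op_sum X_op_qz_mult[OF high] sum_distrib_left)
  also have "\<dots> = (\<Sum>m\<le>D. \<Sum>a\<le>D. q_pairing (\<alpha> + int a) (\<beta> + int m) * dexp a (dexp m f))"
    by (simp add: tconst_mult_assoc) (simp add: mult.assoc[symmetric])
  finally show ?thesis by (subst (asm) sum.swap) (simp add: sum.cartesian_product)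
qed

lemma clifford_high:
  assumes "weight_in (\<lambda>x. x \<le> int D) f"
  shows "X_op \<alpha> (X_op \<beta> f) + X_op \<beta> (X_op \<alpha> f) = (if \<alpha> + \<beta> = 0 then (- 1) ^ nat \<bar>\<alpha>\<bar> * f else 0)"
proof -
  have "X_op \<beta> (X_op \<alpha> f) = (\<Sum>(a, m)\<in>{..D} \<times> {..D}. q_pairing (\<beta> + int m) (\<alpha> + int a) * dexp a (dexp m f))"
    unfolding X_op_X_op_high[OF assms]
    by (rule sum.reindex_bij_witness[where i = "\<lambda>(a, m). (m, a)" and j = "\<lambda>(a, m). (m, a)"])
      (auto simp: dexp_commute)
  then have "X_op \<alpha> (X_op \<beta> f) + X_op \<beta> (X_op \<alpha> f) =
     (\<Sum>(a, m)\<in>{..D} \<times> {..D}. (q_pairing (\<alpha> + int a) (\<beta> + int m) + q_pairing (\<beta> + int m) (\<alpha> + int a)) * dexp a (dexp m f))"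
    by (simp add: X_op_X_op_high[OF assms] case_prod_beta distrib_right sum.distrib)
  also have "\<dots> = (\<Sum>(a, m)\<in>{..D} \<times> {..D}. if (\<alpha> + \<beta>) + int (a + m) = 0 then (- 1) ^ nat \<bar>\<alpha> + int a\<bar> * dexp a (dexp m f) else 0)"
    by (intro sum.cong refl) (auto simp: q_pairing_skew algebra_simps)
  also have "\<dots> = (if \<alpha> + \<beta> = 0 then (- 1) ^ nat \<bar>\<alpha>\<bar> * f else 0)"
  proof (cases "\<alpha> + \<beta> > 0")
    case True
    then show ?thesis by (auto intro!: sum.neutral)
  next
    case False
    \<comment> \<open>The delta function leaves the pairs with a + m = N, and their alternating sum
      is a coefficient of the product of two inverse shifts.\<close>
    define N where "N = nat (- (\<alpha> + \<beta>))"
    have N: "\<alpha> + \<beta> = - int N" using False by (simp add: N_def)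
    have sgn: "(- 1 :: tseries) ^ nat \<bar>\<alpha> + int a\<bar> = (- 1) ^ nat \<bar>\<alpha>\<bar> * (- 1) ^ a" for a
    proof -
      have "even (nat \<bar>\<alpha> + int a\<bar>) \<longleftrightarrow> even (nat \<bar>\<alpha>\<bar> + a)" by (simp add: even_nat_iff)
      then show ?thesis unfolding power_add[symmetric] by (simp add: uminus_power_if)
    qed
    have "(\<Sum>(a, m)\<in>{..D} \<times> {..D}. if (\<alpha> + \<beta>) + int (a + m) = 0 then (- 1) ^ nat \<bar>\<alpha> + int a\<bar> * dexp a (dexp m f) else 0)
      = (\<Sum>(a, m)\<in>{(a, m). a \<le> D \<and> m \<le> D \<and> a + m = N}. (- 1) ^ nat \<bar>\<alpha> + int a\<bar> * dexp a (dexp m f))"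
      unfolding N by (intro sum.mono_neutral_cong_right) (auto split: if_splits)
    also have "\<dots> = (\<Sum>a\<in>{a. a \<le> D \<and> a \<le> N \<and> N - a \<le> D}. (- 1) ^ nat \<bar>\<alpha> + int a\<bar> * dexp a (dexp (N - a) f))"
      by (rule sum.reindex_bij_witness[where i = "\<lambda>a. (a, N - a)" and j = fst]) auto
    also have "\<dots> = (\<Sum>a\<le>N. (- 1) ^ nat \<bar>\<alpha> + int a\<bar> * dexp a (dexp (N - a) f))"
    proof (rule sum.mono_neutral_left)
      have "dexp a (dexp (N - a) f) = 0" if "\<not> a \<le> D \<or> \<not> N - a \<le> D" for a
      proof (cases "a \<le> D")
        case True
        then show ?thesis using that dexp_high[OF assms, of "N - a"] by simp
      next
        case False
        then show ?thesis by (subst dexp_commute) (simp add: dexp_high[OF assms])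
      qed
      then show "\<forall>a\<in>{..N} - {a. a \<le> D \<and> a \<le> N \<and> N - a \<le> D}. (- 1) ^ nat \<bar>\<alpha> + int a\<bar> * dexp a (dexp (N - a) f) = 0"
        by auto
    qed auto
    also have "\<dots> = (- 1) ^ nat \<bar>\<alpha>\<bar> * (if N = 0 then f else 0)"
      by (simp add: sgn mult.assoc dexp_alternating[symmetric] sum_distrib_left del: mult_cancel_left)
    finally show ?thesis using False by (auto simp: N_def)
  qed
  finally show ?thesis .
qed

theorem clifford:
  "X_op \<alpha> (X_op \<beta> f) + X_op \<beta> (X_op \<alpha> f) = (if \<alpha> + \<beta> = 0 then (- 1) ^ nat \<bar>\<alpha>\<bar> * f else 0)"
proof (rule tseries_eqI)
  fix m
  \<comment> \<open>The two operators together move degrees by \<alpha> + \<beta>, so the part of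
    \<open>f\<close> above degree D cannot reach the monomial \<open>m\<close> and the bounded part
    decides.\<close>
  define D where "D = weight m + nat \<bar>\<alpha>\<bar> + nat \<bar>\<beta>\<bar>"
  define g where "g = Tseries (\<lambda>m. if weight m \<le> D then coeff f m else 0)"
  define h where "h = Tseries (\<lambda>m. if weight m \<le> D then 0 else coeff f m)"
  have f: "f = g + h" by (simp add: tseries_eq_iff g_def h_def)
  have g: "weight_in (\<lambda>x. x \<le> int D) g" by (simp add: weight_in_def g_def)
  have h: "weight_in (\<lambda>x. x > int D) h" by (simp add: weight_in_def h_def)
  have hm: "coeff h m = 0" by (simp add: h_def D_def)
  have "coeff (X_op \<alpha> (X_op \<beta> h)) m = 0"
    using weight_in_X_op[OF weight_in_X_op[OF h], of \<alpha> \<beta>] unfolding weight_in_def D_def by fastforce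
  moreover have "coeff (X_op \<beta> (X_op \<alpha> h)) m = 0"
    using weight_in_X_op[OF weight_in_X_op[OF h], of \<beta> \<alpha>] unfolding weight_in_def D_def by fastforce
  moreover have "coeff ((- 1) ^ n * h) m = 0" for n
    using hm by (simp flip: tconst_neg_1_power)
  ultimately show "coeff (X_op \<alpha> (X_op \<beta> f) + X_op \<beta> (X_op \<alpha> f)) m =
      coeff (if \<alpha> + \<beta> = 0 then (- 1) ^ nat \<bar>\<alpha>\<bar> * f else 0) m"
    using arg_cong[OF clifford_high[OF g, of \<alpha> \<beta>], of "\<lambda>x. coeff x m"]
    by (auto simp: f X_op_add distrib_left)
qed

text \<open>Annihilation operators lower the degree, so an element of lowest degree of \<open>Z\<close> is
  annihilated by all of them, hence by all derivations.\<close>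

lemma zero_if_no_vacuum_component:
  assumes const: "\<And>f. f \<in> Z \<Longrightarrow> coeff f {#} = 0"
    and closed: "\<And>f k. f \<in> Z \<Longrightarrow> k > 0 \<Longrightarrow> X_op (- int k) f \<in> Z"
    and "f \<in> Z"
  shows "f = 0"
proof -
  have "\<forall>f\<in>Z. \<forall>m. weight m = d \<longrightarrow> coeff f m = 0" for d
  proof (induction d rule: less_induct)
    case (less d)
    show ?case
    proof (intro ballI allI impI)
      fix f m assume f: "f \<in> Z" and m: "weight m = d"
      show "coeff f m = 0"
      proof (cases "m = {#}")
        case False
        \<comment> \<open>The property of having no component in degree d - n, where the order n in
          u sends the component of degree d.\<close>
        let ?V = "\<lambda>n. weight_in (\<lambda>x. x \<noteq> int d - int n)"
        have X: "?V k (X_op (- int k) f)" if "k > 0" for k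
        proof (cases "k \<le> d")
          case True
          then have "coeff (X_op (- int k) f) m = 0" if "weight m = d - k" for m
            using less[of "d - k"] closed[OF f] that \<open>k > 0\<close> by auto
          then show ?thesis using True by (auto simp: weight_in_def)
        qed (auto simp: weight_in_def)
        \<comment> \<open>In degree d - k, the series X_{-k} f is, up to a constant,
          \<open>dexp k f\<close> plus products of q_{n-k} with \<open>dexp n f\<close> for n > k.
          Hence the descent from large k, where d - k is negative.\<close>
        have dexp: "?V k (dexp k f)" if "k > 0" for k
          using that
        proof (induction "d - k" arbitrary: k rule: less_induct)
          case (less k)
          show ?case
            unfolding weight_in_def
          proof (intro allI impI notI)
            fix m assume nz: "coeff (dexp k f) m \<noteq> 0" and w: "int (weight m) = int d - int k"
            have z: "coeff (qz (- int k + int n) * dexp n f) m = 0" if "n \<noteq> k" for n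
            proof (cases "n < k")
              case False
              then have nk: "k < n" using that by simp
              have "?V n (dexp n f)"
              proof (cases "n \<le> d")
                case True
                then show ?thesis using nk less.prems by (intro less.hyps) auto
              qed (auto simp: weight_in_def)
              then have "weight_in (\<lambda>x. x - (- int k + int n) \<noteq> int d - int n) (qz (- int k + int n) * dexp n f)"
                by (rule weight_in_qz_mult)
              then show ?thesis using w by (auto simp: weight_in_def)
            qed simp
            have "coeff (X_op (- int k) f) m = inv_sqrt2 * (\<Sum>n\<le>weight m + k + k. coeff (qz (- int k + int n) * dexp n f) m)"
              unfolding X_op_eq_vertex_lin by (subst coeff_vertex_lin[of m _ "weight m + k + k"]) (simp_all add: tshift_def)
            also have "(\<Sum>n\<le>weight m + k + k. coeff (qz (- int k + int n) * dexp n f) m) = (\<Sum>n\<in>{k}. coeff (qz (- int k + int n) * dexp n f) m)"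
              by (rule sum.mono_neutral_right) (simp, simp, use z in blast)
            finally have "coeff (X_op (- int k) f) m \<noteq> 0" using nz by (simp add: inv_sqrt2_def)
            then show False using X[OF less.prems] w by (auto simp: weight_in_def)
          qed
        qed
        \<comment> \<open>From the exponential back to its exponent: powers from the second on
          involve only lower orders, and subtracting them leaves the first power, which at a
          suitable odd order is a multiple of a single derivative.\<close>
        have dpow: "\<forall>j. ?V n (dpow (Suc j) n f)" if "n > 0" for n
          using that
        proof (induction n rule: less_induct)
          case (less n)
          have Suc: "?V n (dpow (Suc (Suc j)) n f)" for j
            unfolding dpow.simps(2)[of "Suc j"]
          proof (intro weight_in_sum weight_in_tconst_mult)
            fix k assume k: "k \<in> {k. 1 \<le> k \<and> k \<le> n \<and> odd k}"
            show "?V n (tderiv k (dpow (Suc j) (n - k) f))"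
            proof (cases "k = n")
              case False
              then have "?V (n - k) (dpow (Suc j) (n - k) f)" using k by (intro less.IH[rule_format]) auto
              then have "weight_in (\<lambda>x. x + int k \<noteq> int d - int (n - k)) (tderiv k (dpow (Suc j) (n - k) f))"
                using k by (intro weight_in_tderiv) auto
              then show ?thesis using k by (auto simp: weight_in_def of_nat_diff)
            qed simp
          qed
          have "{..n} = insert 0 (insert 1 {2..n})" using less.prems by auto
          then have eq: "dexp n f = dpow (Suc 0) n f + (\<Sum>j\<in>{2..n}. tconst (1 / fact j) * dpow j n f)"
            unfolding dexp_def using less.prems by (simp del: dpow.simps(2))
          have "?V n (dpow j n f)" if "j \<in> {2..n}" for j
          proof -
            have "j = Suc (Suc (j - 2))" using that by auto
            then show ?thesis using Suc[of "j - 2"] by (simp only:)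
          qed
          then have "?V n (\<Sum>j\<in>{2..n}. tconst (1 / fact j) * dpow j n f)"
            by (intro weight_in_sum weight_in_tconst_mult)
          then have "?V n (dexp n f - (\<Sum>j\<in>{2..n}. tconst (1 / fact j) * dpow j n f))"
            by (rule weight_in_diff[OF dexp[OF less.prems]])
          then have 0: "?V n (dpow (Suc 0) n f)"
            unfolding eq by (simp only: add_diff_cancel_right')
          show ?case
          proof
            fix j show "?V n (dpow (Suc j) n f)" using 0 Suc by (cases j) blast+
          qed
        qed
        from False obtain i where "i \<in># m" by blast
        then obtain m' where m': "m = add_mset i m'" by (blast dest: multi_member_split)
        let ?k = "2 * i + 1"
        have "dpow (Suc 0) ?k f = (\<Sum>k\<in>{?k}. tconst (- 2 / of_nat k) * tderiv k (dpow 0 (?k - k) f))"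
          unfolding dpow.simps(2) by (rule sum.mono_neutral_right) auto
        then have "dpow (Suc 0) ?k f = tconst (- 2 / of_nat ?k) * tderiv ?k f" by simp
        moreover have "coeff (dpow (Suc 0) ?k f) m' = 0"
          using dpow[of ?k] m m' unfolding weight_in_def by fastforce
        moreover have "complex_of_nat ?k \<noteq> 0" by (simp only: of_nat_eq_0_iff)
        ultimately have "coeff (tderiv ?k f) m' = 0" by simp
        then have "of_nat (count m' i + 1) * coeff f m = 0" by (simp add: tderiv_def m')
        then show ?thesis by (simp only: mult_eq_0_iff of_nat_eq_0_iff) simp
      qed (use const f in simp)
    qed
  qed
  then show ?thesis using \<open>f \<in> Z\<close> by (auto simp: tseries_eq_iff)
qed

section \<open>Entries of the matrices\<close>

lemma infsum_single:
  fixes f :: "'a \<Rightarrow> 'b :: {comm_monoid_add, t2_space}"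
  assumes "\<And>y. y \<in> S \<Longrightarrow> y \<noteq> x \<Longrightarrow> f y = 0"
  shows "infsum f S = (if x \<in> S then f x else 0)"
proof -
  have "infsum f S = infsum f (S \<inter> {x})"
    by (rule infsum_cong_neutral) (use assms in auto)
  then show ?thesis by (auto simp: Int_insert_right)
qed

lemma E_eq: "E i j \<alpha> \<beta> = (if ival \<alpha> = i \<and> ival \<beta> = j then 1 else 0)"
proof -
  have fin: "finite {l. ival l = i}" for i
  proof (rule finite_subset)
    show "{l. ival l = i} \<subseteq> {Neg (nat (- i)), Pos (nat i)}"
    proof
      fix l assume "l \<in> {l. ival l = i}"
      then show "l \<in> {Neg (nat (- i)), Pos (nat i)}" by (cases l) auto
    qed
  qed simp
  have "E i j \<alpha> \<beta> = (\<Sum>i' | ival i' = i. if \<alpha> = i' then (\<Sum>j' | ival j' = j. if \<beta> = j' then 1 else 0) else 0)"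
    unfolding E_def Et_def by (intro sum.cong refl) auto
  then show ?thesis by (simp add: fin)
qed

lemma M_mat_eq: "M_mat \<alpha> \<beta> = (if \<beta> = lneg \<alpha> then (- 1) ^ nat \<bar>ival \<alpha>\<bar> else 0)"
proof -
  let ?f = "\<lambda>k. (- 1) ^ k * (Et (Pos k) (Neg k) \<alpha> \<beta> + Et (Neg k) (Pos k) \<alpha> \<beta>) :: complex"
  have "M_mat \<alpha> \<beta> = (if nat \<bar>ival \<alpha>\<bar> \<in> UNIV then ?f (nat \<bar>ival \<alpha>\<bar>) else 0)"
    unfolding M_mat_def by (rule infsum_single) (cases \<alpha>, auto simp: Et_def)
  then show ?thesis by (cases \<alpha>) (auto simp: Et_def)
qed

text \<open>The index set with its zero read as 0. Exactly one of the two zeros belongs to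
  I_\<lambda>, so \<open>ival\<close> is injective there and \<open>rep\<close> inverts it.\<close>

definition J_set :: "nat list \<Rightarrow> int set"
  where "J_set lam = ival ` I_set lam"

lemma J_set_iff: "v \<in> J_set lam \<longleftrightarrow> v = 0 \<or> (if v > 0 then nat v \<notin> set lam else nat (- v) \<in> set lam)"
proof -
  have I: "I_set lam = Neg ` set lam \<union> Pos ` (- set lam)"
    by (auto simp: I_set_def)
  have "v \<in> J_set lam \<longleftrightarrow> (\<exists>j\<in>set lam. v = - int j) \<or> (\<exists>j. j \<notin> set lam \<and> v = int j)"
    unfolding J_set_def I image_Un image_image by auto
  also have "\<dots> \<longleftrightarrow> v = 0 \<or> (if v > 0 then nat v \<notin> set lam else nat (- v) \<in> set lam)"
  proof (cases "v > 0")
    case True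
    then show ?thesis by (auto intro!: exI[of _ "nat v"])
  next
    case False
    then show ?thesis by (auto intro!: bexI[of _ "nat (- v)"])
  qed
  finally show ?thesis .
qed

lemma Neg_in_I_set [simp]: "Neg j \<in> I_set lam \<longleftrightarrow> j \<in> set lam"
  and Pos_in_I_set [simp]: "Pos j \<in> I_set lam \<longleftrightarrow> j \<notin> set lam"
  by (auto simp: I_set_def)

lemma inj_ival_I: "i \<in> I_set lam \<Longrightarrow> j \<in> I_set lam \<Longrightarrow> ival i = ival j \<Longrightarrow> i = j"
proof -
  have "int a = - int b \<longleftrightarrow> a = 0 \<and> b = 0" "- int a = int b \<longleftrightarrow> a = 0 \<and> b = 0" for a b by auto
  then show "i \<in> I_set lam \<Longrightarrow> j \<in> I_set lam \<Longrightarrow> ival i = ival j \<Longrightarrow> i = j"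
    by (cases i; cases j) auto
qed

definition rep :: "nat list \<Rightarrow> int \<Rightarrow> label"
  where "rep lam v = (SOME i. i \<in> I_set lam \<and> ival i = v)"

lemma rep: "v \<in> J_set lam \<Longrightarrow> rep lam v \<in> I_set lam \<and> ival (rep lam v) = v"
  unfolding rep_def J_set_def by (rule someI_ex) auto

lemma infsum_I_pairs:
  fixes f :: "label \<times> label \<Rightarrow> complex"
  assumes "S \<subseteq> I_set lam \<times> I_set lam"
    and "\<And>i j. (i, j) \<in> S \<Longrightarrow> f (i, j) \<noteq> 0 \<Longrightarrow> ival i = a \<and> ival j = b"
  shows "infsum f S = (if a \<in> J_set lam \<and> b \<in> J_set lam \<and> (rep lam a, rep lam b) \<in> S then f (rep lam a, rep lam b) else 0)"
proof (cases "a \<in> J_set lam \<and> b \<in> J_set lam")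
  case True
  then have "infsum f S = (if (rep lam a, rep lam b) \<in> S then f (rep lam a, rep lam b) else 0)"
  proof (intro infsum_single)
    fix p assume p: "p \<in> S" "p \<noteq> (rep lam a, rep lam b)"
    obtain i j where ij: "p = (i, j)" by (cases p)
    then have I: "i \<in> I_set lam" "j \<in> I_set lam" using p assms(1) by auto
    show "f p = 0"
    proof (rule ccontr)
      assume "f p \<noteq> 0"
      then have "ival i = a" "ival j = b" using assms(2)[of i j] p ij by auto
      then have "i = rep lam a" "j = rep lam b" using I True rep by (auto intro!: inj_ival_I)
      then show False using p ij by simp
    qed
  qed
  then show ?thesis using True by simp
next
  case False
  have "f p = 0" if "p \<in> S" for p
    using assms(1) assms(2)[of "fst p" "snd p"] that False by (cases p) (auto simp: J_set_def)
  then show ?thesis using False by (simp add: infsum_0)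
qed

definition okJ :: "nat list \<Rightarrow> int \<Rightarrow> int \<Rightarrow> bool"
  where "okJ lam a b \<longleftrightarrow> a \<in> J_set lam \<and> b \<in> J_set lam \<and> a > \<bar>b\<bar>"

lemma L_mat_eq:
  "L_mat lam r \<alpha> \<beta> = (if \<beta> = lneg \<alpha> then (- 1) ^ nat \<bar>ival \<alpha>\<bar> else 0)
    + (if okJ lam (ival \<alpha>) (ival \<beta>) then r (ival \<alpha>) (ival \<beta>) else 0)
    - (if okJ lam (ival \<beta>) (ival \<alpha>) then r (ival \<beta>) (ival \<alpha>) else 0)
    - (if ival \<alpha> \<in> J_set lam \<and> ival \<beta> \<in> J_set lam \<and> ival \<alpha> > 0 \<and> ival \<beta> > 0
       then r (ival \<alpha>) 0 * r (ival \<beta>) 0 else 0)"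
proof -
  let ?S = "{(i, j). i \<in> I_set lam \<and> j \<in> I_set lam \<and> ival i > \<bar>ival j\<bar>}"
  let ?a = "ival \<alpha>" and ?b = "ival \<beta>"
  have 1: "(\<Sum>\<^sub>\<infinity>(i, j)\<in>?S. r (ival i) (ival j) * (E (ival i) (ival j) \<alpha> \<beta> - E (ival j) (ival i) \<alpha> \<beta>))
     = (if okJ lam ?a ?b then r ?a ?b else 0) - (if okJ lam ?b ?a then r ?b ?a else 0)"
  proof -
    let ?f = "\<lambda>(i, j). r (ival i) (ival j) * (E (ival i) (ival j) \<alpha> \<beta> - E (ival j) (ival i) \<alpha> \<beta>)"
    have f: "?f (i, j) = r (ival i) (ival j) * ((if ?a = ival i \<and> ?b = ival j then 1 else 0) - (if ?a = ival j \<and> ?b = ival i then 1 else 0))" for i j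
      by (simp add: E_eq)
    show ?thesis
    proof (cases "?a > \<bar>?b\<bar>")
      case True
      have neq: "\<not> (x > \<bar>y\<bar> \<and> ?a = y \<and> ?b = x)" "?a \<noteq> ?b" for x y :: int using True by auto
      have "infsum ?f ?S = (if ?a \<in> J_set lam \<and> ?b \<in> J_set lam \<and> (rep lam ?a, rep lam ?b) \<in> ?S then ?f (rep lam ?a, rep lam ?b) else 0)"
      proof (rule infsum_I_pairs)
        fix i j assume "(i, j) \<in> ?S" "?f (i, j) \<noteq> 0"
        then show "ival i = ?a \<and> ival j = ?b" using neq(1)[of "ival j" "ival i"] unfolding f by (auto split: if_splits)
      qed auto
      also have "\<dots> = (if okJ lam ?a ?b then r ?a ?b else 0)"
      proof (cases "okJ lam ?a ?b")
        case True
        then show ?thesis unfolding f using rep[of ?a lam] rep[of ?b lam] neq(2) by (simp add: okJ_def)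
      next
        case False
        then have "\<not> (?a \<in> J_set lam \<and> ?b \<in> J_set lam \<and> (rep lam ?a, rep lam ?b) \<in> ?S)"
          using rep[of ?a lam] rep[of ?b lam] by (auto simp: okJ_def)
        then show ?thesis using False by (simp only: if_False)
      qed
      finally have "infsum ?f ?S = (if okJ lam ?a ?b then r ?a ?b else 0)" .
      moreover have "\<not> okJ lam ?b ?a" using True by (auto simp: okJ_def)
      ultimately show ?thesis by simp
    next
      case False
      have neq: "\<not> (x > \<bar>y\<bar> \<and> ?a = x \<and> ?b = y)" for x y :: int using False by auto
      have "infsum ?f ?S = (if ?b \<in> J_set lam \<and> ?a \<in> J_set lam \<and> (rep lam ?b, rep lam ?a) \<in> ?S then ?f (rep lam ?b, rep lam ?a) else 0)"
      proof (rule infsum_I_pairs)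
        fix i j assume "(i, j) \<in> ?S" "?f (i, j) \<noteq> 0"
        then show "ival i = ?b \<and> ival j = ?a" using neq[of "ival j" "ival i"] unfolding f by (auto split: if_splits)
      qed auto
      also have "\<dots> = - (if okJ lam ?b ?a then r ?b ?a else 0)"
      proof (cases "okJ lam ?b ?a")
        case True
        then have "?a \<noteq> ?b" by (auto simp: okJ_def)
        then show ?thesis unfolding f using True rep[of ?a lam] rep[of ?b lam] by (simp add: okJ_def)
      next
        case False
        then have "\<not> (?b \<in> J_set lam \<and> ?a \<in> J_set lam \<and> (rep lam ?b, rep lam ?a) \<in> ?S)"
          using rep[of ?a lam] rep[of ?b lam] by (auto simp: okJ_def)
        then show ?thesis using False by (simp only: if_False minus_zero)
      qed
      finally have "infsum ?f ?S = - (if okJ lam ?b ?a then r ?b ?a else 0)" .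
      moreover have "\<not> okJ lam ?a ?b" using False by (auto simp: okJ_def)
      ultimately show ?thesis by simp
    qed
  qed
  have 2: "(\<Sum>\<^sub>\<infinity>(i, j)\<in>{(i, j). i \<in> I_set lam \<and> j \<in> I_set lam \<and> ival i > 0 \<and> ival j > 0}.
        r (ival i) 0 * r (ival j) 0 * E (ival i) (ival j) \<alpha> \<beta>)
     = (if ?a \<in> J_set lam \<and> ?b \<in> J_set lam \<and> ?a > 0 \<and> ?b > 0 then r ?a 0 * r ?b 0 else 0)"
    (is "infsum ?f ?T = _")
  proof -
    have "infsum ?f ?T = (if ?a \<in> J_set lam \<and> ?b \<in> J_set lam \<and> (rep lam ?a, rep lam ?b) \<in> ?T then ?f (rep lam ?a, rep lam ?b) else 0)"
      by (rule infsum_I_pairs) (auto simp: E_eq split: if_splits)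
    then show ?thesis using rep[of ?a lam] rep[of ?b lam] by (auto simp: E_eq)
  qed
  show ?thesis unfolding L_mat_def M_mat_eq 1 2 by simp
qed

section \<open>The numerical part of W and its relations with the columns of L\<close>

definition r_mat :: "nat list \<Rightarrow> (int \<Rightarrow> int \<Rightarrow> complex) \<Rightarrow> label \<Rightarrow> label \<Rightarrow> complex" where
  "r_mat lam r i j = (if i \<in> I_set lam \<and> j \<in> I_set lam \<and> ival i > \<bar>ival j\<bar>
     then (- 1) powi min 0 (ival j) * r (ival i) (ival j) else 0)"

text \<open>Couples the labels + \<lambda>_j among themselves, because \<open>pair_mat\<close>
  couples a positive label with its negative only outside the parts.\<close>

definition dummy_mat :: "nat list \<Rightarrow> label \<Rightarrow> label \<Rightarrow> complex" where
  "dummy_mat lam \<alpha> \<beta> = (\<Sum>j = 1..length lam div 2.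
        Et (Pos (part lam (2 * j))) (Pos (part lam (2 * j - 1))) \<alpha> \<beta>
        - Et (Pos (part lam (2 * j - 1))) (Pos (part lam (2 * j))) \<alpha> \<beta>)"

definition pair_mat :: "nat list \<Rightarrow> label \<Rightarrow> label \<Rightarrow> complex" where
  "pair_mat lam \<alpha> \<beta> = (if \<exists>i. i \<notin> set lam \<and> \<alpha> = Neg i \<and> \<beta> = Pos i then 1 else 0)"

definition num_mat :: "nat list \<Rightarrow> (int \<Rightarrow> int \<Rightarrow> complex) \<Rightarrow> label \<Rightarrow> label \<Rightarrow> complex" where
  "num_mat lam r \<alpha> \<beta> = pair_mat lam \<alpha> \<beta> - pair_mat lam \<beta> \<alpha> + (r_mat lam r \<alpha> \<beta> - r_mat lam r \<beta> \<alpha>) + dummy_mat lam \<alpha> \<beta>"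

fun Q_mat :: "label \<Rightarrow> label \<Rightarrow> tseries" where
  "Q_mat (Neg i) (Neg j) = - skewQ i j"
| "Q_mat _ _ = 0"

lemma last_eq_0_iff: assumes "sorted_wrt (>) lam" shows "lam \<noteq> [] \<and> last lam = (0::nat) \<longleftrightarrow> 0 \<in> set lam"
proof
  assume 0: "0 \<in> set lam"
  then have ne: "lam \<noteq> []" by auto
  have "last lam \<le> x" if "x \<in> set lam" for x
  proof (cases "x = last lam")
    case False
    then have "x \<in> set (butlast lam)" using that ne by (metis append_butlast_last_id in_set_butlastD insert_iff rotate1.simps(2) set_ConsD set_rotate1 append_Cons)
    moreover have "sorted_wrt (>) (butlast lam @ [last lam])" using assms ne by simp
    ultimately show ?thesis by (auto simp: sorted_wrt_append)
  qed simp
  with 0 ne show "lam \<noteq> [] \<and> last lam = 0" by fastforce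
qed (use last_in_set in metis)

lemma tconst_Et: "tconst (Et i j \<alpha> \<beta>) = Et i j \<alpha> \<beta>"
  by (simp add: Et_def)

lemma W_mat_eq:
  assumes "sorted_wrt (>) lam"
  shows "W_mat lam r \<alpha> \<beta> = Q_mat \<alpha> \<beta> + tconst (num_mat lam r \<alpha> \<beta>)"
proof -
  have 1: "(\<Sum>\<^sub>\<infinity>(j, i)\<in>{(j, i). j > i}. schurQ j i * (Et (Neg i) (Neg j) \<alpha> \<beta> - Et (Neg j) (Neg i) \<alpha> \<beta>)) = Q_mat \<alpha> \<beta>"
    (is "infsum ?f ?S = _")
  proof (cases "\<exists>a b. \<alpha> = Neg a \<and> \<beta> = Neg b")
    case True
    then obtain a b where ab: "\<alpha> = Neg a" "\<beta> = Neg b" by blast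
    let ?x = "(max a b, min a b)"
    have "infsum ?f ?S = (if ?x \<in> ?S then ?f ?x else 0)"
    proof (rule infsum_single)
      fix p assume p: "p \<in> ?S" "p \<noteq> ?x"
      obtain j i where ji: "p = (j, i)" by (cases p)
      have "\<not> (a = i \<and> b = j)" "\<not> (a = j \<and> b = i)" using p ji by auto
      then have "Et (Neg i) (Neg j) \<alpha> \<beta> = (0 :: tseries)" "Et (Neg j) (Neg i) \<alpha> \<beta> = (0 :: tseries)"
        by (simp_all only: ab Et_def label.inject if_False)
      then show "?f p = 0" by (simp only: ji case_prod_conv diff_self mult_zero_right)
    qed
    also have "\<dots> = Q_mat \<alpha> \<beta>"
      by (cases a b rule: linorder_cases) (simp_all add: ab Et_def skewQ_def)
    finally show ?thesis .
  next
    case False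
    then have "Q_mat \<alpha> \<beta> = 0" by (cases "(\<alpha>, \<beta>)" rule: Q_mat.cases) auto
    moreover have "?f p = 0" for p
    proof -
      obtain j i where ji: "p = (j, i)" by (cases p)
      have "\<not> (\<alpha> = Neg i \<and> \<beta> = Neg j)" "\<not> (\<alpha> = Neg j \<and> \<beta> = Neg i)" using False by blast+
      then have "Et (Neg i) (Neg j) \<alpha> \<beta> = (0 :: tseries)" "Et (Neg j) (Neg i) \<alpha> \<beta> = (0 :: tseries)"
        by (simp_all only: Et_def if_False)
      then show ?thesis by (simp only: ji case_prod_conv diff_self mult_zero_right)
    qed
    ultimately show ?thesis by (simp only: infsum_0)
  qed
  have 2: "(\<Sum>\<^sub>\<infinity>i\<in>{i \<in> I_set lam. ival i > 0}. Et (lneg i) i \<alpha> \<beta> - Et i (lneg i) \<alpha> \<beta>)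
     + (if lam \<noteq> [] \<and> last lam = 0 then 0 else Et (Neg 0) (Pos 0) \<alpha> \<beta> - Et (Pos 0) (Neg 0) \<alpha> \<beta>)
     = tconst (pair_mat lam \<alpha> \<beta> - pair_mat lam \<beta> \<alpha>)" (is "infsum ?f ?S + ?z = _")
  proof -
    let ?x = "Pos (nat \<bar>ival \<alpha>\<bar>)"
    have "infsum ?f ?S = (if ?x \<in> ?S then ?f ?x else 0)"
    proof (rule infsum_single)
      fix y assume "y \<in> ?S" "y \<noteq> ?x"
      then show "?f y = 0" by (cases y; cases \<alpha>) (auto simp: Et_def)
    qed
    then show ?thesis
      unfolding last_eq_0_iff[OF assms] by (cases \<alpha>; cases \<beta>) (auto simp: Et_def pair_mat_def tconst_uminus)
  qed
  have 3: "(\<Sum>\<^sub>\<infinity>(i, j)\<in>{(i, j). i \<in> I_set lam \<and> j \<in> I_set lam \<and> ival i > \<bar>ival j\<bar>}.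
        tconst ((- 1) powi min 0 (ival j) * r (ival i) (ival j)) * (Et i j \<alpha> \<beta> - Et j i \<alpha> \<beta>))
     = tconst (r_mat lam r \<alpha> \<beta> - r_mat lam r \<beta> \<alpha>)" (is "infsum ?f ?S = _")
  proof -
    let ?x = "if ival \<alpha> > \<bar>ival \<beta>\<bar> then (\<alpha>, \<beta>) else (\<beta>, \<alpha>)"
    have "infsum ?f ?S = (if ?x \<in> ?S then ?f ?x else 0)"
    proof (rule infsum_single)
      fix p assume p: "p \<in> ?S" "p \<noteq> ?x"
      obtain i j where ij: "p = (i, j)" by (cases p)
      have "\<not> (\<alpha> = i \<and> \<beta> = j)" "\<not> (\<alpha> = j \<and> \<beta> = i)" using p ij by (auto split: if_splits)
      then have "Et i j \<alpha> \<beta> = (0 :: tseries)" "Et j i \<alpha> \<beta> = (0 :: tseries)"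
        by (simp_all only: Et_def if_False)
      then show "?f p = 0" by (simp only: ij case_prod_conv diff_self mult_zero_right)
    qed
    also have "\<dots> = tconst (r_mat lam r \<alpha> \<beta> - r_mat lam r \<beta> \<alpha>)"
    proof (cases "ival \<alpha> > \<bar>ival \<beta>\<bar>")
      case True
      then have "\<alpha> \<noteq> \<beta>" "r_mat lam r \<beta> \<alpha> = 0" by (auto simp: r_mat_def)
      then show ?thesis using True by (simp add: Et_def r_mat_def)
    next
      case False
      then have "r_mat lam r \<alpha> \<beta> = 0" by (auto simp: r_mat_def)
      moreover have "\<alpha> \<noteq> \<beta>" if "ival \<beta> > \<bar>ival \<alpha>\<bar>" using that by auto
      ultimately show ?thesis using False by (auto simp: Et_def r_mat_def tconst_uminus)
    qed
    finally show ?thesis .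
  qed
  have 4: "(\<Sum>j = 1..length lam div 2.
        Et (Pos (part lam (2 * j))) (Pos (part lam (2 * j - 1))) \<alpha> \<beta>
        - Et (Pos (part lam (2 * j - 1))) (Pos (part lam (2 * j))) \<alpha> \<beta>) = tconst (dummy_mat lam \<alpha> \<beta>)"
    unfolding dummy_mat_def tconst_sum diff_conv_add_uminus tconst_add tconst_uminus tconst_Et ..
  show ?thesis
    unfolding W_mat_def 1 3 4 num_mat_def tconst_add 2[symmetric] by (simp only: add_ac)
qed

lemma dummy_mat_eq_0:
  assumes "even (length lam)" "\<alpha> \<notin> Pos ` set lam \<or> \<beta> \<notin> Pos ` set lam"
  shows "dummy_mat lam \<alpha> \<beta> = 0"
  unfolding dummy_mat_def
proof (rule sum.neutral, rule ballI)
  have Et: "Et (Pos a) (Pos b) \<alpha> \<beta> = (0 :: complex)" if "a \<in> set lam" "b \<in> set lam" for a b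
  proof -
    have "\<not> (\<alpha> = Pos a \<and> \<beta> = Pos b)" using assms(2) that by blast
    then show ?thesis by (simp only: Et_def if_False)
  qed
  fix j assume j: "j \<in> {1..length lam div 2}"
  then have "part lam (2 * j) \<in> set lam" "part lam (2 * j - 1) \<in> set lam" by auto
  then show "Et (Pos (part lam (2 * j))) (Pos (part lam (2 * j - 1))) \<alpha> \<beta>
        - Et (Pos (part lam (2 * j - 1))) (Pos (part lam (2 * j))) \<alpha> \<beta> = (0 :: complex)"
    by (simp only: Et diff_self)
qed

lemma Et_swap: "Et i j \<alpha> \<beta> = Et j i \<beta> \<alpha>"
  by (simp only: Et_def conj_commute)

lemma num_mat_skew: "num_mat lam r \<alpha> \<beta> = - num_mat lam r \<beta> \<alpha>"
proof -
  have "dummy_mat lam \<alpha> \<beta> = - dummy_mat lam \<beta> \<alpha>"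
    unfolding dummy_mat_def sum_negf[symmetric] Et_swap[of _ _ \<beta> \<alpha>] by (simp only: minus_diff_eq)
  then show ?thesis by (simp add: num_mat_def)
qed

lemma num_mat_diag: "num_mat lam r \<alpha> \<alpha> = 0"
  using num_mat_skew[of lam r \<alpha> \<alpha>] by simp

lemma neg_powi: "(- 1 :: complex) powi (- int k) = (- 1) ^ k"
  by (cases "even k") (simp_all add: power_int_minus power_int_of_nat)

lemma num_mat_Neg_Pos:
  assumes "even (length lam)"
  shows "num_mat lam r (Neg i) (Pos j) = (if i = j \<and> i \<notin> set lam then 1 else 0)
     - (if i \<in> set lam \<and> j \<notin> set lam \<and> i < j then (- 1) ^ i * r (int j) (- int i) else 0)"
proof -
  have "dummy_mat lam (Neg i) (Pos j) = 0" by (rule dummy_mat_eq_0[OF assms]) auto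
  moreover have "r_mat lam r (Neg i) (Pos j) = 0" by (simp add: r_mat_def)
  moreover have "r_mat lam r (Pos j) (Neg i) = (if i \<in> set lam \<and> j \<notin> set lam \<and> i < j then (- 1) ^ i * r (int j) (- int i) else 0)"
    by (auto simp: r_mat_def neg_powi min_def)
  moreover have "pair_mat lam (Neg i) (Pos j) = (if i = j \<and> i \<notin> set lam then 1 else 0)" "pair_mat lam (Pos j) (Neg i) = 0"
    by (auto simp: pair_mat_def)
  ultimately show ?thesis unfolding num_mat_def by (simp only: diff_0 diff_zero add_0_right) (simp only: diff_conv_add_uminus)
qed

lemma num_mat_Pos_Neg:
  assumes "even (length lam)"
  shows "num_mat lam r (Pos j) (Neg i) = (if i \<in> set lam \<and> j \<notin> set lam \<and> i < j then (- 1) ^ i * r (int j) (- int i) else 0)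
    - (if i = j \<and> i \<notin> set lam then 1 else 0)"
  unfolding num_mat_skew[of lam r "Pos j"] num_mat_Neg_Pos[OF assms] by simp

lemma num_mat_Neg_Neg [simp]: "num_mat lam r (Neg i) (Neg j) = 0"
  unfolding num_mat_def by (auto simp: pair_mat_def r_mat_def dummy_mat_def Et_def)

lemma num_mat_Pos_Pos:
  assumes "even (length lam)" "i \<notin> set lam"
  shows "num_mat lam r (Pos i) (Pos j) = (if j \<notin> set lam then (if j < i then r (int i) (int j) else 0) - (if i < j then r (int j) (int i) else 0) else 0)"
  using dummy_mat_eq_0[OF assms(1), of "Pos i" "Pos j"] assms(2) by (auto simp: num_mat_def pair_mat_def r_mat_def)

definition label_range :: "nat \<Rightarrow> label set"
  where "label_range n = Neg ` {..n} \<union> Pos ` {..n}"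

lemma finite_label_range [simp]: "finite (label_range n)" by (simp add: label_range_def)

lemma Neg_in_label_range [simp]: "Neg i \<in> label_range n \<longleftrightarrow> i \<le> n" and Pos_in_label_range [simp]: "Pos i \<in> label_range n \<longleftrightarrow> i \<le> n"
  by (auto simp: label_range_def)

text \<open>The multipliers that express the bordering row of a vector \<open>x\<close> through the rows of the matrix, and
  the numerical part of that bordering row.\<close>

fun row_coeff :: "nat list \<Rightarrow> (label \<Rightarrow> complex) \<Rightarrow> label \<Rightarrow> complex" where
  "row_coeff lam x (Neg m) = - x (Pos m)"
| "row_coeff lam x (Pos i) = (if i \<in> set lam then 0 else if i = 0 then - x (Pos 0) else - ((- 1) ^ i * x (Neg i)))"

fun target :: "(label \<Rightarrow> complex) \<Rightarrow> label \<Rightarrow> complex" where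
  "target x (Neg i) = (if i = 0 then x (Pos 0) else (- 1) ^ i * x (Neg i))"
| "target x (Pos i) = 0"

text \<open>Together with \<open>X_trunc_qhat\<close> this makes the bordering row of the column a
  combination of rows of W. For a positive part k the column has only positive labels in its
  support, so just the rows -k and \<open>lneg d\<close> can contribute.\<close>

lemma column_relation_Neg:
  fixes r :: "int \<Rightarrow> int \<Rightarrow> complex"
  assumes ev: "even (length lam)" and k: "k \<in> set lam" "k > 0" "k \<le> n" and d: "d \<in> label_range n"
  defines "x \<equiv> \<lambda>\<alpha>. L_mat lam r \<alpha> (Neg k)"
  shows "(\<Sum>c\<in>label_range n. row_coeff lam x c * num_mat lam r c d) = target x d"
proof -
  have x_Neg: "x (Neg i) = 0" for i
    using k by (auto simp: x_def L_mat_eq okJ_def)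
  have x_Pos: "x (Pos i) = (if i = k then (- 1) ^ k else 0) + (if i \<notin> set lam \<and> k < i then r (int i) (- int k) else 0)" for i
    using k by (auto simp: x_def L_mat_eq okJ_def J_set_iff)
  have y_Pos: "row_coeff lam x (Pos i) = 0" for i
    using k by (auto simp: x_Neg x_Pos)
  have y_Neg: "row_coeff lam x (Neg m) * num_mat lam r (Neg m) d = 0" if "m \<noteq> k" "Neg m \<noteq> lneg d" for m
    using that by (cases d) (auto simp: x_Pos num_mat_Neg_Pos[OF ev])
  have "(\<Sum>c\<in>label_range n. row_coeff lam x c * num_mat lam r c d) = (\<Sum>c\<in>{Neg k, lneg d}. row_coeff lam x c * num_mat lam r c d)"
  proof (rule sum.mono_neutral_right)
    show "{Neg k, lneg d} \<subseteq> label_range n" using k d by (cases d) auto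
    have "row_coeff lam x c * num_mat lam r c d = 0" if "c \<notin> {Neg k, lneg d}" for c
      using that y_Pos y_Neg by (cases c) (auto simp del: row_coeff.simps)
    then show "\<forall>c\<in>label_range n - {Neg k, lneg d}. row_coeff lam x c * num_mat lam r c d = 0" by blast
  qed simp
  also have "\<dots> = target x d"
  proof (cases d)
    case (Neg i)
    then show ?thesis using k by (auto simp: x_Pos x_Neg y_Pos simp del: row_coeff.simps(2))
  next
    case (Pos i)
    then show ?thesis using k by (cases "i = k") (auto simp: x_Pos num_mat_Neg_Pos[OF ev])
  qed
  finally show ?thesis .
qed

text \<open>Here the zero label accounts for the quadratic term of L. Since the column has the entry
  -r_{k,0} at both zeros, the row of the zero in I_\<lambda> gets the multiplier r_{k,0}, and the
  resulting products r_{i,0} r_{k,0} cancel against that term.\<close>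

lemma column_relation_Pos:
  fixes r :: "int \<Rightarrow> int \<Rightarrow> complex"
  assumes ev: "even (length lam)" and k: "k \<notin> set lam" "k > 0" "k \<le> n" and d: "d \<in> label_range n"
  defines "x \<equiv> \<lambda>\<alpha>. L_mat lam r \<alpha> (Pos k)"
  shows "(\<Sum>c\<in>label_range n. row_coeff lam x c * num_mat lam r c d) = target x d"
proof -
  have x_Neg: "x (Neg i) = (if i = k then (- 1) ^ k else 0) - (if i \<in> set lam \<and> i < k then r (int k) (- int i) else 0)" if "i > 0" for i
    using k that by (auto simp: x_def L_mat_eq okJ_def J_set_iff)
  have x_0: "x (Neg 0) = - r (int k) 0" "x (Pos 0) = - r (int k) 0"
    using k by (auto simp: x_def L_mat_eq okJ_def J_set_iff)
  have x_Pos: "x (Pos i) = (if i \<notin> set lam then (if k < i then r (int i) (int k) else 0) - (if i < k then r (int k) (int i) else 0)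
      - r (int i) 0 * r (int k) 0 else 0)" if "i > 0" for i
    using k that by (auto simp: x_def L_mat_eq okJ_def J_set_iff)
  have y_Pos: "row_coeff lam x (Pos i) = (if i = k then - 1 else 0)" if "i > 0" for i
    using k that by (auto simp: x_Neg mult.assoc[symmetric] power_add[symmetric])
  have y_0: "row_coeff lam x (Pos 0) = (if 0 \<in> set lam then 0 else r (int k) 0)" "row_coeff lam x (Neg 0) = r (int k) 0"
    by (simp_all add: x_0)
  have y_Neg: "row_coeff lam x (Neg m) * num_mat lam r (Neg m) d = 0" if "m > 0" "Neg m \<noteq> lneg d" for m
    using that by (cases d) (auto simp: x_Pos num_mat_Neg_Pos[OF ev])
  let ?C = "{Pos k, Pos 0, Neg 0, lneg d}"
  have "(\<Sum>c\<in>label_range n. row_coeff lam x c * num_mat lam r c d) = (\<Sum>c\<in>?C. row_coeff lam x c * num_mat lam r c d)"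
  proof (rule sum.mono_neutral_right)
    show "?C \<subseteq> label_range n" using k d by (cases d) auto
    have "row_coeff lam x c * num_mat lam r c d = 0" if "c \<notin> ?C" for c
    proof (cases c)
      case (Neg m)
      then show ?thesis using that y_Neg[of m] by (cases m) auto
    next
      case (Pos m)
      then show ?thesis using that y_Pos[of m] by (cases m) auto
    qed
    then show "\<forall>c\<in>label_range n - ?C. row_coeff lam x c * num_mat lam r c d = 0" by blast
  qed simp
  also have "\<dots> = target x d"
  proof (cases d)
    case (Neg i)
    then show ?thesis
    proof (cases "i = 0")
      case True
      then show ?thesis using k Neg
        by (simp add: sum.insert_if y_Pos y_0 num_mat_Pos_Neg[OF ev] x_0 del: row_coeff.simps sum.insert)
    next
      case False
      then show ?thesis using k Neg
        by (cases "i = k") (auto simp: sum.insert_if y_Pos y_0 num_mat_Pos_Neg[OF ev] x_Neg simp del: row_coeff.simps sum.insert)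
    qed
  next
    case (Pos i)
    show ?thesis
    proof (cases "i = 0")
      case True
      then show ?thesis using k Pos
        by (simp add: sum.insert_if y_Pos y_0 num_mat_Neg_Pos[OF ev] num_mat_Pos_Pos[OF ev] num_mat_diag x_0 del: row_coeff.simps sum.insert)
    next
      case False
      have "row_coeff lam x (Neg i) = - x (Pos i)" by simp
      then show ?thesis using k Pos False
        by (auto simp: sum.insert_if y_Pos y_0 num_mat_Neg_Pos[OF ev] num_mat_Pos_Pos[OF ev] x_Pos algebra_simps simp del: row_coeff.simps sum.insert)
    qed
  qed
  finally show ?thesis .
qed

section \<open>Pfaffians annihilated by the columns\<close>

text \<open>\<open>Row\<close> is the row of a vertex operator. A second bordering label, \<open>Bd True\<close>, is needed when a
  list with an odd number of labels has already been completed by \<open>Bd False\<close>.\<close>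

datatype elab = Lab label | Row | Bd bool

fun label_q :: "label \<Rightarrow> tseries" where
  "label_q (Neg i) = qhat i"
| "label_q (Pos i) = 0"

text \<open>With respect to the shift, a label \<open>Bd\<close> is one more label whose bordering
  value is 1; this value is the entry between \<open>Bd True\<close> and
  \<open>Bd False\<close>.\<close>

fun bord :: "tseries lmat \<Rightarrow> (tseries \<Rightarrow> tseries) \<Rightarrow> elab \<Rightarrow> elab \<Rightarrow> tseries" where
  "bord W T (Lab c) (Lab d) = W c d"
| "bord W T (Lab c) Row = - T (label_q c)"
| "bord W T (Lab c) (Bd y) = - label_q c"
| "bord W T Row (Lab d) = T (label_q d)"
| "bord W T Row Row = 0"
| "bord W T Row (Bd y) = T 1"
| "bord W T (Bd x) (Lab d) = label_q d"
| "bord W T (Bd x) Row = - T 1"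
| "bord W T (Bd x) (Bd y) = (if x = y then 0 else if x then 1 else - 1)"

lemma alternating_bord: assumes "alternating W" shows "alternating (bord W T)"
proof
  interpret alternating W by fact
  show "bord W T c d = - bord W T d c" for c d
    by (cases c; cases d) (auto intro: skew)
  show "bord W T c c = 0" for c
    by (cases c) (auto simp: diag)
qed

lemma tconst_mult_distrib_sum: "tconst (\<Sum>x\<in>B. c x * d x) = (\<Sum>x\<in>B. tconst (c x) * tconst (d x))"
  by (simp add: tconst_sum tconst_mult)

definition X_trunc :: "(label \<Rightarrow> complex) \<Rightarrow> nat \<Rightarrow> tseries \<Rightarrow> tseries" where
  "X_trunc x n f = tconst (complex_of_real (sqrt 2) * x (Neg 0)) * X_op 0 f
     + (\<Sum>m\<in>{1..n}. tconst (x (Pos m)) * X_op (int m) f + tconst (x (Neg m)) * X_op (- int m) f)"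

lemma vertex_op_X_trunc: "vertex_op (X_trunc x n)"
  unfolding X_trunc_def by (intro vertex_op_add vertex_op_sum vertex_op_tconst_mult vertex_op_X)

text \<open>The bordering entry at -i splits into a combination of rows of the Q-block, whose sign
  in \<open>Q_mat\<close> is absorbed by \<open>row_coeff\<close>, and a number that the numerical
  part of W has to supply.\<close>

lemma X_trunc_qhat:
  assumes "x (Neg 0) = x (Pos 0)" "i \<le> n"
  shows "X_trunc x n (qhat i) = (\<Sum>m\<le>n. tconst (x (Pos m)) * skewQ m i) + tconst (target x (Neg i))"
proof -
  have "(\<Sum>m\<in>{1..n}. tconst (x (Pos m)) * X_op (int m) (qhat i) + tconst (x (Neg m)) * X_op (- int m) (qhat i))
    = (\<Sum>m\<in>{1..n}. tconst (x (Pos m)) * skewQ m i) + (\<Sum>m\<in>{1..n}. if m = i then tconst ((- 1) ^ i * x (Neg i)) else 0)"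
    unfolding sum.distrib[symmetric]
    by (intro sum.cong refl) (auto simp: X_op_pos_qhat X_op_neg_qhat tconst_mult tconst_neg_1_power mult.commute)
  also have "(\<Sum>m\<in>{1..n}. if m = i then tconst ((- 1) ^ i * x (Neg i)) else 0) = (if i = 0 then 0 else tconst ((- 1) ^ i * x (Neg i)))"
    using assms(2) by (simp add: sum.delta Suc_le_eq)
  finally have 1: "(\<Sum>m\<in>{1..n}. tconst (x (Pos m)) * X_op (int m) (qhat i) + tconst (x (Neg m)) * X_op (- int m) (qhat i))
    = (\<Sum>m\<in>{1..n}. tconst (x (Pos m)) * skewQ m i) + (if i = 0 then 0 else tconst ((- 1) ^ i * x (Neg i)))" .
  have 2: "tconst (complex_of_real (sqrt 2) * x (Neg 0)) * X_op 0 (qhat i) = tconst (x (Pos 0)) * (skewQ 0 i + (if i = 0 then 1 else 0))"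
    unfolding X_op_0_qhat[symmetric] tconst_mult_assoc assms(1) by (simp only: mult.commute)
  have "{..n} = insert 0 {1..n}" by auto
  then have "(\<Sum>m\<le>n. tconst (x (Pos m)) * skewQ m i) = tconst (x (Pos 0)) * skewQ 0 i + (\<Sum>m\<in>{1..n}. tconst (x (Pos m)) * skewQ m i)"
    by simp
  then show ?thesis unfolding X_trunc_def 1 2 by (simp add: distrib_left)
qed

lemma X_trunc_1:
  assumes "x (Neg 0) = x (Pos 0)"
  shows "X_trunc x n 1 = (\<Sum>m\<le>n. tconst (x (Pos m)) * qhat m)"
proof -
  have "X_trunc x n 1 = X_trunc x n (qhat 0)" by (simp add: qhat_def)
  also have "\<dots> = (\<Sum>m\<le>n. tconst (x (Pos m)) * skewQ m 0 + (if m = 0 then tconst (x (Pos 0)) else 0))"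
    by (subst X_trunc_qhat) (simp_all add: assms sum.distrib sum.delta)
  also have "\<dots> = (\<Sum>m\<le>n. tconst (x (Pos m)) * qhat m)"
    by (intro sum.cong refl) (simp add: skewQ_0_right, simp add: qhat_def)
  finally show ?thesis .
qed

lemma sum_label_range: "(\<Sum>c\<in>label_range n. f c) = (\<Sum>m\<le>n. f (Neg m)) + (\<Sum>m\<le>n. f (Pos m))"
  unfolding label_range_def by (subst sum.union_disjoint) (auto simp: sum.reindex inj_on_def)

definition trunc_labels :: "nat \<Rightarrow> label list"
  where "trunc_labels n = map (trunc_label n) [0..<2 * (n + 1)]"

lemma Pf_trunc_eq: "Pf_trunc W n = pf W (trunc_labels n)"
  unfolding Pf_trunc_def pfaffian_eq_pf trunc_labels_def pf_map ..

lemma trunc_labels_Suc: "trunc_labels (Suc n) = Neg (Suc n) # trunc_labels n @ [Pos (Suc n)]"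
proof (rule nth_equalityI)
  fix i assume i: "i < length (trunc_labels (Suc n))"
  consider "i = 0" | "i > 0" "i < 2 * n + 3" | "i = 2 * n + 3" using i by (fastforce simp: trunc_labels_def)
  then show "trunc_labels (Suc n) ! i = (Neg (Suc n) # trunc_labels n @ [Pos (Suc n)]) ! i"
  proof cases
    case 1
    then show ?thesis by (simp add: trunc_labels_def trunc_label_def del: upt_Suc)
  next
    case 2
    then obtain j where j: "i = Suc j" by (cases i) auto
    then show ?thesis using 2 by (simp add: trunc_labels_def nth_append trunc_label_def del: upt_Suc)
  next
    case 3
    then show ?thesis by (simp add: trunc_labels_def nth_append trunc_label_def del: upt_Suc)
  qed
qed (simp add: trunc_labels_def)

lemma trunc_labels_0: "trunc_labels 0 = [Neg 0, Pos 0]"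
  by (simp add: trunc_labels_def trunc_label_def upt_rec)

lemma set_trunc_labels: "set (trunc_labels n) = label_range n"
proof (induction n)
  case (Suc n)
  then show ?case by (auto simp: trunc_labels_Suc label_range_def atMost_Suc)
qed (auto simp: trunc_labels_0 label_range_def)

lemma length_trunc_labels [simp]: "length (trunc_labels n) = 2 * n + 2"
  by (simp add: trunc_labels_def)

lemma weight_in_trivial: "weight_in (\<lambda>x. 0 \<le> x) f"
  by (simp add: weight_in_def)

lemma weight_in_add: "weight_in P f \<Longrightarrow> weight_in P g \<Longrightarrow> weight_in P (f + g)"
  unfolding weight_in_def by (metis coeff_add add_0)

lemma weight_in_uminus: "weight_in P f \<Longrightarrow> weight_in P (- f)"
  by (simp add: weight_in_def)

lemma weight_in_mono: "weight_in P f \<Longrightarrow> (\<And>x. P x \<Longrightarrow> R x) \<Longrightarrow> weight_in R f"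
  by (auto simp: weight_in_def)

lemma weight_in_q_ge: "N \<le> n \<Longrightarrow> weight_in (\<lambda>x. int N \<le> x) (q n * f)"
  using weight_in_mono[OF weight_in_qz_mult[OF weight_in_trivial, of "int n" f], of "\<lambda>x. int N \<le> x"] by simp

lemma weight_in_ge_mult: assumes "weight_in (\<lambda>x. N \<le> x) f" shows "weight_in (\<lambda>x. N \<le> x) (f * g)"
  unfolding weight_in_def
proof (intro allI impI)
  fix m assume "coeff (f * g) m \<noteq> 0"
  then obtain a where a: "a \<subseteq># m" "coeff f a \<noteq> 0"
    unfolding coeff_mult by (metis (no_types, lifting) mem_Collect_eq mult_eq_0_iff sum.not_neutral_contains_not_neutral)
  then have "N \<le> int (weight a)" using assms by (simp add: weight_in_def)
  then show "N \<le> int (weight m)" using weight_diff[OF a(1)] by linarith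
qed

lemma weight_in_skewQ: assumes "j < N" shows "weight_in (\<lambda>x. int N \<le> x) (skewQ N j)"
proof (cases "j = 0")
  case True
  then show ?thesis using assms weight_in_tconst_mult[OF weight_in_q_ge[of N N 1], of inv_sqrt2]
    by (simp add: skewQ_0_right qhat_def)
next
  case False
  have "weight_in (\<lambda>x. int N \<le> x) (tconst (1 / 2) * (q N * q j))"
    by (intro weight_in_tconst_mult weight_in_q_ge) simp
  moreover have "weight_in (\<lambda>x. int N \<le> x) (\<Sum>k = 1..j. tconst ((- 1) ^ k) * (q (N + k) * q (j - k)))"
    by (intro weight_in_sum weight_in_tconst_mult weight_in_q_ge) simp
  ultimately show ?thesis using weight_in_add assms False
    by (simp add: skewQ_def schurQ_def mult.assoc tconst_neg_1_power)
qed

lemma coeff_X_op_eq_0: "int (weight m) < \<alpha> \<Longrightarrow> coeff (X_op \<alpha> f) m = 0"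
  using weight_in_X_op[OF weight_in_trivial, of \<alpha> f] unfolding weight_in_def by force

lemma sum_label_range_nonzero:
  "(\<Sum>\<alpha>\<in>label_range n - {Neg 0, Pos 0}. f \<alpha>) = (\<Sum>m\<in>{1..n}. f (Pos m) + f (Neg m))"
proof -
  have "label_range n - {Neg 0, Pos 0} = Pos ` {1..n} \<union> Neg ` {1..n}"
    by (auto simp: label_range_def)
  then show ?thesis by (simp only: sum.distrib) (subst sum.union_disjoint, auto simp: sum.reindex inj_on_def)
qed

text \<open>Labels above \<open>n\<close> raise the degree past that of \<open>m\<close>, and the
  negative labels are bounded by \<open>B\<close>, so a coefficient of the infinite sum is one of a
  finite sum.\<close>

lemma coeff_X_vec:
  assumes "\<And>k. k > B \<Longrightarrow> x (Neg k) = 0" and n: "B \<le> n" "weight m \<le> n"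
  shows "coeff (X_vec x f) m = coeff (X_trunc x n f) m"
proof -
  let ?S = "{\<alpha>. \<alpha> \<noteq> Neg 0 \<and> \<alpha> \<noteq> Pos 0}" and ?F = "\<lambda>\<alpha>. tconst (x \<alpha>) * X_op (ival \<alpha>) f"
  have zero: "coeff (?F \<alpha>) m = 0" if "\<alpha> \<notin> label_range (max N B)" "weight m \<le> N" for \<alpha> m N
  proof (cases \<alpha>)
    case (Neg k)
    then show ?thesis using that assms(1)[of k] by simp
  next
    case (Pos k)
    then show ?thesis using that by (simp add: coeff_X_op_eq_0)
  qed
  have "coeff (infsum ?F ?S) m = (\<Sum>\<alpha>\<in>label_range n - {Neg 0, Pos 0}. coeff (?F \<alpha>) m)"
  proof (rule coeff_infsum)
    fix N
    show "finite {\<alpha>\<in>?S. \<exists>m. weight m \<le> N \<and> coeff (?F \<alpha>) m \<noteq> 0}"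
      by (rule finite_subset[of _ "label_range (max N B)"]) (use zero in blast, simp)
  next
    fix \<alpha> assume "\<alpha> \<in> ?S - (label_range n - {Neg 0, Pos 0})"
    then have "\<alpha> \<notin> label_range (max n B)" using n by (auto simp: max_absorb1)
    then show "coeff (?F \<alpha>) m = 0" using n(2) by (rule zero)
  qed auto
  then show ?thesis
    unfolding X_vec_def X_trunc_def sum_label_range_nonzero by simp
qed

definition L_col :: "nat list \<Rightarrow> (int \<Rightarrow> int \<Rightarrow> complex) \<Rightarrow> label \<Rightarrow> label \<Rightarrow> complex"
  where "L_col lam r \<beta> = (\<lambda>\<alpha>. L_mat lam r \<alpha> \<beta>)"

lemma L_col_Neg: "k > nat \<bar>ival \<beta>\<bar> \<Longrightarrow> L_col lam r \<beta> (Neg k) = 0"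
  by (cases \<beta>) (auto simp: L_col_def L_mat_eq okJ_def)

lemma L_col_zero: "ival \<beta> \<noteq> 0 \<Longrightarrow> L_col lam r \<beta> (Neg 0) = L_col lam r \<beta> (Pos 0)"
  by (cases \<beta>) (auto simp: L_col_def L_mat_eq)

lemma L_col_zero_neq: "ival \<beta> = 0 \<Longrightarrow> L_col lam r \<beta> (Neg 0) \<noteq> L_col lam r \<beta> (Pos 0)"
  by (cases \<beta>) (auto simp: L_col_def L_mat_eq)

lemma X_trunc_sum: "X_trunc (\<lambda>\<alpha>. \<Sum>\<beta>\<in>B. c \<beta> * x \<beta> \<alpha>) n f = (\<Sum>\<beta>\<in>B. tconst (c \<beta>) * X_trunc (x \<beta>) n f)"
proof -
  have "X_trunc (\<lambda>\<alpha>. \<Sum>\<beta>\<in>B. c \<beta> * x \<beta> \<alpha>) n f = (\<Sum>\<beta>\<in>B. tconst (c \<beta>) * (tconst (complex_of_real (sqrt 2) * x \<beta> (Neg 0)) * X_op 0 f))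
     + (\<Sum>m\<in>{1..n}. \<Sum>\<beta>\<in>B. tconst (c \<beta>) * (tconst (x \<beta> (Pos m)) * X_op (int m) f + tconst (x \<beta> (Neg m)) * X_op (- int m) f))"
    unfolding X_trunc_def by (simp add: tconst_mult tconst_sum sum_distrib_left sum_distrib_right sum.distrib distrib_left mult_ac)
  also have "\<dots> = (\<Sum>\<beta>\<in>B. tconst (c \<beta>) * X_trunc (x \<beta>) n f)"
    unfolding X_trunc_def by (subst sum.swap) (simp add: distrib_left sum.distrib sum_distrib_left)
  finally show ?thesis .
qed

lemma annihilated_iff:
  "(\<forall>x\<in>U_space lam r. x (Neg 0) = x (Pos 0) \<longrightarrow> X_vec x f = 0) \<longleftrightarrow>
   (\<forall>\<beta>\<in>I_set lam. ival \<beta> \<noteq> 0 \<longrightarrow> X_vec (L_col lam r \<beta>) f = 0)"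
proof (intro iffI ballI impI)
  fix \<beta> assume *: "\<forall>x\<in>U_space lam r. x (Neg 0) = x (Pos 0) \<longrightarrow> X_vec x f = 0" "\<beta> \<in> I_set lam" "ival \<beta> \<noteq> 0"
  have "L_col lam r \<beta> \<in> U_space lam r"
    unfolding U_space_def using *(2) by (auto simp: L_col_def intro!: exI[of _ "{\<beta>}"] exI[of _ "\<lambda>_. 1"])
  with * L_col_zero show "X_vec (L_col lam r \<beta>) f = 0" by blast
next
  fix x assume *: "\<forall>\<beta>\<in>I_set lam. ival \<beta> \<noteq> 0 \<longrightarrow> X_vec (L_col lam r \<beta>) f = 0"
    and "x \<in> U_space lam r" and x0: "x (Neg 0) = x (Pos 0)"
  then obtain B c where B: "finite B" "B \<subseteq> I_set lam" and x: "x = (\<lambda>\<alpha>. \<Sum>\<beta>\<in>B. c \<beta> * L_col lam r \<beta> \<alpha>)"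
    unfolding U_space_def L_col_def by blast
  \<comment> \<open>A column with nonzero label has equal entries at the two zeros; the single
    column labelled by a zero does not, so its coefficient must vanish.\<close>
  have c0: "c \<beta> = 0" if "\<beta> \<in> B" "ival \<beta> = 0" for \<beta>
  proof -
    have "(\<Sum>\<gamma>\<in>B. c \<gamma> * (L_col lam r \<gamma> (Neg 0) - L_col lam r \<gamma> (Pos 0))) = 0"
      using x0 unfolding x by (simp add: right_diff_distrib sum_subtractf)
    also have "(\<Sum>\<gamma>\<in>B. c \<gamma> * (L_col lam r \<gamma> (Neg 0) - L_col lam r \<gamma> (Pos 0)))
      = (\<Sum>\<gamma>\<in>{\<beta>}. c \<gamma> * (L_col lam r \<gamma> (Neg 0) - L_col lam r \<gamma> (Pos 0)))"
    proof (rule sum.mono_neutral_right)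
      show "\<forall>\<gamma>\<in>B - {\<beta>}. c \<gamma> * (L_col lam r \<gamma> (Neg 0) - L_col lam r \<gamma> (Pos 0)) = 0"
      proof
        fix \<gamma> assume g: "\<gamma> \<in> B - {\<beta>}"
        then have "ival \<gamma> \<noteq> 0" using inj_ival_I[of \<gamma> lam \<beta>] that B(2) by auto
        then show "c \<gamma> * (L_col lam r \<gamma> (Neg 0) - L_col lam r \<gamma> (Pos 0)) = 0"
          using L_col_zero by simp
      qed
    qed (use B that in auto)
    finally show ?thesis using L_col_zero_neq[OF that(2), of lam r] by simp
  qed
  define K where "K = (\<Sum>\<beta>\<in>B. nat \<bar>ival \<beta>\<bar>)"
  have K: "nat \<bar>ival \<beta>\<bar> \<le> K" if "\<beta> \<in> B" for \<beta>
    unfolding K_def using B(1) that by (intro member_le_sum) auto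
  show "X_vec x f = 0"
  proof (rule tseries_eqI)
    fix m
    let ?n = "K + weight m"
    have "coeff (X_vec x f) m = coeff (X_trunc x ?n f) m"
    proof (rule coeff_X_vec[of K])
      fix k assume "k > K"
      then have "L_col lam r \<beta> (Neg k) = 0" if "\<beta> \<in> B" for \<beta>
        using K[OF that] by (intro L_col_Neg) simp
      then show "x (Neg k) = 0" unfolding x by simp
    qed auto
    also have "\<dots> = (\<Sum>\<beta>\<in>B. c \<beta> * coeff (X_trunc (L_col lam r \<beta>) ?n f) m)"
      unfolding x X_trunc_sum by simp
    also have "\<dots> = 0"
    proof (rule sum.neutral, rule ballI)
      fix \<beta> assume b: "\<beta> \<in> B"
      show "c \<beta> * coeff (X_trunc (L_col lam r \<beta>) ?n f) m = 0"
      proof (cases "ival \<beta> = 0")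
        case False
        then have "X_vec (L_col lam r \<beta>) f = 0" using * b B(2) by blast
        moreover have "coeff (X_vec (L_col lam r \<beta>) f) m = coeff (X_trunc (L_col lam r \<beta>) ?n f) m"
          by (rule coeff_X_vec[of "nat \<bar>ival \<beta>\<bar>"]) (use L_col_Neg K[OF b] in auto)
        ultimately show ?thesis by simp
      qed (use c0 b in simp)
    qed
    finally show "coeff (X_vec x f) m = coeff 0 m" by simp
  qed
qed

section \<open>Truncations of the Pfaffian: annihilation and convergence\<close>

locale strict_partition =
  fixes lam :: "nat list" and r :: "int \<Rightarrow> int \<Rightarrow> complex"
  assumes sorted: "sorted_wrt (>) lam" and even_length: "even (length lam)"
begin

abbreviation "W \<equiv> W_mat lam r"

lemmas W_eq = W_mat_eq[OF sorted, of r]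

sublocale W: alternating W
proof
  have Q: "Q_mat \<alpha> \<beta> = - Q_mat \<beta> \<alpha>" for \<alpha> \<beta>
    by (cases "(\<alpha>, \<beta>)" rule: Q_mat.cases) (auto intro: skewQ_skew[symmetric])
  show "W \<alpha> \<beta> = - W \<beta> \<alpha>" for \<alpha> \<beta>
    unfolding W_eq Q[of \<alpha> \<beta>] num_mat_skew[of lam r \<alpha> \<beta>] by (simp add: tconst_uminus)
  show "W \<alpha> \<alpha> = 0" for \<alpha>
    unfolding W_eq num_mat_diag by (cases \<alpha>) (simp_all add: skewQ_def)
qed

lemma tshift_W:
  "tshift (W c d) = fps_const (W c d) - ((tshift (label_q c) - fps_const (label_q c)) * fps_const (label_q d)
      - fps_const (label_q c) * (tshift (label_q d) - fps_const (label_q d)))"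
proof (cases "(c, d)" rule: Q_mat.cases)
  case (1 i j)
  then have c: "c = Neg i" "d = Neg j" by auto
  show ?thesis
    unfolding W_eq c Q_mat.simps tshift_add tshift_uminus tshift_tconst tshift_skewQ label_q.simps fps_const_add[symmetric] fps_const_neg[symmetric]
    by (simp only: minus_add_distrib diff_conv_add_uminus add_ac)
qed (auto simp: W_eq tshift_tconst)

lemma vertex_op_bord:
  assumes T: "vertex_op T" and L: "set L \<subseteq> range Lab \<union> {Bd False}"
  shows "T (pf (bord W T) L) = pf (bord W T) (Row # Bd True # L)"
proof -
  define p where "p c = (case c of Lab c \<Rightarrow> label_q c | _ \<Rightarrow> 1)" for c
  have L': "(\<exists>c'. c = Lab c') \<or> c = Bd False" if "c \<in> set L" for c using L that by auto
  show ?thesis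
  proof (rule vertex_op_pf[OF T alternating_bord[OF W.alternating_axioms], where p = p])
    fix c d assume cd: "c \<in> set L" "d \<in> set L"
    show "tshift (bord W T c d) = fps_const (bord W T c d) - ((tshift (p c) - fps_const (p c)) * fps_const (p d)
        - fps_const (p c) * (tshift (p d) - fps_const (p d)))"
      using L'[OF cd(1)] L'[OF cd(2)] tshift_W
      by (elim disjE exE) (simp_all add: p_def tshift_1 tshift_uminus flip: fps_const_neg)
  next
    fix c assume "c \<in> set L"
    from L'[OF this] show "bord W T (Bd True) c = p c" "bord W T Row c = T (p c)"
      by (auto simp: p_def)
  qed (use L' in auto)
qed

lemma pf_map_Lab: "pf (bord W T) (map Lab L) = pf W L"
  by (simp add: pf_map)

lemma X_trunc_Pf_trunc:
  assumes rel: "\<And>d. d \<in> label_range n \<Longrightarrow> (\<Sum>c\<in>label_range n. row_coeff lam x c * num_mat lam r c d) = target x d"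
    and x0: "x (Neg 0) = x (Pos 0)"
  shows "X_trunc x n (Pf_trunc W n) = 0"
proof -
  let ?T = "X_trunc x n" and ?L = "map Lab (trunc_labels n)"
  let ?y = "\<lambda>c. case c of Lab c \<Rightarrow> tconst (row_coeff lam x c) | _ \<Rightarrow> 0"
  interpret e: alternating "bord W ?T" by (rule alternating_bord) unfold_locales
  have "?T (Pf_trunc W n) = ?T (pf (bord W ?T) ?L)"
    unfolding Pf_trunc_eq pf_map_Lab ..
  also have "\<dots> = pf (bord W ?T) (Row # Bd True # ?L)"
    by (rule vertex_op_bord[OF vertex_op_X_trunc]) auto
  also have "\<dots> = 0"
  proof (rule e.pf_row_combination[where C = "Lab ` label_range n" and y = ?y])
    show "Lab ` label_range n \<subseteq> set (Bd True # ?L)" by (auto simp: set_trunc_labels)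
    fix d assume "d \<in> set (Bd True # ?L)"
    then consider "d = Bd True" | i where "d = Lab (Neg i)" "i \<le> n" | i where "d = Lab (Pos i)" "i \<le> n"
      by (auto simp: set_trunc_labels label_range_def)
    then have "bord W ?T Row d = (\<Sum>c\<in>label_range n. tconst (row_coeff lam x c) * bord W ?T (Lab c) d)"
    proof cases
      \<comment> \<open>The combination of rows must also be right in the column of the second
        bordering label, where the entry is the value of the operator on 1.\<close>
      case 1
      then show ?thesis by (simp add: sum_label_range X_trunc_1[OF x0] tconst_uminus)
    next
      case 2
      have "(\<Sum>c\<in>label_range n. tconst (row_coeff lam x c) * W c (Neg i)) =
        (\<Sum>c\<in>label_range n. tconst (row_coeff lam x c) * Q_mat c (Neg i)) + tconst (\<Sum>c\<in>label_range n. row_coeff lam x c * num_mat lam r c (Neg i))"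
        by (simp add: W_eq distrib_left sum.distrib tconst_mult_distrib_sum)
      also have "(\<Sum>c\<in>label_range n. tconst (row_coeff lam x c) * Q_mat c (Neg i)) = (\<Sum>m\<le>n. tconst (x (Pos m)) * skewQ m i)"
        by (simp add: sum_label_range tconst_uminus)
      also have "(\<Sum>c\<in>label_range n. row_coeff lam x c * num_mat lam r c (Neg i)) = target x (Neg i)"
        by (rule rel) (use 2 in simp)
      finally show ?thesis unfolding 2(1) bord.simps label_q.simps using X_trunc_qhat[OF x0 2(2)] by simp
    next
      case 3
      have Q: "Q_mat c (Pos i) = 0" for c by (cases c) auto
      have "(\<Sum>c\<in>label_range n. tconst (row_coeff lam x c) * W c (Pos i)) = tconst (\<Sum>c\<in>label_range n. row_coeff lam x c * num_mat lam r c (Pos i))"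
        by (simp add: W_eq Q tconst_mult_distrib_sum)
      also have "(\<Sum>c\<in>label_range n. row_coeff lam x c * num_mat lam r c (Pos i)) = target x (Pos i)"
        by (rule rel) (use 3 in simp)
      finally show ?thesis unfolding 3(1) bord.simps label_q.simps using vertex_op_zero[OF vertex_op_X_trunc, of x n] by simp
    qed
    then show "bord W ?T Row d = (\<Sum>c\<in>Lab ` label_range n. ?y c * bord W ?T c d)"
      by (subst sum.reindex) (auto simp: inj_on_def)
  qed
  finally show ?thesis .
qed

lemma part_le: "k \<in> set lam \<Longrightarrow> k \<le> sum_list lam"
  by (rule member_le_sum_list) auto

text \<open>Expand along -(n + 1). Against +(n + 1) the entry is 1 and the smaller truncation
  remains; all other entries are 0 or start in degree n + 1 or higher. The bound on \<open>n\<close>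
  keeps n + 1 from being a part.\<close>

lemma Pf_trunc_Suc:
  assumes "sum_list lam \<le> n"
  shows "weight_in (\<lambda>x. int (Suc n) \<le> x) (Pf_trunc W (Suc n) - Pf_trunc W n)"
proof -
  let ?a = "Neg (Suc n)" and ?L = "trunc_labels n @ [Pos (Suc n)]"
  have lam: "Suc n \<notin> set lam" using part_le assms by fastforce
  have "Pf_trunc W (Suc n) = (\<Sum>k<Suc (2 * n + 2). (- 1) ^ k * W ?a (?L ! k) * pf W (del k ?L))"
    by (simp add: Pf_trunc_eq trunc_labels_Suc pf.simps(2))
  also have "\<dots> = (\<Sum>k<2 * n + 2. (- 1) ^ k * W ?a (?L ! k) * pf W (del k ?L)) + W ?a (Pos (Suc n)) * pf W (trunc_labels n)"
    using length_trunc_labels[of n] by (simp add: nth_append del_append del: length_trunc_labels)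
  also have "W ?a (Pos (Suc n)) = 1"
    using lam by (simp add: W_eq num_mat_Neg_Pos[OF even_length])
  finally have eq: "Pf_trunc W (Suc n) - Pf_trunc W n = (\<Sum>k<2 * n + 2. tconst ((- 1) ^ k) * (W ?a (?L ! k) * pf W (del k ?L)))"
    by (simp add: Pf_trunc_eq tconst_neg_1_power mult.assoc)
  show ?thesis
    unfolding eq
  proof (intro weight_in_sum weight_in_tconst_mult weight_in_ge_mult)
    fix k assume k: "k \<in> {..<2 * n + 2}"
    then have "?L ! k \<in> label_range n" by (simp add: nth_append set_trunc_labels[symmetric])
    then consider j where "?L ! k = Neg j" "j \<le> n" | j where "?L ! k = Pos j" "j \<le> n"
      by (auto simp: label_range_def)
    then show "weight_in (\<lambda>x. int (Suc n) \<le> x) (W ?a (?L ! k))"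
    proof cases
      case 1
      then show ?thesis using weight_in_uminus[OF weight_in_skewQ[of j "Suc n"]] by (simp add: W_eq)
    next
      case 2
      then show ?thesis using lam by (simp add: W_eq num_mat_Neg_Pos[OF even_length])
    qed
  qed
qed

lemma Pf_trunc_stable:
  assumes "sum_list lam \<le> n" "n \<le> n'"
  shows "weight_in (\<lambda>x. int n < x) (Pf_trunc W n' - Pf_trunc W n)"
  using assms(2)
proof (induction n' rule: dec_induct)
  case (step k)
  have "weight_in (\<lambda>x. int n < x) (Pf_trunc W (Suc k) - Pf_trunc W k)"
    by (rule weight_in_mono[OF Pf_trunc_Suc]) (use assms step in auto)
  from weight_in_add[OF this step.IH] show ?case by simp
qed simp

lemma Pf_limit:
  "convergent (Pf_trunc W)" and
  Pf_inf_approx: "sum_list lam \<le> n \<Longrightarrow> weight_in (\<lambda>x. int n < x) (Pf_inf W - Pf_trunc W n)"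
proof -
  \<comment> \<open>Each coefficient is read off where the truncations have become stationary in its
    degree.\<close>
  define f where "f = Tseries (\<lambda>m. coeff (Pf_trunc W (weight m + sum_list lam)) m)"
  have approx: "coeff (Pf_trunc W n) m = coeff f m" if "sum_list lam + weight m \<le> n" for n m
  proof -
    have "weight_in (\<lambda>x. int (weight m + sum_list lam) < x) (Pf_trunc W n - Pf_trunc W (weight m + sum_list lam))"
      using that by (intro Pf_trunc_stable) auto
    then show ?thesis by (force simp: weight_in_def f_def)
  qed
  have lim: "Pf_trunc W \<longlonglongrightarrow> f"
    unfolding tendsto_tseries_iff
  proof
    fix N
    show "\<forall>\<^sub>F n in sequentially. \<forall>m. weight m \<le> N \<longrightarrow> coeff (Pf_trunc W n) m = coeff f m"
      by (rule eventually_sequentiallyI[of "sum_list lam + N"]) (auto intro!: approx)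
  qed
  then show "convergent (Pf_trunc W)" by (rule convergentI)
  have inf: "Pf_inf W = f" unfolding Pf_inf_def using lim by (rule limI)
  show "weight_in (\<lambda>x. int n < x) (Pf_inf W - Pf_trunc W n)" if n: "sum_list lam \<le> n"
    unfolding weight_in_def inf
  proof (intro allI impI)
    fix m assume nz: "coeff (f - Pf_trunc W n) m \<noteq> 0"
    let ?k = "n + weight m"
    have "coeff (f - Pf_trunc W n) m = coeff (Pf_trunc W ?k - Pf_trunc W n) m"
      using approx[of m ?k] n by simp
    then show "int n < int (weight m)"
      using nz Pf_trunc_stable[OF n, of ?k] by (simp add: weight_in_def)
  qed
qed

lemma Pf_inf_annihilated:
  assumes "\<beta> \<in> I_set lam" "ival \<beta> \<noteq> 0"
  shows "X_vec (L_col lam r \<beta>) (Pf_inf W) = 0"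
proof (rule tseries_eqI)
  fix m
  let ?x = "L_col lam r \<beta>" and ?K = "nat \<bar>ival \<beta>\<bar>"
  \<comment> \<open>Large enough to contain the label of the column and to keep the truncation
    error, of degree above n, beyond \<open>m\<close> after it is lowered by at most
    \<open>?K\<close>.\<close>
  define n where "n = ?K + weight m + sum_list lam"
  have rel: "(\<Sum>c\<in>label_range n. row_coeff lam ?x c * num_mat lam r c d) = target ?x d" if "d \<in> label_range n" for d
  proof (cases \<beta>)
    case (Neg k)
    then show ?thesis using column_relation_Neg[OF even_length, of k n d r] assms that
      unfolding L_col_def by (simp add: n_def)
  next
    case (Pos k)
    then show ?thesis using column_relation_Pos[OF even_length, of k n d r] assms that
      unfolding L_col_def by (simp add: n_def)
  qed
  let ?f = "Pf_inf W - Pf_trunc W n"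
  have f: "weight_in (\<lambda>x. int n < x) ?f" by (rule Pf_inf_approx) (simp add: n_def)
  have X: "coeff (X_op \<alpha> ?f) m = 0" if "\<alpha> \<ge> - int ?K" for \<alpha>
    using weight_in_X_op[OF f, of \<alpha>] that unfolding weight_in_def n_def by fastforce
  have "coeff (tconst (?x (Neg k)) * X_op (- int k) ?f) m = 0" for k
    using X[of "- int k"] L_col_Neg[of \<beta> k lam r] by (cases "k > ?K") auto
  then have "coeff (X_trunc ?x n ?f) m = 0"
    unfolding X_trunc_def by (auto simp: X intro!: sum.neutral)
  moreover have "X_trunc ?x n (Pf_inf W) = X_trunc ?x n ?f + X_trunc ?x n (Pf_trunc W n)"
    by (subst vertex_op_additive[OF vertex_op_X_trunc, symmetric]) simp
  moreover have "X_trunc ?x n (Pf_trunc W n) = 0"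
    by (rule X_trunc_Pf_trunc[OF rel]) (simp_all add: L_col_zero assms)
  moreover have "coeff (X_vec ?x (Pf_inf W)) m = coeff (X_trunc ?x n (Pf_inf W)) m"
    by (rule coeff_X_vec[of ?K]) (auto simp: L_col_Neg n_def)
  ultimately show "coeff (X_vec ?x (Pf_inf W)) m = coeff 0 m" by simp
qed

end

section \<open>Uniqueness\<close>

abbreviation word :: "int list \<Rightarrow> tseries \<Rightarrow> tseries"
  where "word w f \<equiv> foldr X_op w f"

lemma word_add: "word w (f + g) = word w f + word w g"
  by (induction w) (simp_all add: X_op_add)

lemma word_tconst: "word w (tconst c * f) = tconst c * word w f"
  by (induction w) (simp_all add: X_op_tconst_mult)

lemma word_0 [simp]: "word w 0 = 0"
  by (induction w) simp_all

lemma word_sum: "word w (\<Sum>x\<in>B. F x) = (\<Sum>x\<in>B. word w (F x))"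
  by (induction B rule: infinite_finite_induct) (simp_all add: word_add)

lemma weight_in_word: "weight_in P f \<Longrightarrow> weight_in (\<lambda>x. P (x - sum_list w)) (word w f)"
proof (induction w)
  case (Cons a w)
  from weight_in_X_op[OF Cons.IH[OF Cons.prems], of a] show ?case by (simp add: diff_diff_eq)
qed simp

definition vac :: "nat list \<Rightarrow> tseries \<Rightarrow> complex"
  where "vac ks f = coeff (word (map (\<lambda>k. - int k) ks) f) {#}"

lemma vac_add: "vac ks (f + g) = vac ks f + vac ks g"
  and vac_tconst: "vac ks (tconst c * f) = c * vac ks f"
  and vac_0 [simp]: "vac ks 0 = 0"
  and vac_sum: "vac ks (\<Sum>x\<in>B. F x) = (\<Sum>x\<in>B. vac ks (F x))"
  by (simp_all add: vac_def word_add word_tconst word_sum)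

lemma coeff_X_op_0: "coeff (X_op 0 f) {#} = inv_sqrt2 * coeff f {#}"
  unfolding X_op_eq_vertex_lin by (subst coeff_vertex_lin[of _ _ 0]) (simp_all add: tshift_def)

lemma clifford_swap: "X_op \<alpha> (X_op \<beta> f) = tconst (if \<alpha> + \<beta> = 0 then (- 1) ^ nat \<bar>\<alpha>\<bar> else 0) * f + tconst (- 1) * X_op \<beta> (X_op \<alpha> f)"
  using clifford[of \<alpha> \<beta> f] by (auto simp: tconst_neg_1_power tconst_uminus eq_diff_eq)

lemma word_anticommute:
  assumes "\<And>k. k \<in> set ks \<Longrightarrow> \<alpha> \<noteq> int k"
  shows "word (map (\<lambda>k. - int k) ks) (X_op \<alpha> f) = tconst ((- 1) ^ length ks) * X_op \<alpha> (word (map (\<lambda>k. - int k) ks) f)"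
  using assms
proof (induction ks)
  case (Cons k ks)
  have "X_op (- int k) (X_op \<alpha> g) = tconst (- 1) * X_op \<alpha> (X_op (- int k) g)" for g
    using clifford_swap[of "- int k" \<alpha> g] Cons.prems[of k] by simp
  then show ?case using Cons by (simp add: X_op_tconst_mult tconst_mult_assoc)
qed simp

lemma vac_pos: "\<alpha> > 0 \<Longrightarrow> (\<And>k. k \<in> set ks \<Longrightarrow> \<alpha> \<noteq> int k) \<Longrightarrow> vac ks (X_op \<alpha> f) = 0"
  unfolding vac_def by (subst word_anticommute) (auto simp: coeff_X_op_eq_0)

lemma vac_zero: "0 \<notin> set ks \<Longrightarrow> vac ks (X_op 0 f) = (- 1) ^ length ks * inv_sqrt2 * vac ks f"
  unfolding vac_def by (subst word_anticommute) (auto simp: coeff_X_op_0 intro!: Nat.gr0I)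

lemma X_op_sq: "\<alpha> \<noteq> 0 \<Longrightarrow> X_op \<alpha> (X_op \<alpha> f) = 0"
proof -
  assume "\<alpha> \<noteq> 0"
  then have "tconst (1 / 2) * (X_op \<alpha> (X_op \<alpha> f) + X_op \<alpha> (X_op \<alpha> f)) = 0"
    using clifford[of \<alpha> \<alpha> f] by simp
  then show ?thesis by (metis distrib_left tconst_half(2))
qed

lemma vac_neg:
  assumes "k \<in> set ks" "k > 0"
  shows "vac ks (X_op (- int k) f) = 0"
proof -
  obtain us vs where ks: "ks = us @ k # vs" using assms(1) by (auto simp: in_set_conv_decomp)
  have "word (map (\<lambda>k. - int k) vs) (X_op (- int k) f) = tconst ((- 1) ^ length vs) * X_op (- int k) (word (map (\<lambda>k. - int k) vs) f)"
    by (rule word_anticommute) (use assms(2) in auto)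
  then show ?thesis
    using assms(2) by (simp add: vac_def ks X_op_tconst_mult X_op_sq)
qed

text \<open>Creation operators in the opposite order undo the annihilations one by one, so the plain
  constant term can be recovered from \<open>vac ks\<close>.\<close>

lemma vac_creation:
  assumes "distinct ks" "0 \<notin> set ks"
  shows "\<exists>c. c \<noteq> 0 \<and> (\<forall>g. vac ks (word (map int (rev ks)) g) = c * coeff g {#})"
  using assms
proof (induction ks rule: rev_induct)
  case Nil
  then show ?case by (intro exI[of _ 1]) (simp add: vac_def)
next
  case (snoc k us)
  then obtain c where c: "c \<noteq> 0" "\<And>g. vac us (word (map int (rev us)) g) = c * coeff g {#}" by auto
  have "vac (us @ [k]) (word (map int (rev (us @ [k]))) g) = (- 1) ^ k * c * coeff g {#}" for g
  proof -
    let ?h = "word (map int (rev us)) g"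
    have "vac (us @ [k]) (word (map int (rev (us @ [k]))) g) = vac us (X_op (- int k) (X_op (int k) ?h))"
      by (simp add: vac_def)
    also have "\<dots> = (- 1) ^ k * vac us ?h - vac us (X_op (int k) (X_op (- int k) ?h))"
      unfolding clifford_swap[of "- int k"] vac_add vac_tconst by simp
    also have "vac us (X_op (int k) (X_op (- int k) ?h)) = 0"
      by (rule vac_pos) (use snoc.prems in auto)
    finally show ?thesis by (simp add: c)
  qed
  then show ?case using c(1) by (intro exI[of _ "(- 1) ^ k * c"]) simp
qed

lemma X_vec_additive:
  assumes "\<And>k. k > B \<Longrightarrow> x (Neg k) = 0"
  shows "X_vec x (f + tconst c * g) = X_vec x f + tconst c * X_vec x g"
proof (rule tseries_eqI)
  fix m
  have "coeff (X_vec x h) m = coeff (X_trunc x (B + weight m) h) m" for h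
    by (rule coeff_X_vec[of B]) (use assms in auto)
  then show "coeff (X_vec x (f + tconst c * g)) m = coeff (X_vec x f + tconst c * X_vec x g) m"
    by (simp add: vertex_op_additive[OF vertex_op_X_trunc] vertex_op_scale[OF vertex_op_X_trunc])
qed

lemma (in strict_partition) distinct_lam: "distinct lam"
proof -
  have "sorted_wrt (>) xs \<Longrightarrow> distinct xs" for xs :: "nat list" by (induction xs) auto
  then show ?thesis using sorted .
qed

section \<open>The functional of the partition determines an annihilated series\<close>

context strict_partition
begin

definition "pos_parts = filter (\<lambda>k. k > 0) lam"

abbreviation "lam_vac \<equiv> vac pos_parts"

abbreviation "J \<equiv> J_set lam"

text \<open>The opposites of the nonzero labels of I_\<lambda>: creation operators relative to the
  functional of \<lambda>. Words in them suffice to test whether a series vanishes.\<close>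

definition "J' = {\<gamma>. \<gamma> \<noteq> 0 \<and> - \<gamma> \<in> J}"

lemma J_or_J': "\<alpha> \<in> J \<or> \<alpha> \<in> J'"
  by (auto simp: J'_def J_set_iff)

lemma lam_vac_J: "a \<in> J \<Longrightarrow> a \<noteq> 0 \<Longrightarrow> lam_vac (X_op a f) = 0"
proof (cases "a > 0")
  case True
  moreover assume "a \<in> J"
  ultimately show ?thesis by (intro vac_pos) (auto simp: J_set_iff pos_parts_def)
next
  case False
  moreover assume "a \<in> J" "a \<noteq> 0"
  ultimately show ?thesis using vac_neg[of "nat (- a)" pos_parts f] by (auto simp: J_set_iff pos_parts_def)
qed

lemma lam_vac_0: "lam_vac (X_op 0 f) = (- 1) ^ length pos_parts * inv_sqrt2 * lam_vac f"
  by (rule vac_zero) (simp add: pos_parts_def)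

text \<open>Moving X_a to the left costs scalars times words without it, which vanish by assumption.
  On the far left it is killed by the functional, or for a = 0 turns into a scalar.\<close>

lemma lam_vac_word_J:
  assumes vanish: "\<And>w. set w \<subseteq> J' \<Longrightarrow> length w \<le> n \<Longrightarrow> lam_vac (word w f) = 0"
    and "set V \<subseteq> J'" "set U \<subseteq> J'" "length V + length U \<le> n" "a \<in> J"
  shows "lam_vac (word V (X_op a (word U f))) = 0"
  using assms(2-4)
proof (induction V arbitrary: U rule: rev_induct)
  case Nil
  then show ?case
    using lam_vac_J[OF \<open>a \<in> J\<close>] vanish[of U] by (cases "a = 0") (simp_all add: lam_vac_0)
next
  case (snoc \<gamma> V)
  have "word V (word U f) = word (V @ U) f" by simp
  then have "lam_vac (word V (word U f)) = 0" using snoc.prems by (simp only:) (intro vanish, auto)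
  moreover have "lam_vac (word V (X_op a (word (\<gamma> # U) f))) = 0" using snoc.prems by (intro snoc.IH) auto
  ultimately show ?case
    by (simp add: clifford_swap[of \<gamma> a] word_add word_tconst vac_add vac_tconst)
qed

lemma lam_vac_word_vanish:
  assumes ann: "\<And>\<beta>. \<beta> \<in> I_set lam \<Longrightarrow> ival \<beta> \<noteq> 0 \<Longrightarrow> X_vec (L_col lam r \<beta>) \<tau> = 0"
    and "lam_vac \<tau> = 0" "set w \<subseteq> J'"
  shows "lam_vac (word w \<tau>) = 0"
  using assms(3)
proof (induction "length w" arbitrary: w rule: less_induct)
  case less
  show ?case
  proof (cases w rule: rev_exhaust)
    case Nil
    then show ?thesis using assms(2) by simp
  next
    case (snoc V \<gamma>)
    define b where "b = - \<gamma>"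
    have b: "b \<in> J" "b \<noteq> 0" "set V \<subseteq> J'" using less.prems snoc by (auto simp: b_def J'_def)
    define \<beta> where "\<beta> = rep lam b"
    have \<beta>: "\<beta> \<in> I_set lam" "ival \<beta> = b" using rep[OF b(1)] by (auto simp: \<beta>_def)
    let ?x = "L_col lam r \<beta>"
    let ?w = "map (\<lambda>k. - int k) pos_parts @ V"
    \<comment> \<open>Terms outside this truncation have degree above n and cannot come down to a
      constant under the remaining word; the summand for b keeps the label -b inside.\<close>
    define n where "n = nat \<bar>sum_list ?w\<bar> + nat \<bar>b\<bar>"
    have \<Phi>J: "lam_vac (word V (X_op a \<tau>)) = 0" if "a \<in> J" for a
    proof (rule lam_vac_word_J[of "length V" \<tau> V "[]" a, simplified])
      fix w' assume "set w' \<subseteq> J'" "length w' \<le> length V"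
      then show "lam_vac (word w' \<tau>) = 0" using snoc by (intro less.hyps) auto
    qed (use b that in auto)
    have T: "weight_in (\<lambda>x. int n < x) (X_trunc ?x n \<tau>)"
      unfolding weight_in_def
    proof (intro allI impI, rule ccontr)
      fix m assume *: "coeff (X_trunc ?x n \<tau>) m \<noteq> 0" "\<not> int n < int (weight m)"
      have "coeff (X_vec ?x \<tau>) m = coeff (X_trunc ?x n \<tau>) m"
      proof (rule coeff_X_vec)
        show "?x (Neg k) = 0" if "k > nat \<bar>ival \<beta>\<bar>" for k using L_col_Neg that .
        show "nat \<bar>ival \<beta>\<bar> \<le> n" by (simp add: \<beta>(2) n_def)
        show "weight m \<le> n" using *(2) by simp
      qed
      then show False using * ann[OF \<beta>(1)] \<beta>(2) b(2) by simp
    qed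
    have "lam_vac (word V (X_trunc ?x n \<tau>)) = 0"
    proof -
      have "weight_in (\<lambda>x. int n < x - sum_list ?w) (word ?w (X_trunc ?x n \<tau>))" by (rule weight_in_word[OF T])
      moreover have "\<not> int n < 0 - sum_list ?w" unfolding n_def by linarith
      ultimately have "coeff (word ?w (X_trunc ?x n \<tau>)) {#} = 0" by (force simp: weight_in_def)
      then show ?thesis by (simp add: vac_def)
    qed
    moreover have "lam_vac (word V (X_trunc ?x n \<tau>)) = complex_of_real (sqrt 2) * ?x (Neg 0) * lam_vac (word V (X_op 0 \<tau>))
      + (\<Sum>m\<in>{1..n}. ?x (Pos m) * lam_vac (word V (X_op (int m) \<tau>)) + ?x (Neg m) * lam_vac (word V (X_op (- int m) \<tau>)))"
      unfolding X_trunc_def by (simp only: word_add word_tconst word_sum vac_add vac_tconst vac_sum)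
    moreover have "lam_vac (word V (X_op 0 \<tau>)) = 0" by (rule \<Phi>J) (simp add: J_set_iff)
    \<comment> \<open>Outside J the column has the entry of M at -b and nothing else, so the
      equation is solved for X_{-b} with a sign as coefficient.\<close>
    moreover have x_Pos: "?x (Pos m) * lam_vac (word V (X_op (int m) \<tau>)) = (if int m = - b then (- 1) ^ nat \<bar>b\<bar> * lam_vac (word V (X_op (- b) \<tau>)) else 0)"
      if "m > 0" for m
    proof (cases "int m \<in> J")
      case True
      moreover have "int m \<noteq> - b"
      proof
        assume "int m = - b"
        then have "b = - int m" by simp
        then show False using True b that by (auto simp: J_set_iff)
      qed
      ultimately show ?thesis using \<Phi>J by simp
    next
      case False
      then have "?x (Pos m) = (if int m = - b then (- 1) ^ nat \<bar>b\<bar> else 0)"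
        using \<beta>(2) that by (cases \<beta>) (auto simp: L_col_def L_mat_eq okJ_def)
      then show ?thesis by simp
    qed
    moreover have x_Neg: "?x (Neg m) * lam_vac (word V (X_op (- int m) \<tau>)) = (if int m = b then (- 1) ^ nat \<bar>b\<bar> * lam_vac (word V (X_op (- b) \<tau>)) else 0)"
      if "m > 0" for m
    proof (cases "- int m \<in> J")
      case True
      moreover have "int m \<noteq> b" using True b that by (auto simp: J_set_iff)
      ultimately show ?thesis using \<Phi>J by simp
    next
      case False
      then have "?x (Neg m) = (if int m = b then (- 1) ^ nat \<bar>b\<bar> else 0)"
        using \<beta>(2) that by (cases \<beta>) (auto simp: L_col_def L_mat_eq okJ_def)
      then show ?thesis by simp
    qed
    ultimately have "(\<Sum>m\<in>{1..n}. (if int m = - b then (- 1) ^ nat \<bar>b\<bar> * lam_vac (word V (X_op (- b) \<tau>)) else 0)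
        + (if int m = b then (- 1) ^ nat \<bar>b\<bar> * lam_vac (word V (X_op (- b) \<tau>)) else 0)) = 0"
      by (simp add: Suc_le_eq)
    also have "(\<Sum>m\<in>{1..n}. (if int m = - b then (- 1) ^ nat \<bar>b\<bar> * lam_vac (word V (X_op (- b) \<tau>)) else 0)
        + (if int m = b then (- 1) ^ nat \<bar>b\<bar> * lam_vac (word V (X_op (- b) \<tau>)) else 0))
      = (\<Sum>m\<in>{1..n}. if m = nat \<bar>b\<bar> then (- 1) ^ nat \<bar>b\<bar> * lam_vac (word V (X_op (- b) \<tau>)) else 0)"
      by (intro sum.cong refl) (use b(2) in auto)
    also have "\<dots> = (- 1) ^ nat \<bar>b\<bar> * lam_vac (word V (X_op (- b) \<tau>))"
      using b(2) by (subst sum.delta) (auto simp: n_def)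
    finally show ?thesis using snoc by (simp add: b_def)
  qed
qed

lemma annihilated_unique:
  assumes ann: "\<And>\<beta>. \<beta> \<in> I_set lam \<Longrightarrow> ival \<beta> \<noteq> 0 \<Longrightarrow> X_vec (L_col lam r \<beta>) \<tau> = 0"
    and lam_vac: "lam_vac \<tau> = 0"
  shows "\<tau> = 0"
proof (rule zero_if_no_vacuum_component)
  \<comment> \<open>The common kernel of all functionals given by words in J'. It is stable under
    X_{-k}: either -k is in J and moves to the left, or it only lengthens the word.\<close>
  let ?Z = "{f. \<forall>w. set w \<subseteq> J' \<longrightarrow> lam_vac (word w f) = 0}"
  show "\<tau> \<in> ?Z" using lam_vac_word_vanish[OF ann lam_vac] by blast
  show "X_op (- int k) f \<in> ?Z" if f: "f \<in> ?Z" for f k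
  proof (intro CollectI allI impI)
    fix w assume w: "set w \<subseteq> J'"
    show "lam_vac (word w (X_op (- int k) f)) = 0"
    proof (cases "- int k \<in> J")
      case True
      show ?thesis
        using lam_vac_word_J[of "length w" f w "[]" "- int k"] f w True by auto
    next
      case False
      then have "set (w @ [- int k]) \<subseteq> J'" using J_or_J' w by auto
      then have "lam_vac (word (w @ [- int k]) f) = 0" using f by blast
      then show ?thesis by simp
    qed
  qed
  show "coeff f {#} = 0" if f: "f \<in> ?Z" for f
  proof -
    have "distinct pos_parts" "0 \<notin> set pos_parts" using distinct_lam by (auto simp: pos_parts_def)
    then obtain c where c: "c \<noteq> 0" "lam_vac (word (map int (rev pos_parts)) f) = c * coeff f {#}"
      using vac_creation by metis
    have "set (map int (rev pos_parts)) \<subseteq> J'"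
      by (auto simp: pos_parts_def J'_def J_set_iff)
    then have "lam_vac (word (map int (rev pos_parts)) f) = 0" using f by blast
    then show ?thesis using c by simp
  qed
qed

end

section \<open>The vacuum component of the Pfaffian\<close>

definition flat :: "('a \<times> 'a) list \<Rightarrow> 'a list"
  where "flat ps = concat (map (\<lambda>(a, b). [a, b]) ps)"

text \<open>The first row of each pair vanishes on all later labels, so the matching is forced pair
  by pair.\<close>

lemma (in alternating) pf_flat:
  assumes "sorted_wrt (\<lambda>(a, b) (c, d). A a c = 0 \<and> A a d = 0) ps"
  shows "pf A (flat ps) = (\<Prod>(a, b)\<leftarrow>ps. A a b)"
  using assms
proof (induction ps)
  case (Cons p ps)
  obtain a b where p: "p = (a, b)" by (cases p)
  have "A a d = 0" if "d \<in> set (flat ps)" for d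
    using Cons.prems that by (auto simp: p flat_def)
  then have "pf A (a # b # flat ps) = A a b * pf A (flat ps)" by (rule pf_pair)
  then show ?case using Cons by (simp add: p flat_def)
qed (simp add: flat_def)

lemma flat_map: "flat (map (map_prod f f) ps) = map f (flat ps)"
  by (induction ps) (auto simp: flat_def)

lemma flat_append: "flat (ps @ qs) = flat ps @ flat qs"
  by (simp add: flat_def)

lemma mset_flat_map: "mset (flat (map (\<lambda>j. (f j, g j)) xs)) = mset (map f xs) + mset (map g xs)"
  by (induction xs) (simp_all add: flat_def)

definition dummies :: "'a list \<Rightarrow> ('a \<times> 'a) list"
  where "dummies xs = map (\<lambda>i. (xs ! (2 * i + 1), xs ! (2 * i))) [0..<length xs div 2]"

lemma mset_flat_dummies: "even (length xs) \<Longrightarrow> mset (flat (dummies xs)) = mset xs"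
proof (induction xs rule: induct_list012)
  case (3 x y zs)
  have "dummies (x # y # zs) = (y, x) # dummies zs"
    by (simp add: dummies_def map_upt_Suc del: upt_Suc)
  then show ?case using 3 by (simp add: flat_def add_mset_commute)
qed (simp_all add: dummies_def flat_def)

lemma pf_bord_indep: "Row \<notin> set L \<Longrightarrow> pf (bord W T) L = pf (bord W T') L"
proof (rule pf_cong)
  fix c d assume "Row \<notin> set L" "c \<in> set L" "d \<in> set L"
  then show "bord W T c d = bord W T' c d" by (cases c; cases d) auto
qed

lemma pf_bord_Bd: "pf (bord W T) (Bd x # map Lab L) = pf (bord W T) (Bd y # map Lab L)"
  by (simp add: pf.simps(2))

lemma coeff_mult_const: "coeff (f * g) {#} = coeff f {#} * coeff g {#}"
  by (simp add: coeff_mult)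

lemma coeff_pf_const: "coeff (pf A L) {#} = pf (\<lambda>c d. coeff (A c d) {#}) L"
  by (rule pf_hom[of "\<lambda>f. coeff f {#}"]) (simp_all add: coeff_1 coeff_mult_const)

lemma weight_in_const_0: "weight_in (\<lambda>x. int N \<le> x) f \<Longrightarrow> 0 < N \<Longrightarrow> coeff f {#} = 0"
  by (force simp: weight_in_def)

lemma coeff_skewQ_const: "coeff (skewQ i j) {#} = 0"
proof -
  have "coeff (skewQ i j) {#} = 0" if "j < i" for i j
    using weight_in_const_0[OF weight_in_skewQ[OF that]] that by simp
  note gt = this
  consider "j < i" | "i = j" | "i < j" by linarith
  then show ?thesis
  proof cases
    case 3
    then have "coeff (- skewQ j i) {#} = 0" using gt by simp
    then show ?thesis by (subst skewQ_skew)
  qed (simp_all add: gt, simp add: skewQ_def)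
qed

lemma coeff_qhat_const: "coeff (qhat i) {#} = (if i = 0 then 1 else 0)"
  using weight_in_const_0[OF weight_in_q_ge[of i i 1]] by (auto simp: qhat_def coeff_1)

section \<open>Striking out the parts and evaluating at t = 0\<close>

context strict_partition
begin

definition "bordW = bord W (\<lambda>_. 0)"

sublocale bordW: alternating bordW
  unfolding bordW_def by (rule alternating_bord) unfold_locales

text \<open>A list with an odd number of labels is completed by a bordering label.\<close>

definition pf_bord :: "label list \<Rightarrow> tseries"
  where "pf_bord L = pf bordW (if even (length L) then map Lab L else Bd False # map Lab L)"

text \<open>The bordering row of X_{-m} has its only nonzero entry at -m. Expanding along it removes
  -m and leaves \<open>Bd True\<close>, which completes an odd list or is cancelled against
  \<open>Bd False\<close>.\<close>

lemma X_op_pf_bord: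
  assumes m: "m > 0" "Neg m \<notin> set L"
  shows "\<exists>s\<in>{1, - 1}. X_op (- int m) (pf_bord (Neg m # L)) = tconst s * pf_bord L"
proof -
  let ?T = "X_op (- int m)" and ?B = "bord W (X_op (- int m))"
  interpret b: alternating ?B by (rule alternating_bord) unfold_locales
  have row: "?B Row (Lab d) = (if d = Neg m then tconst ((- 1) ^ m) else 0)" for d
    using m(1) by (cases d) (auto simp: X_op_neg_qhat tconst_neg_1_power)
  have Bd: "?B Row (Bd y) = 0" for y using m(1) by (simp add: X_op_neg_1)
  have indep: "pf bordW M = pf ?B M" if "Row \<notin> set M" for M
    unfolding bordW_def using that by (rule pf_bord_indep)
  have expand: "pf ?B (Row # us @ Lab (Neg m) # map Lab L) = tconst ((- 1) ^ length us * (- 1) ^ m) * pf ?B (us @ map Lab L)"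
    if "\<And>u. u \<in> set us \<Longrightarrow> ?B Row u = 0" for us
  proof -
    let ?M = "us @ Lab (Neg m) # map Lab L"
    have z: "?B Row (?M ! k) = 0" if "k < length ?M" "k \<noteq> length us" for k
    proof (cases "k < length us")
      case True
      then show ?thesis using \<open>\<And>u. u \<in> set us \<Longrightarrow> ?B Row u = 0\<close> by (simp add: nth_append)
    next
      case False
      then obtain j where j: "k = length us + Suc j" using \<open>k \<noteq> length us\<close>
        by (metis add_Suc_right less_iff_Suc_add linorder_neqE_nat)
      then have "L ! j \<in> set L" "j < length L" using \<open>k < length ?M\<close> by auto
      moreover from this m(2) have "L ! j \<noteq> Neg m" by metis
      ultimately show ?thesis using row[of "L ! j"] unfolding j by (simp add: nth_append del: bord.simps)
    qed
    have "pf ?B (Row # ?M) = (\<Sum>k\<in>{length us}. (- 1) ^ k * ?B Row (?M ! k) * pf ?B (del k ?M))"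
      unfolding pf.simps(2)
    proof (rule sum.mono_neutral_right)
      show "\<forall>k\<in>{..<length ?M} - {length us}. (- 1) ^ k * ?B Row (?M ! k) * pf ?B (del k ?M) = 0"
        using z by (auto simp del: bord.simps)
    qed auto
    then show ?thesis
      using row[of "Neg m"] by (simp add: nth_append del_append tconst_mult tconst_neg_1_power del: bord.simps)
  qed
  have sign: "(- 1 :: complex) ^ k * (- 1) ^ m \<in> {1, - 1}" for k
    by (cases "even k"; cases "even m") auto
  show ?thesis
  proof (cases "even (length L)")
    case True
    have "X_op (- int m) (pf_bord (Neg m # L)) = pf ?B (Row # Bd True # Bd False # map Lab (Neg m # L))"
    proof -
      have "pf_bord (Neg m # L) = pf ?B (Bd False # map Lab (Neg m # L))"
        using True by (simp add: pf_bord_def indep image_iff)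
      then show ?thesis by (simp only:) (rule vertex_op_bord[OF vertex_op_X], auto)
    qed
    also have "\<dots> = tconst ((- 1) ^ 2 * (- 1) ^ m) * pf ?B (Bd True # Bd False # map Lab L)"
      using expand[of "[Bd True, Bd False]"] Bd by (auto simp del: bord.simps)
    \<comment> \<open>Both bordering labels have the same entries on \<open>L\<close>. Comparison
      with the vanishing Pfaffian where \<open>Bd False\<close> is repeated therefore leaves only
      the term of their mutual entry 1.\<close>
    also have "pf ?B (Bd True # Bd False # map Lab L) = pf ?B (map Lab L)"
    proof -
      have ex: "pf ?B (Bd y # Bd False # map Lab L) = ?B (Bd y) (Bd False) * pf ?B (map Lab L)
         - (\<Sum>k<length L. (- 1) ^ k * label_q (L ! k) * pf ?B (Bd False # del k (map Lab L)))" for y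
        by (simp add: pf.simps(2)[of _ "Bd y"] sum.lessThan_Suc_shift sum_negf del: sum.lessThan_Suc)
      show ?thesis using ex[of True] ex[of False] b.pf_repeated[of "Bd False" "Bd False # map Lab L"] by simp
    qed
    finally have "X_op (- int m) (pf_bord (Neg m # L)) = tconst ((- 1) ^ 2 * (- 1) ^ m) * pf_bord L"
      unfolding pf_bord_def using True by (simp add: indep image_iff)
    then show ?thesis using sign by blast
  next
    case False
    have "X_op (- int m) (pf_bord (Neg m # L)) = pf ?B (Row # Bd True # map Lab (Neg m # L))"
    proof -
      have "pf_bord (Neg m # L) = pf ?B (map Lab (Neg m # L))"
        using False by (simp add: pf_bord_def indep image_iff)
      then show ?thesis by (simp only:) (rule vertex_op_bord[OF vertex_op_X], auto)
    qed
    also have "\<dots> = tconst ((- 1) ^ 1 * (- 1) ^ m) * pf ?B (Bd True # map Lab L)"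
      using expand[of "[Bd True]"] Bd by (auto simp del: bord.simps)
    also have "pf ?B (Bd True # map Lab L) = pf_bord L"
      unfolding pf_bord_def using False by (simp add: indep image_iff pf_bord_Bd[of _ _ True _ False])
    finally show ?thesis using sign by blast
  qed
qed

lemma vac_pf_bord:
  assumes "distinct ks" "0 \<notin> set ks" "\<And>k. k \<in> set ks \<Longrightarrow> Neg k \<notin> set M"
  shows "\<exists>s\<in>{1, - 1}. word (map (\<lambda>k. - int k) ks) (pf_bord (map Neg (rev ks) @ M)) = tconst s * pf_bord M"
  using assms
proof (induction ks rule: rev_induct)
  case (snoc k ks)
  then obtain s where s: "s \<in> {1, - 1}" "word (map (\<lambda>k. - int k) ks) (pf_bord (map Neg (rev ks) @ M)) = tconst s * pf_bord M"
    by (metis Un_iff distinct_append set_append)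
  have "k > 0" "Neg k \<notin> set (map Neg (rev ks) @ M)" using snoc.prems by (auto intro: Nat.gr0I)
  from X_op_pf_bord[OF this] obtain s' where s': "s' \<in> {1, - 1}"
    "X_op (- int k) (pf_bord (Neg k # map Neg (rev ks) @ M)) = tconst s' * pf_bord (map Neg (rev ks) @ M)"
    by blast
  have "word (map (\<lambda>k. - int k) (ks @ [k])) (pf_bord (map Neg (rev (ks @ [k])) @ M)) = tconst (s' * s) * pf_bord M"
    using s(2) s'(2) by (simp add: word_tconst tconst_mult_assoc)
  moreover have "s' * s \<in> {1, - 1}" using s(1) s'(1) by auto
  ultimately show ?case by blast
qed auto

lemma pf_bord_perm: "mset L = mset M \<Longrightarrow> \<exists>s\<in>{1, - 1}. pf_bord L = s * pf_bord M"
  unfolding pf_bord_def using mset_eq_length[of L M] by (intro bordW.pf_perm) simp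

lemma num_mat_dummy:
  assumes "a \<in> set lam" "b \<in> set lam"
  shows "num_mat lam r (Pos a) (Pos b) = dummy_mat lam (Pos a) (Pos b)"
  using assms by (simp add: num_mat_def pair_mat_def r_mat_def)

lemma dummy_mat_nth:
  assumes i: "i < length lam div 2" and p: "p < length lam" and not: "p \<noteq> 2 * i + 1"
  shows "dummy_mat lam (Pos (lam ! (2 * i + 1))) (Pos (lam ! p)) = (if p = 2 * i then 1 else 0)"
proof -
  have nth: "lam ! u = lam ! v \<longleftrightarrow> u = v" if "u < length lam" "v < length lam" for u v
    using nth_eq_iff_index_eq[OF distinct_lam that] .
  have "dummy_mat lam (Pos (lam ! (2 * i + 1))) (Pos (lam ! p)) = (\<Sum>j = 1..length lam div 2. if j = Suc i then (if p = 2 * i then 1 else 0) else 0)"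
    unfolding dummy_mat_def
  proof (intro sum.cong refl)
    fix j assume j: "j \<in> {1..length lam div 2}"
    then have len: "2 * j - 1 < length lam" "2 * j - 1 - 1 < length lam" "2 * i + 1 < length lam" using i by auto
    have e1: "(Et (Pos (part lam (2 * j))) (Pos (part lam (2 * j - 1))) (Pos (lam ! (2 * i + 1))) (Pos (lam ! p)) :: complex)
      = (if j = Suc i \<and> p = 2 * i then 1 else 0)"
    proof -
      have "lam ! (2 * i + 1) = lam ! (2 * j - 1) \<longleftrightarrow> j = Suc i" "lam ! p = lam ! (2 * j - 1 - 1) \<longleftrightarrow> p = 2 * j - 2"
        using nth[OF len(3) len(1)] nth[OF p len(2)] j by auto
      then show ?thesis unfolding Et_def label.inject by auto
    qed
    have e2: "(Et (Pos (part lam (2 * j - 1))) (Pos (part lam (2 * j))) (Pos (lam ! (2 * i + 1))) (Pos (lam ! p)) :: complex) = 0"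
    proof -
      have "2 * i + 1 \<noteq> 2 * j - 1 - 1" using j by auto presburger
      then have "lam ! (2 * i + 1) \<noteq> lam ! (2 * j - 1 - 1)" using nth[OF len(3) len(2)] by simp
      then show ?thesis unfolding Et_def label.inject by auto
    qed
    show "Et (Pos (part lam (2 * j))) (Pos (part lam (2 * j - 1))) (Pos (lam ! (2 * i + 1))) (Pos (lam ! p))
        - Et (Pos (part lam (2 * j - 1))) (Pos (part lam (2 * j))) (Pos (lam ! (2 * i + 1))) (Pos (lam ! p))
      = (if j = Suc i then (if p = 2 * i then 1 else 0) else (0 :: complex))"
      unfolding e1 e2 by auto
  qed
  also have "\<dots> = (if p = 2 * i then 1 else 0)" using i by (subst sum.delta) auto
  finally show ?thesis .
qed

definition bordW0 :: "elab \<Rightarrow> elab \<Rightarrow> complex"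
  where "bordW0 c d = coeff (bordW c d) {#}"

sublocale bordW0: alternating bordW0
proof
  show "bordW0 c d = - bordW0 d c" for c d
    using arg_cong[OF bordW.skew[of c d], of "\<lambda>f. coeff f {#}"] by (simp only: bordW0_def coeff_uminus)
  show "bordW0 c c = 0" for c by (simp add: bordW0_def bordW.diag)
qed

lemma bordW0_Lab: "bordW0 (Lab c) (Lab d) = num_mat lam r c d"
proof -
  have "coeff (Q_mat c d) {#} = 0" by (cases "(c, d)" rule: Q_mat.cases) (simp_all add: coeff_skewQ_const)
  then show ?thesis by (simp add: bordW0_def bordW_def W_eq coeff_tconst)
qed

lemma bordW0_Bd: "bordW0 (Bd x) (Lab d) = (if d = Neg 0 then 1 else 0)"
  by (cases d) (auto simp: bordW0_def bordW_def coeff_qhat_const)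

definition npairs :: "nat \<Rightarrow> (label \<times> label) list"
  where "npairs n = map (\<lambda>j. (Neg j, Pos j)) (filter (\<lambda>j. j \<notin> set lam) [0..<Suc n])"

definition dpairs :: "(label \<times> label) list"
  where "dpairs = map (\<lambda>i. (Pos (lam ! (2 * i + 1)), Pos (lam ! (2 * i)))) [0..<length lam div 2]"

definition zeros :: "label list"
  where "zeros = (if 0 \<in> set lam then [Neg 0] else [])"

text \<open>The labels that remain after the negatives of the positive parts are struck out, listed
  along the one matching that survives at t = 0. A part 0 leaves -0, which is matched with the
  bordering label.\<close>

definition core :: "nat \<Rightarrow> label list"
  where "core n = zeros @ flat (npairs n @ dpairs)"

lemma mset_trunc_labels: "mset (trunc_labels n) = mset (map Neg [0..<Suc n]) + mset (map Pos [0..<Suc n])"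
  by (induction n) (simp_all add: trunc_labels_0 trunc_labels_Suc)

lemma mset_core:
  assumes "sum_list lam \<le> n"
  shows "mset (map Neg (rev pos_parts) @ core n) = mset (trunc_labels n)"
proof -
  define F where "F = filter (\<lambda>j. j \<notin> set lam) [0..<Suc n]"
  have dp: "dpairs = map (map_prod Pos Pos) (dummies lam)"
    by (simp add: dpairs_def dummies_def)
  have "mset (flat dpairs) = mset (map Pos lam)"
    unfolding dp flat_map using mset_flat_dummies[OF even_length] by (simp del: mset_map add: mset_map)
  moreover have "mset (flat (npairs n)) = mset (map Neg F) + mset (map Pos F)"
    unfolding npairs_def F_def by (rule mset_flat_map)
  moreover have all: "mset lam + mset F = mset [0..<Suc n]"
  proof -
    have "mset lam = mset (filter (\<lambda>j. j \<in> set lam) [0..<Suc n])"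
    proof (subst set_eq_iff_mset_eq_distinct[symmetric])
      show "set lam = set (filter (\<lambda>j. j \<in> set lam) [0..<Suc n])"
      proof -
        have "k < Suc n" if "k \<in> set lam" for k using part_le[OF that] assms by simp
        then show ?thesis by (auto simp del: upt_Suc)
      qed
    qed (use distinct_lam in auto)
    then show ?thesis unfolding F_def by (metis mset_filter multiset_partition)
  qed
  moreover have "mset (map Neg pos_parts) + mset zeros = mset (map Neg lam)"
  proof -
    have "mset pos_parts + (if 0 \<in> set lam then {#0#} else {#}) = mset lam"
    proof (cases "0 \<in> set lam")
      case True
      have "mset (0 # pos_parts) = mset lam"
        by (subst set_eq_iff_mset_eq_distinct[symmetric])
          (use distinct_lam True in \<open>auto simp: pos_parts_def\<close>)
      then show ?thesis using True by simp
    next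
      case False
      then have "pos_parts = lam" unfolding pos_parts_def by (intro filter_True) (auto intro: Nat.gr0I)
      then show ?thesis using False by simp
    qed
    then have "image_mset Neg (mset pos_parts + (if 0 \<in> set lam then {#0#} else {#})) = image_mset Neg (mset lam)" by simp
    then show ?thesis by (simp add: zeros_def split: if_splits)
  qed
  ultimately have "mset (map Neg (rev pos_parts) @ core n) = mset (map Neg lam) + (mset (map Neg F) + mset (map Pos F)) + mset (map Pos lam)"
    unfolding core_def flat_append mset_append mset_map mset_rev by (simp only: add.assoc[symmetric])
  also have "\<dots> = image_mset Neg (mset lam + mset F) + image_mset Pos (mset lam + mset F)"
    by (simp add: add_ac)
  also have "\<dots> = mset (trunc_labels n)"
    unfolding all mset_trunc_labels mset_map ..
  finally show ?thesis .
qed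

text \<open>At t = 0 a label -j with j not a part meets only +j. The entries r_{i,j} involve a
  positive label that is not a part, so they drop out with these pairs, and the pairs of consecutive
  parts remain, each with entry 1.\<close>

lemma pf_core: "coeff (pf_bord (core n)) {#} = 1"
proof -
  let ?P = "npairs n @ dpairs"
  let ?R = "\<lambda>(a, b) (c, d). bordW0 a c = 0 \<and> bordW0 a d = 0"
  let ?LL = "\<lambda>p. map_prod Lab Lab p"
  have Neg: "bordW0 (Lab (Neg j)) (Lab d) = (if d = Pos j then 1 else 0)" if "j \<notin> set lam" for j d
    using that by (cases d) (auto simp: bordW0_Lab num_mat_Neg_Pos[OF even_length])
  have up: "sorted_wrt (<) (filter P [0..<k])" for P :: "nat \<Rightarrow> bool" and k
    by (intro sorted_wrt_filter) simp
  have "sorted_wrt ?R (map ?LL (npairs n))"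
    unfolding npairs_def map_map sorted_wrt_map
    by (rule sorted_wrt_mono_rel[OF _ up]) (auto simp: Neg simp del: upt_Suc)
  moreover have "sorted_wrt ?R (map ?LL dpairs)"
  proof -
    have D: "bordW0 (Lab (Pos (lam ! (2 * i + 1)))) (Lab (Pos (lam ! p))) = 0"
      if "i < length lam div 2" "p < length lam" "p \<noteq> 2 * i" "p \<noteq> 2 * i + 1" for i p
      using that by (simp add: bordW0_Lab num_mat_dummy dummy_mat_nth[of i p, simplified])
    show ?thesis
      unfolding dpairs_def map_map sorted_wrt_map
    proof (rule sorted_wrt_mono_rel[of _ "(<)"])
      fix i j assume "i \<in> set [0..<length lam div 2]" "j \<in> set [0..<length lam div 2]" "i < j"
      then have "i < length lam div 2" "2 * j + 1 < length lam" "2 * j < length lam" "i < j" by auto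
      then show "?R ((?LL \<circ> (\<lambda>i. (Pos (lam ! (2 * i + 1)), Pos (lam ! (2 * i))))) i)
         ((?LL \<circ> (\<lambda>i. (Pos (lam ! (2 * i + 1)), Pos (lam ! (2 * i))))) j)"
        using D[of i "2 * j + 1"] D[of i "2 * j"] by simp
    qed simp
  qed
  moreover have "?R p q" if qhat: "p \<in> set (map ?LL (npairs n))" "q \<in> set (map ?LL dpairs)" for p q
  proof -
    obtain j where p: "p = (Lab (Neg j), Lab (Pos j))" and j: "j \<notin> set lam"
      using qhat(1) by (auto simp: npairs_def simp del: upt_Suc)
    obtain i where q: "q = (Lab (Pos (lam ! (2 * i + 1))), Lab (Pos (lam ! (2 * i))))" and i: "i < length lam div 2"
      using qhat(2) by (auto simp: dpairs_def)
    have "lam ! (2 * i + 1) \<in> set lam" "lam ! (2 * i) \<in> set lam" using i by (auto intro!: nth_mem)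
    then have "lam ! (2 * i + 1) \<noteq> j" "lam ! (2 * i) \<noteq> j" using j by auto
    then show ?thesis unfolding p q using j by (simp add: Neg)
  qed
  ultimately have sorted: "sorted_wrt ?R (map ?LL ?P)"
    by (auto simp: sorted_wrt_append)
  have "pf bordW0 (map Lab (flat ?P)) = (\<Prod>(a, b)\<leftarrow>map ?LL ?P. bordW0 a b)"
    unfolding flat_map[symmetric] by (rule bordW0.pf_flat[OF sorted])
  also have "\<dots> = 1"
  proof -
    have "bordW0 (Lab a) (Lab b) = 1" if ab: "(a, b) \<in> set ?P" for a b
    proof -
      consider j where "j \<notin> set lam" "a = Neg j" "b = Pos j"
        | i where "i < length lam div 2" "a = Pos (lam ! (2 * i + 1))" "b = Pos (lam ! (2 * i))"
        using ab by (auto simp: npairs_def dpairs_def simp del: upt_Suc)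
      then show ?thesis
      proof cases
        case 1
        then show ?thesis by (simp add: Neg)
      next
        case 2
        then have "2 * i + 1 < length lam" "2 * i < length lam" by auto
        with 2 show ?thesis using dummy_mat_nth[of i "2 * i"] by (simp add: bordW0_Lab num_mat_dummy)
      qed
    qed
    then have "map (\<lambda>(a, b). bordW0 a b) (map ?LL ?P) = map (\<lambda>_. 1) (map ?LL ?P)"
      by auto
    then show ?thesis by (simp only: map_replicate_const) simp
  qed
  finally have 1: "pf bordW0 (map Lab (flat ?P)) = 1" .
  have ev: "even (length (flat ps))" for ps :: "(label \<times> label) list"
    by (induction ps) (auto simp: flat_def)
  have bordW0: "coeff (pf bordW L) {#} = pf bordW0 L" for L
    unfolding coeff_pf_const bordW0_def ..
  show ?thesis
  proof (cases "0 \<in> set lam")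
    case False
    then show ?thesis using 1 ev by (simp add: pf_bord_def core_def zeros_def bordW0)
  next
    case True
    have "Neg 0 \<notin> set (flat ?P)"
      using True by (auto simp: flat_def npairs_def dpairs_def simp del: upt_Suc)
    then have "pf bordW0 (Bd False # Lab (Neg 0) # map Lab (flat ?P)) = bordW0 (Bd False) (Lab (Neg 0)) * pf bordW0 (map Lab (flat ?P))"
      by (intro bordW0.pf_pair) (auto simp: bordW0_Bd)
    then show ?thesis using True 1 ev by (simp add: pf_bord_def core_def zeros_def bordW0 bordW0_Bd)
  qed
qed

lemma lam_vac_Pf_inf: "lam_vac (Pf_inf W) \<noteq> 0"
proof -
  \<comment> \<open>Makes the truncation error, of degree above n, too high to leave a constant term
    after the annihilations.\<close>
  define n where "n = sum_list lam + nat \<bar>sum_list (map (\<lambda>k. - int k) pos_parts)\<bar>"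
  have n: "sum_list lam \<le> n" by (simp add: n_def)
  have "lam_vac (Pf_inf W - Pf_trunc W n) = 0"
  proof -
    let ?w = "map (\<lambda>k. - int k) pos_parts"
    have "weight_in (\<lambda>x. int n < x - sum_list ?w) (word ?w (Pf_inf W - Pf_trunc W n))"
      by (rule weight_in_word[OF Pf_inf_approx[OF n]])
    moreover have "\<not> int n < 0 - sum_list ?w" unfolding n_def by linarith
    ultimately show ?thesis by (force simp: weight_in_def vac_def)
  qed
  then have "lam_vac (Pf_inf W) = lam_vac (Pf_trunc W n)"
    using vac_add[of pos_parts "Pf_inf W - Pf_trunc W n" "Pf_trunc W n"] by simp
  also have "Pf_trunc W n = pf_bord (trunc_labels n)"
    unfolding Pf_trunc_eq pf_bord_def bordW_def by (simp add: pf_map_Lab)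
  finally have eq: "lam_vac (Pf_inf W) = lam_vac (pf_bord (trunc_labels n))" .
  obtain s where s: "s \<in> {1, - 1}" "pf_bord (trunc_labels n) = s * pf_bord (map Neg (rev pos_parts) @ core n)"
    using pf_bord_perm[OF mset_core[OF n, symmetric]] by blast
  have "Neg k \<notin> set (core n)" if "k \<in> set pos_parts" for k
    using that by (auto simp: core_def zeros_def flat_def npairs_def dpairs_def pos_parts_def)
  moreover have "distinct pos_parts" "0 \<notin> set pos_parts" using distinct_lam by (auto simp: pos_parts_def)
  ultimately obtain s' where s'': "s' \<in> {1, - 1}"
    "word (map (\<lambda>k. - int k) pos_parts) (pf_bord (map Neg (rev pos_parts) @ core n)) = tconst s' * pf_bord (core n)"
    using vac_pf_bord by blast
  then have s': "s' \<in> {1, - 1}" "lam_vac (pf_bord (map Neg (rev pos_parts) @ core n)) = s' * coeff (pf_bord (core n)) {#}"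
    by (simp_all add: vac_def)
  have "s * f = tconst (if s = 1 then 1 else - 1) * f" for f
    using s(1) by (auto simp: tconst_uminus)
  then have "lam_vac (pf_bord (trunc_labels n)) = (if s = 1 then 1 else - 1) * lam_vac (pf_bord (map Neg (rev pos_parts) @ core n))"
    unfolding s(2) by (metis vac_tconst)
  then show ?thesis unfolding eq s'(2) pf_core using s'(1) by auto
qed

lemma is_BKP_tau_iff:
  "is_BKP_tau lam r \<tau> \<longleftrightarrow> (\<exists>c. c \<noteq> 0 \<and> \<tau> = tconst c * Pf_inf W)"
proof
  let ?f = "Pf_inf W"
  have lin: "X_vec (L_col lam r \<beta>) (f + tconst c * g) = X_vec (L_col lam r \<beta>) f + tconst c * X_vec (L_col lam r \<beta>) g" for \<beta> f c g
    using L_col_Neg by (rule X_vec_additive)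
  {
    assume tau: "is_BKP_tau lam r \<tau>"
    \<comment> \<open>With this ratio the functional of \<lambda> vanishes on the difference, so
      \<open>annihilated_unique\<close> applies.\<close>
    define c where "c = lam_vac \<tau> / lam_vac ?f"
    have "\<tau> + tconst (- c) * ?f = 0"
    proof (rule annihilated_unique)
      fix \<beta> assume "\<beta> \<in> I_set lam" "ival \<beta> \<noteq> 0"
      then show "X_vec (L_col lam r \<beta>) (\<tau> + tconst (- c) * ?f) = 0"
        using tau Pf_inf_annihilated unfolding is_BKP_tau_def annihilated_iff lin by simp
    qed (simp add: vac_add vac_tconst c_def lam_vac_Pf_inf)
    then have "\<tau> = tconst c * ?f" by (simp add: tconst_uminus)
    moreover have "\<tau> \<noteq> 0" using tau by (simp add: is_BKP_tau_def)
    ultimately show "\<exists>c. c \<noteq> 0 \<and> \<tau> = tconst c * ?f" by (metis mult_zero_left tconst_0)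
  }
  assume "\<exists>c. c \<noteq> 0 \<and> \<tau> = tconst c * ?f"
  then obtain c where c: "c \<noteq> 0" "\<tau> = tconst c * ?f" by blast
  have "lam_vac \<tau> \<noteq> 0" using c lam_vac_Pf_inf by (simp add: vac_tconst)
  then have "\<tau> \<noteq> 0" by auto
  moreover have "X_vec (L_col lam r \<beta>) \<tau> = 0" if "\<beta> \<in> I_set lam" "ival \<beta> \<noteq> 0" for \<beta>
  proof -
    have "X_vec (L_col lam r \<beta>) 0 = 0"
      using lin[of \<beta> "?f" "- 1" "?f"] Pf_inf_annihilated[OF that] by (simp add: tconst_uminus)
    then show ?thesis using lin[of \<beta> 0 c ?f] Pf_inf_annihilated[OF that] c(2) by simp
  qed
  ultimately show "is_BKP_tau lam r \<tau>"
    unfolding is_BKP_tau_def annihilated_iff by blast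
qed

end

theorem theorem1p3:
  fixes lam :: "nat list" and r :: "int \<Rightarrow> int \<Rightarrow> complex"
  assumes "sorted_wrt (>) lam" and "even (length lam)"
  shows "convergent (Pf_trunc (W_mat lam r)) \<and>
    (\<forall>\<tau>. is_BKP_tau lam r \<tau> \<longleftrightarrow>
      (\<exists>c. c \<noteq> 0 \<and> \<tau> = tconst c * Pf_inf (W_mat lam r)))"
proof -
  interpret strict_partition lam r using assms by unfold_locales
  show ?thesis using Pf_limit is_BKP_tau_iff by blast
qed

end
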